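(* Let $p\ge 5$ be a prime. Let $G$ be a plane graph of girth $p$ containing no cycle of length $\ell$ for any $p+1\le \ell\le 2(p-1)(p+2)-1$, let $C$ be a $p$-cycle of $G$, and let $\omega:V(C)\to\{0,\dots,p-1\}$ be a $C_p$-coloring of the induced subgraph $G[V(C)]$. Then $\omega$ extends to a $C_p$-coloring of $G$.
   Context: A $C_p$-coloring of a graph $H$ is a map $\varphi:V(H)\to\{0,\dots,p-1\}$ with $\frac{p-1}{2}\le|\varphi(u)-\varphi(v)|\le\frac{p+1}{2}$ for every edge $uv$. The girth of a graph is the length of its shortest cycle. *)

theory Defs
  imports
    "HOL-Analysis.Analysis"
    "HOL-Library.Extended_Nat"
    "HOL-Computational_Algebra.Primes"
begin

locale finite_simple_graph =
  fixes V :: "'a set" and E :: "'a set set"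
  assumes finite_verts: "finite V"
    and edge_subset: "e \<in> E \<Longrightarrow> e \<subseteq> V"
    and edge_card: "e \<in> E \<Longrightarrow> card e = 2"

text \<open>
  A graph together with a drawing in the plane, which is identified with the complex numbers.
  The interior of an edge is its arc without the two end points; it contains no vertex and no point
  of any other edge.
\<close>

locale plane_graph = finite_simple_graph V E
  for V :: "'a set" and E :: "'a set set" +
  fixes pos :: "'a \<Rightarrow> complex" and \<gamma> :: "'a set \<Rightarrow> real \<Rightarrow> complex"
  assumes inj_pos: "inj_on pos V"
    and edge_arc: "e \<in> E \<Longrightarrow> arc (\<gamma> e)"
    and edge_ends: "e \<in> E \<Longrightarrow> {pathstart (\<gamma> e), pathfinish (\<gamma> e)} = pos ` e"
    and interior_vertex: "e \<in> E \<Longrightarrow> (path_image (\<gamma> e) - pos ` e) \<inter> pos ` V = {}"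
    and interior_edge:
      "e \<in> E \<Longrightarrow> f \<in> E \<Longrightarrow> e \<noteq> f \<Longrightarrow> (path_image (\<gamma> e) - pos ` e) \<inter> path_image (\<gamma> f) = {}"

text \<open>
  A cycle is given by the list of its vertices in cyclic order, without repeating the first one, so
  its length (number of edges) is the length of the list.
\<close>

definition is_cycle :: "'a set set \<Rightarrow> 'a list \<Rightarrow> bool" where
  "is_cycle E c \<longleftrightarrow> length c \<ge> 3 \<and> distinct c \<and>
     (\<forall>i<length c. {c ! i, c ! (Suc i mod length c)} \<in> E)"

text \<open>The girth of an acyclic graph is \<open>\<infinity>\<close>.\<close>

definition girth :: "'a set set \<Rightarrow> enat" where
  "girth E = (INF c\<in>{c. is_cycle E c}. enat (length c))"

definition induced_edges :: "'a set set \<Rightarrow> 'a set \<Rightarrow> 'a set set" where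
  "induced_edges E W = {e \<in> E. e \<subseteq> W}"

text \<open>Only the values of \<open>\<phi>\<close> on \<open>V\<close> matter.\<close>

definition Cp_coloring :: "nat \<Rightarrow> 'a set \<Rightarrow> 'a set set \<Rightarrow> ('a \<Rightarrow> nat) \<Rightarrow> bool" where
  "Cp_coloring p V E \<phi> \<longleftrightarrow> \<phi> ` V \<subseteq> {0..p - 1} \<and>
     (\<forall>u v. {u, v} \<in> E \<longrightarrow>
        (real p - 1) / 2 \<le> \<bar>real (\<phi> u) - real (\<phi> v)\<bar> \<and>
        \<bar>real (\<phi> u) - real (\<phi> v)\<bar> \<le> (real p + 1) / 2)"

end

theory Submission
  imports Defs "HOL-Number_Theory.Cong" "HOL-Complex_Analysis.Contour_Integration"
begin

text \<open>
  After doubling the colors, a \<open>C\<^sub>p\<close>-coloring is a map to the integers modulo \<open>p\<close> that changes by \<open>\<plusminus>1\<close> along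
  every edge. Such a map is rigid on a \<open>p\<close>-cycle, where it is \<open>i \<mapsto> x + \<epsilon> i\<close> with \<open>\<epsilon> = \<plusminus>1\<close>, and the
  \<open>p\<close>-cycles are pairwise edge-disjoint. If some \<open>p\<close>-cycle has edges on both of its sides, color one
  side first and extend the coloring to the other side; so assume that every \<open>p\<close>-cycle bounds a face.

  Along a chain of \<open>l\<close> edges and \<open>k\<close> of the \<open>p\<close>-cycles, the set of displacements realized between its
  ends has at least \<open>min p (l + k + 1)\<close> elements, because adding a two-element set enlarges every proper
  nonempty set of residues. So a branching vertex or \<open>p\<close>-cycle whose incident chains are long can be
  removed and colored last. If nothing can be removed, then degree counting contradicts Euler's
  formula, in which every face that is not a \<open>p\<close>-cycle has at least \<open>2 (p - 1) (p + 2)\<close> edges.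
\<close>

section \<open>Sets of residues\<close>

text \<open>Removing or suppressing nodes leaves the class of plane graphs without short cycles. The
  coloring is therefore built on abstract networks. Of a chain they keep a set of displacements, an
  expansion number and a weight; of planarity they keep only the inequality \<open>sparse\<close>,
  for every subnetwork. The precolored cycle is a root node with prescribed state that is never
  removed, so its degree is not controlled. The constant comes from the final count. Let
  \<open>m\<close> be the number of edges, \<open>k\<close> the number of nodes besides the root,
  \<open>d\<close> the degree of the root and \<open>S\<close> the sum of the expansion numbers. If
  nothing can be reduced, then \<open>3k + d \<le> 2m\<close> and
  \<open>pk + d \<le> 2m(p-1) - 2S\<close>, while sparsity gives
  \<open>N(m-k) \<le> pS + p(k+1)\<close>. For \<open>N = 2(p-1)(p+2)\<close>, eliminating
  \<open>S\<close> and \<open>m\<close> cancels the quadratic terms in the coefficient of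
  \<open>k\<close> and leaves \<open>k(3p-4) + d(p^2+4p-4) \<le> 2p\<close>, which is impossible for
  \<open>k \<ge> 1\<close> and \<open>p \<ge> 5\<close>.\<close>

definition residues :: "nat \<Rightarrow> int set \<Rightarrow> int set" where
  "residues p X = (\<lambda>x. x mod int p) ` X"

definition sumset :: "int set \<Rightarrow> int set \<Rightarrow> int set" where
  "sumset X Y = {x + y | x y. x \<in> X \<and> y \<in> Y}"

text \<open>The growth bound of the Cauchy-Davenport theorem taken as a property of
  \<open>A\<close>. Demanding it for every \<open>X\<close> makes it additive under
  \<open>sumset\<close>, so primality is needed only for two-element sets.\<close>

definition expanding :: "nat \<Rightarrow> int set \<Rightarrow> nat \<Rightarrow> bool" where
  "expanding p A s \<longleftrightarrow>
     (\<forall>X. X \<noteq> {} \<longrightarrow> min p (card (residues p X) + s) \<le> card (residues p (sumset X A)))"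

lemma residues_subset: "p > 0 \<Longrightarrow> residues p X \<subseteq> {0..<int p}"
  unfolding residues_def by auto

lemma finite_residues: "p > 0 \<Longrightarrow> finite (residues p X)"
  by (rule finite_subset[OF residues_subset]) auto

lemma sumset_assoc: "sumset (sumset X Y) Z = sumset X (sumset Y Z)"
  unfolding sumset_def by (auto simp: add.assoc) (metis add.assoc)+

lemma sumset_nonempty: "X \<noteq> {} \<Longrightarrow> Y \<noteq> {} \<Longrightarrow> sumset X Y \<noteq> {}"
  unfolding sumset_def by auto

lemma expanding_nonempty:
  assumes "p > 0" "expanding p A s" shows "A \<noteq> {}"
proof
  assume "A = {}"
  moreover have "min p (card (residues p {0}) + s) \<le> card (residues p (sumset {0} A))"
    using assms(2) unfolding expanding_def by blast
  ultimately show False using assms(1) by (simp add: residues_def sumset_def)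
qed

lemma expanding_card:
  assumes "expanding p A s"
  shows "min p (s + 1) \<le> card (residues p A)"
proof -
  have "min p (card (residues p {0}) + s) \<le> card (residues p (sumset {0} A))"
    using assms unfolding expanding_def by blast
  thus ?thesis by (simp add: residues_def sumset_def)
qed

lemma expanding_sumset:
  assumes "p > 0" "expanding p A s" "expanding p B t"
  shows "expanding p (sumset A B) (s + t)"
  unfolding expanding_def
proof (intro allI impI)
  fix X :: "int set" assume X: "X \<noteq> {}"
  have "min p (card (residues p X) + s) \<le> card (residues p (sumset X A))"
    using assms(2) X unfolding expanding_def by blast
  moreover have "min p (card (residues p (sumset X A)) + t) \<le> card (residues p (sumset (sumset X A) B))"
    using assms(3) sumset_nonempty[OF X expanding_nonempty[OF assms(1,2)]]
    unfolding expanding_def by blast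
  ultimately show "min p (card (residues p X) + (s + t)) \<le> card (residues p (sumset X (sumset A B)))"
    unfolding sumset_assoc by linarith
qed

lemma card_residues_image:
  assumes "inj_on (\<lambda>x. h x mod int p) {0..<int p}"
    and "\<And>x. h x mod int p = h (x mod int p) mod int p" and "p > 0"
  shows "card (residues p (h ` X)) = card (residues p X)"
proof -
  have "residues p (h ` X) = (\<lambda>x. h x mod int p) ` residues p X"
    unfolding residues_def image_image using assms(2) by (intro image_cong) auto
  thus ?thesis
    using card_image[OF inj_on_subset[OF assms(1) residues_subset[OF assms(3)]]] by simp
qed

lemma card_residues_translate:
  assumes "p > 0"
  shows "card (residues p ((\<lambda>x. x + d) ` X)) = card (residues p X)"
proof (rule card_residues_image[OF _ _ assms])
  show "inj_on (\<lambda>x. (x + d) mod int p) {0..<int p}"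
  proof (rule inj_onI)
    fix x y assume "x \<in> {0..<int p}" "y \<in> {0..<int p}" "(x + d) mod int p = (y + d) mod int p"
    thus "x = y" using cong_add_rcancel[of x d y "int p"] by (simp add: cong_def)
  qed
qed (simp add: mod_simps)

lemma card_residues_uminus:
  assumes "p > 0"
  shows "card (residues p (uminus ` X)) = card (residues p X)"
proof (rule card_residues_image[OF _ _ assms])
  show "inj_on (\<lambda>x. (- x) mod int p) {0..<int p}"
  proof (rule inj_onI)
    fix x y assume "x \<in> {0..<int p}" "y \<in> {0..<int p}" "(- x) mod int p = (- y) mod int p"
    thus "x = y" using cong_minus_minus_iff[of x y "int p"] by (simp add: cong_def)
  qed
qed (simp add: mod_simps)

text \<open>Reading an edge from its other end negates the permitted differences. The bound follows
  by negating \<open>X\<close> instead of \<open>A\<close>.\<close>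

lemma expanding_uminus:
  assumes "p > 0" "expanding p A s"
  shows "expanding p (uminus ` A) s"
  unfolding expanding_def
proof (intro allI impI)
  fix X :: "int set" assume X: "X \<noteq> {}"
  have "sumset (uminus ` X) A = uminus ` sumset X (uminus ` A)"
  proof (intro equalityI subsetI)
    fix z assume "z \<in> sumset (uminus ` X) A"
    then obtain x a where xa: "x \<in> X" "a \<in> A" "z = - x + a" unfolding sumset_def by blast
    hence "x + - a \<in> sumset X (uminus ` A)" unfolding sumset_def by blast
    thus "z \<in> uminus ` sumset X (uminus ` A)" using xa by (intro image_eqI[of _ _ "x + - a"]) auto
  next
    fix z assume "z \<in> uminus ` sumset X (uminus ` A)"
    then obtain x a where xa: "x \<in> X" "a \<in> A" "z = - (x + - a)" unfolding sumset_def by blast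
    hence "z = - x + a" by simp
    thus "z \<in> sumset (uminus ` X) A" using xa unfolding sumset_def by blast
  qed
  moreover have "min p (card (residues p (uminus ` X)) + s) \<le> card (residues p (sumset (uminus ` X) A))"
    using assms(2)[unfolded expanding_def, rule_format, of "uminus ` X"] X by simp
  ultimately show "min p (card (residues p X) + s) \<le> card (residues p (sumset X (uminus ` A)))"
    by (simp add: card_residues_uminus[OF assms(1)])
qed

lemma expanding_0:
  assumes "p > 0" "A \<noteq> {}" shows "expanding p A 0"
  unfolding expanding_def
proof (intro allI impI)
  fix X :: "int set" assume X: "X \<noteq> {}"
  obtain a where "a \<in> A" using assms by blast
  hence "(\<lambda>x. x + a) ` X \<subseteq> sumset X A" unfolding sumset_def by auto
  hence "residues p ((\<lambda>x. x + a) ` X) \<subseteq> residues p (sumset X A)" unfolding residues_def by blast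
  from card_mono[OF finite_residues[OF assms(1)] this]
  show "min p (card (residues p X) + 0) \<le> card (residues p (sumset X A))"
    by (simp add: card_residues_translate[OF assms(1)])
qed

text \<open>The bound can only fail if \<open>X\<close> is invariant under translation by \<open>x - y\<close> modulo \<open>p\<close>, and then \<open>X\<close>
  contains all residues.\<close>

lemma expanding_doubleton:
  assumes p: "prime p" and xy: "\<not> [x = y] (mod int p)"
  shows "expanding p {x, y} 1"
  unfolding expanding_def
proof (intro allI impI)
  fix X :: "int set" assume X: "X \<noteq> {}"
  have p0: "p > 0" using p prime_gt_0_nat by blast
  define U where "U = residues p ((\<lambda>t. t + x) ` X)"
  define W where "W = residues p ((\<lambda>t. t + y) ` X)"
  have un: "residues p (sumset X {x, y}) = U \<union> W"
    unfolding U_def W_def residues_def sumset_def by auto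
  have fin: "finite U" "finite W" unfolding U_def W_def by (simp_all add: finite_residues[OF p0])
  have cU: "card U = card (residues p X)" and cW: "card W = card (residues p X)"
    unfolding U_def W_def by (simp_all add: card_residues_translate[OF p0])
  show "min p (card (residues p X) + 1) \<le> card (residues p (sumset X {x, y}))"
  proof (cases "U = W")
    case False
    have "card U < card (U \<union> W)"
    proof (rule psubset_card_mono)
      show "finite (U \<union> W)" using fin by simp
      have "\<not> W \<subseteq> U" using card_seteq[of U W] fin cU cW False by auto
      thus "U \<subset> U \<union> W" by blast
    qed
    thus ?thesis unfolding un using cU by simp
  next
    case True
    define R where "R = residues p X"
    have step: "(z + (x - y)) mod int p \<in> R" if zR: "z \<in> R" for z
    proof -
      obtain t where t: "t \<in> X" "z = t mod int p" using zR unfolding R_def residues_def by blast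
      have "(t + x) mod int p \<in> W" using t True[symmetric] unfolding U_def residues_def by auto
      then obtain t' where t': "t' \<in> X" "(t + x) mod int p = (t' + y) mod int p"
        unfolding W_def residues_def by auto
      have "[t + x - y = t' + y - y] (mod int p)"
        using t'(2) by (intro cong_diff) (auto simp: cong_def)
      hence "(t + (x - y)) mod int p = t' mod int p" by (simp add: cong_def algebra_simps)
      thus ?thesis using t' t unfolding R_def residues_def by (auto simp: mod_simps)
    qed
    have iter: "(z + int k * (x - y)) mod int p \<in> R" if "z \<in> R" for z k
    proof (induction k)
      case 0
      have "z mod int p = z" using that unfolding R_def residues_def by auto
      thus ?case using that by simp
    next
      case (Suc k)
      have "((z + int k * (x - y)) mod int p + (x - y)) mod int p = (z + int (Suc k) * (x - y)) mod int p"
        by (subst mod_add_left_eq) (simp add: algebra_simps)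
      thus ?case using step[OF Suc] by simp
    qed
    obtain z where z: "z \<in> R" using X unfolding R_def residues_def by auto
    have "{0..<int p} \<subseteq> R"
    proof
      fix r assume r: "r \<in> {0..<int p}"
      have "\<not> int p dvd x - y" using xy by (simp add: cong_iff_dvd_diff)
      moreover have "prime (int p)" using p by simp
      ultimately have "coprime (int p) (x - y)" by (rule prime_imp_coprime[rotated])
      hence "coprime (x - y) (int p)" by (simp add: coprime_commute)
      then obtain k0 where k0: "[(x - y) * k0 = 1] (mod int p)"
        using cong_solve_coprime_int by blast
      \<comment> \<open>\<open>x - y\<close> is invertible modulo the prime \<open>p\<close>, so
        some number of steps leads from \<open>z\<close> to \<open>r\<close>. Reducing it modulo
        \<open>p\<close> makes it a natural number.\<close>
      define k where "k = k0 * (r - z)"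
      have k: "[(x - y) * k = r - z] (mod int p)"
        using cong_scalar_right[OF k0, of "r - z"] by (simp add: k_def mult.assoc)
      define k' where "k' = nat (k mod int p)"
      have k': "int k' = k mod int p" unfolding k'_def using p0 by simp
      have "[z + int k' * (x - y) = z + (r - z)] (mod int p)"
        using k unfolding k' by (intro cong_add) (auto simp: cong_def mod_simps mult.commute)
      hence "(z + int k' * (x - y)) mod int p = r" using r by (simp add: cong_def)
      thus "r \<in> R" using iter[OF z, of k'] by simp
    qed
    hence "card R \<ge> p" using card_mono[OF finite_residues[OF p0], of "{0..<int p}" X] unfolding R_def by simp
    thus ?thesis unfolding un using cU card_mono[of "U \<union> W" U] fin unfolding R_def by simp
  qed
qed

section \<open>Constraint networks\<close>

text \<open>The state of a node \<open>v\<close> is \<open>(x v, \<epsilon> v)\<close> with \<open>\<epsilon> v = \<plusminus>1\<close>. An edge \<open>e\<close> has the ends \<open>nd e False\<close> and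
  \<open>nd e True\<close>; it sees the value \<open>x + \<epsilon> \<cdot> off e b\<close> at its end \<open>b\<close>, and \<open>A e\<close> is the set of permitted
  differences of these two values.\<close>

definition satisfied ::
  "nat \<Rightarrow> ('e \<Rightarrow> bool \<Rightarrow> 'b) \<Rightarrow> ('e \<Rightarrow> bool \<Rightarrow> int) \<Rightarrow> ('e \<Rightarrow> int set) \<Rightarrow> ('b \<Rightarrow> int) \<Rightarrow> ('b \<Rightarrow> int) \<Rightarrow> 'e \<Rightarrow> bool"
  where "satisfied p nd off A x \<epsilon> e \<longleftrightarrow>
    (\<exists>a\<in>A e. [x (nd e False) + \<epsilon> (nd e False) * off e False + a
      = x (nd e True) + \<epsilon> (nd e True) * off e True] (mod int p))"

text \<open>The permitted differences when the edge is read from its end \<open>b\<close> towards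
  \<open>\<not> b\<close>; the sets \<open>A e\<close> are stated for the reading from
  \<open>False\<close> to \<open>True\<close>.\<close>

definition directed :: "bool \<Rightarrow> int set \<Rightarrow> int set" where
  "directed b S = (if b then uminus ` S else S)"

lemma satisfied_iff:
  "satisfied p nd off A x \<epsilon> e \<longleftrightarrow>
    (\<exists>a\<in>directed b (A e). [x (nd e b) + \<epsilon> (nd e b) * off e b + a
      = x (nd e (\<not> b)) + \<epsilon> (nd e (\<not> b)) * off e (\<not> b)] (mod int p))"
proof (cases b)
  case True
  have "[u + a = v] (mod int p) \<longleftrightarrow> [v + - a = u] (mod int p)" for u v a
    by (metis (no_types, opaque_lifting) add.commute add.right_inverse cong_add_lcancel_0
        add.assoc add_0_right cong_add_rcancel cong_sym_eq diff_add_cancel diff_conv_add_uminus)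
  thus ?thesis using True unfolding satisfied_def directed_def by auto
qed (simp add: satisfied_def directed_def)

lemma expanding_directed: "p > 0 \<Longrightarrow> expanding p A s \<Longrightarrow> expanding p (directed b A) s"
  unfolding directed_def by (simp add: expanding_uminus)

text \<open>The trace of Euler's formula on a network. The weight of an edge is the number of sides of graph
  edges on the faces that are not \<open>p\<close>-cycles, for the chain of edges and \<open>p\<close>-cycles it stands for: \<open>2\<close>
  for a graph edge and \<open>p\<close> for a \<open>p\<close>-cycle. The nodes in \<open>T\<close> stand for \<open>p\<close>-cycles.\<close>

definition sparse ::
  "nat \<Rightarrow> nat \<Rightarrow> 'b set \<Rightarrow> 'e set \<Rightarrow> 'b set \<Rightarrow> ('e \<Rightarrow> bool \<Rightarrow> 'b) \<Rightarrow> ('e \<Rightarrow> nat) \<Rightarrow> bool"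
  where "sparse p N B E T nd w \<longleftrightarrow>
    (\<forall>B' E'. B' \<subseteq> B \<longrightarrow> B' \<noteq> {} \<longrightarrow> E' \<subseteq> E \<longrightarrow> (\<forall>e\<in>E'. \<forall>b. nd e b \<in> B') \<longrightarrow>
       int N * (int (card E') + 1 - int (card B')) \<le> int (sum w E' + p * card (B' \<inter> T)))"

text \<open>What deletion and suppression preserve. A chain with \<open>l\<close> edges and
  \<open>k\<close> of the \<open>p\<close>-cycles has \<open>s = l + k\<close> and
  \<open>w = 2 * l + p * k\<close>, whence \<open>w e \<le> p * s e\<close>. Distinct edges attach
  to a rigid node at different offsets, so that its two orientations give different displacements
  between them. The \<open>+ 1\<close> in \<open>sparse\<close>, against \<open>+ 2\<close> in
  Euler's formula, gives up one face; for the \<open>N\<close> in use, a single node without edges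
  would violate the stronger form.\<close>

definition network ::
  "nat \<Rightarrow> nat \<Rightarrow> 'b set \<Rightarrow> 'e set \<Rightarrow> 'b set \<Rightarrow> ('e \<Rightarrow> bool \<Rightarrow> 'b) \<Rightarrow> ('e \<Rightarrow> bool \<Rightarrow> int) \<Rightarrow>
   ('e \<Rightarrow> int set) \<Rightarrow> ('e \<Rightarrow> nat) \<Rightarrow> ('e \<Rightarrow> nat) \<Rightarrow> bool"
  where "network p N B E T nd off A s w \<longleftrightarrow>
    finite B \<and> finite E \<and> (\<forall>e\<in>E. \<forall>b. nd e b \<in> B) \<and>
    (\<forall>e\<in>E. expanding p (A e) (s e) \<and> w e \<le> p * s e) \<and>
    (\<forall>e\<in>E. \<forall>e'\<in>E. \<forall>b b'. e \<noteq> e' \<longrightarrow> nd e b = nd e' b' \<longrightarrow> nd e b \<in> T \<longrightarrow>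
       \<not> [off e b = off e' b'] (mod int p)) \<and>
    sparse p N B E T nd w"

lemma sparseD:
  assumes "sparse p N B E T nd w" "B' \<subseteq> B" "B' \<noteq> {}" "E' \<subseteq> E" "\<And>e b. e \<in> E' \<Longrightarrow> nd e b \<in> B'"
  shows "int N * (int (card E') + 1 - int (card B')) \<le> int (sum w E' + p * card (B' \<inter> T))"
  using assms unfolding sparse_def by simp

lemma network_delete:
  assumes "network p N B E T nd off A s w" "B' \<subseteq> B" "E' \<subseteq> E" "\<And>e b. e \<in> E' \<Longrightarrow> nd e b \<in> B'"
  shows "network p N B' E' T nd off A s w"
proof -
  have "sparse p N B' E' T nd w"
    using assms unfolding network_def sparse_def by (meson order_trans)
  moreover have "finite B'" "finite E'"
    using assms(1-3) unfolding network_def by (auto intro: finite_subset)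
  ultimately show ?thesis using assms unfolding network_def by (metis subsetD)
qed

text \<open>An expansion number of at least \<open>p - 1\<close> makes the permitted differences
  exhaust all residues, so such an edge constrains nothing.\<close>

lemma satisfied_full:
  assumes p: "p > 0" and A: "expanding p (A e) (s e)" and s: "s e \<ge> p - 1"
  shows "satisfied p nd off A x \<epsilon> e"
proof -
  define u where "u = x (nd e True) + \<epsilon> (nd e True) * off e True
     - (x (nd e False) + \<epsilon> (nd e False) * off e False)"
  have "card {0..<int p} \<le> card (residues p (A e))"
    using expanding_card[OF A] s p by simp
  hence "residues p (A e) = {0..<int p}"
    using card_seteq[of "{0..<int p}"] residues_subset[OF p] by blast
  hence "u mod int p \<in> residues p (A e)" using p by simp
  then obtain a where a: "a \<in> A e" "[a = u] (mod int p)"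
    unfolding residues_def cong_def by auto
  have "[x (nd e False) + \<epsilon> (nd e False) * off e False + a
     = x (nd e False) + \<epsilon> (nd e False) * off e False + u] (mod int p)"
    using a(2) cong_add_lcancel by blast
  thus ?thesis using a(1) unfolding satisfied_def u_def by auto
qed

text \<open>By expansion each constraint admits at least \<open>s i + 1\<close> residues, so it
  forbids at most \<open>p - 1 - s i\<close>. If these deficiencies sum to less than
  \<open>p\<close>, some residue is forbidden by none.\<close>

lemma residue_avoiding:
  assumes p: "p > 0" and fin: "finite I"
    and ex: "\<And>i. i \<in> I \<Longrightarrow> expanding p (S i) (s i) \<and> s i \<le> p - 1"
    and less: "(\<Sum>i\<in>I. p - 1 - s i) < p"
  shows "\<exists>z. \<forall>i\<in>I. \<exists>a\<in>S i. [c i + a = z] (mod int p)"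
proof -
  define good where "good i = residues p ((\<lambda>a. a + c i) ` S i)" for i
  define bad where "bad i = {0..<int p} - good i" for i
  have "card (bad i) \<le> p - 1 - s i" if "i \<in> I" for i
  proof -
    have "card (bad i) = p - card (good i)"
      unfolding bad_def using residues_subset[OF p] finite_residues[OF p]
      by (subst card_Diff_subset) (auto simp: good_def)
    moreover have "card (good i) = card (residues p (S i))"
      unfolding good_def by (rule card_residues_translate[OF p])
    moreover have "card (residues p (S i)) \<ge> s i + 1"
      using expanding_card[of p "S i" "s i"] ex[OF that] p by linarith
    ultimately show ?thesis by linarith
  qed
  hence "(\<Sum>i\<in>I. card (bad i)) < p"
    using less by (rule_tac le_less_trans[OF sum_mono])
  moreover have "card (\<Union>i\<in>I. bad i) \<le> (\<Sum>i\<in>I. card (bad i))"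
    using card_UN_le[OF fin] .
  ultimately have "card (\<Union>i\<in>I. bad i) < card {0..<int p}" by simp
  hence "\<not> {0..<int p} \<subseteq> (\<Union>i\<in>I. bad i)"
    using card_mono[of "\<Union>i\<in>I. bad i" "{0..<int p}"] fin unfolding bad_def by fastforce
  then obtain z where z: "z \<in> {0..<int p}" "\<And>i. i \<in> I \<Longrightarrow> z \<in> good i"
    unfolding bad_def by blast
  have "\<exists>a\<in>S i. [c i + a = z] (mod int p)" if i: "i \<in> I" for i
  proof -
    obtain a where "a \<in> S i" "z = (a + c i) mod int p"
      using z(2)[OF i] unfolding good_def residues_def by auto
    thus ?thesis unfolding cong_def by (auto simp: add.commute intro!: bexI[of _ a])
  qed
  thus ?thesis by blast
qed

section \<open>Reductions of networks and the final count\<close>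

definition incident :: "('e \<Rightarrow> bool \<Rightarrow> 'b) \<Rightarrow> 'e set \<Rightarrow> 'b \<Rightarrow> 'e set" where
  "incident nd E v = {e \<in> E. \<exists>b. nd e b = v}"

text \<open>Double counting over the two ends of each edge. Loops must be excluded, since
  \<open>incident\<close> would count them only once.\<close>

lemma sum_incident:
  fixes g :: "'e \<Rightarrow> nat"
  assumes "finite B" "finite E" "\<And>e b. e \<in> E \<Longrightarrow> nd e b \<in> B"
    and "\<And>e. e \<in> E \<Longrightarrow> nd e False \<noteq> nd e True"
  shows "(\<Sum>v\<in>B. sum g (incident nd E v)) = 2 * sum g E"
proof -
  have "(\<Sum>v\<in>B. sum g (incident nd E v)) = (\<Sum>v\<in>B. \<Sum>e\<in>E. if \<exists>b. nd e b = v then g e else 0)"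
    unfolding incident_def by (rule sum.cong[OF refl]) (simp add: sum.inter_filter assms(2))
  also have "\<dots> = (\<Sum>e\<in>E. \<Sum>v\<in>B. if \<exists>b. nd e b = v then g e else 0)"
    by (rule sum.swap)
  also have "\<dots> = (\<Sum>e\<in>E. 2 * g e)"
  proof (intro sum.cong refl)
    fix e assume e: "e \<in> E"
    have "{v \<in> B. \<exists>b. nd e b = v} = {nd e False, nd e True}"
      using assms(3)[OF e] by auto (metis (full_types))+
    hence "card {v \<in> B. \<exists>b. nd e b = v} = 2" using assms(4)[OF e] by simp
    moreover have "(\<Sum>v\<in>B. if \<exists>b. nd e b = v then g e else 0) = card {v \<in> B. \<exists>b. nd e b = v} * g e"
      using assms(1) by (simp add: sum.inter_filter[symmetric])
    ultimately show "(\<Sum>v\<in>B. if \<exists>b. nd e b = v then g e else 0) = 2 * g e" by simp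
  qed
  also have "\<dots> = 2 * sum g E" by (simp add: sum_distrib_left)
  finally show ?thesis .
qed

text \<open>\<open>m\<close> counts the edges, \<open>k\<close> the nodes besides the root,
  \<open>d\<close> is the degree of the root and \<open>S\<close> the sum of the expansion numbers.
  The \<open>k + 1\<close> allows for every node, the root included, to be rigid.\<close>

lemma counting_contradiction:
  fixes p m k S W d :: int
  assumes p: "p \<ge> 5" and k: "k \<ge> 1" and d: "d \<ge> 0"
    and deg: "3 * k + d \<le> 2 * m"
    and S: "2 * m * (p - 1) - 2 * S \<ge> p * k + d"
    and W: "2 * (p - 1) * (p + 2) * (m - k) \<le> W" "W \<le> p * S + p * (k + 1)"
  shows False
proof -
  have "2 * W \<le> p * (2 * S) + 2 * p * (k + 1)" using W(2) by (simp add: algebra_simps)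
  also have "p * (2 * S) \<le> p * (2 * m * (p - 1) - p * k - d)"
    using S p by (intro mult_left_mono) auto
  finally have 1: "4 * (p - 1) * (p + 2) * (m - k) \<le> p * (2 * m * (p - 1) - p * k - d) + 2 * p * (k + 1)"
    using W(1) by (simp add: algebra_simps)
  \<comment> \<open>This is \<open>(p - 1) * (p + 4)\<close>, the coefficient that
    \<open>2 * m\<close> gets once all terms in \<open>m\<close> are on the left. It must be
    nonnegative for the degree bound to replace \<open>2 * m\<close> by
    \<open>3 * k + d\<close>.\<close>
  have pp: "p * p + 3 * p - 4 \<ge> 0" using p zero_le_square[of p] by linarith
  have "(p * p + 3 * p - 4) * (3 * k + d) \<le> (p * p + 3 * p - 4) * (2 * m)"
    using deg pp by (intro mult_left_mono) linarith+
  with 1 have 2: "k * (3 * p - 4) + d * (p * p + 4 * p - 4) \<le> 2 * p"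
    by (simp add: algebra_simps)
  define u where "u = k * (3 * p - 4)"
  define t where "t = d * (p * p + 4 * p - 4)"
  have "p * p + 4 * p - 4 \<ge> 0" using p pp by linarith
  hence "t \<ge> 0" unfolding t_def using d by (intro mult_nonneg_nonneg)
  moreover have "3 * p - 4 \<le> u" unfolding u_def using mult_right_mono[OF k, of "3 * p - 4"] p by simp
  moreover have "u + t \<le> 2 * p" using 2 unfolding u_def t_def .
  ultimately have "3 * p - 4 \<le> 2 * p" by linarith
  thus False using p by linarith
qed

text \<open>Suppressing a node of degree two: the constraints on its two edges compose, and a rigid node
  contributes one more step because its two orientations give two different displacements.\<close>

lemma network_suppress:
  assumes net: "network p N B E T nd off A s w" and p: "prime p" "odd p"
    and e: "e1 \<in> E" "e2 \<in> E" "e1 \<noteq> e2" and inc: "incident nd E v = {e1, e2}"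
    and b: "nd e1 b1 = v" "nd e2 b2 = v" and other: "nd e1 (\<not> b1) \<noteq> v" "nd e2 (\<not> b2) \<noteq> v"
  obtains nd' off' A' s' w' where
    "network p N (B - {v}) (E - {e2}) T nd' off' A' s' w'"
    "\<And>x \<epsilon>. \<forall>u. \<epsilon> u = 1 \<or> \<epsilon> u = -1 \<Longrightarrow> \<forall>e\<in>E - {e2}. satisfied p nd' off' A' x \<epsilon> e \<Longrightarrow>
       \<exists>z \<eta>. (\<eta> = 1 \<or> \<eta> = -1) \<and> (\<forall>e\<in>E. satisfied p nd off A (x(v := z)) (\<epsilon>(v := \<eta>)) e)"
proof -
  have p0: "p > 0" using p prime_gt_0_nat by blast
  define d where "d = off e2 b2 - off e1 b1"
  \<comment> \<open>Displacements from the far end of \<open>e1\<close> to the far end of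
    \<open>e2\<close>: along \<open>e1\<close>, then between the two attachments at
    \<open>v\<close>, by \<open>d\<close> or \<open>- d\<close> according to the orientation of
    \<open>v\<close>, then along \<open>e2\<close>. Outside \<open>T\<close> both signs are still
    allowed, but no gain is counted.\<close>
  define A0 where "A0 = sumset (sumset (directed (b1 \<noteq> True) (A e1)) {d, - d}) (directed b2 (A e2))"
  define k where "k = (if v \<in> T then 1 else 0 :: nat)"
  \<comment> \<open>The composed edge reuses the name \<open>e1\<close>: its end
    \<open>False\<close> is the far end of \<open>e1\<close>, its end \<open>True\<close> the far
    end of \<open>e2\<close>.\<close>
  define nd' where "nd' = nd(e1 := (\<lambda>b. if b then nd e2 (\<not> b2) else nd e1 (\<not> b1)))"
  define off' where "off' = off(e1 := (\<lambda>b. if b then off e2 (\<not> b2) else off e1 (\<not> b1)))"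
  define A' where "A' = A(e1 := A0)"
  define s' where "s' = s(e1 := s e1 + k + s e2)"
  define w' where "w' = w(e1 := w e1 + p * k + w e2)"
  have nB: "\<And>e b. e \<in> E \<Longrightarrow> nd e b \<in> B"
    and ex: "\<And>e. e \<in> E \<Longrightarrow> expanding p (A e) (s e)" and ws: "\<And>e. e \<in> E \<Longrightarrow> w e \<le> p * s e"
    and dis: "\<And>e e' b b'. e \<in> E \<Longrightarrow> e' \<in> E \<Longrightarrow> e \<noteq> e' \<Longrightarrow> nd e b = nd e' b' \<Longrightarrow> nd e b \<in> T \<Longrightarrow>
       \<not> [off e b = off e' b'] (mod int p)"
    and sp: "sparse p N B E T nd w" and fin: "finite B" "finite E"
    using net unfolding network_def by blast+
  have vB: "v \<in> B" using nB[OF e(1), of b1] b(1) by simp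
  have notv: "nd e b \<noteq> v" if "e \<in> E" "e \<noteq> e1" "e \<noteq> e2" for e b
    using inc that unfolding incident_def by blast
  have dd: "expanding p {d, - d} k"
  proof (cases "v \<in> T")
    case True
    \<comment> \<open>Otherwise the odd prime \<open>p\<close> divides \<open>d\<close>, and the two
      attachments at the rigid node coincide.\<close>
    have "\<not> [d = - d] (mod int p)"
    proof
      assume "[d = - d] (mod int p)"
      hence "int p dvd 2 * d" by (simp add: cong_iff_dvd_diff)
      hence "int p dvd d" using p
        by (metis coprime_dvd_mult_right_iff coprime_left_2_iff_odd coprime_commute even_of_nat)
      hence "[off e2 b2 = off e1 b1] (mod int p)" unfolding d_def by (simp add: cong_iff_dvd_diff)
      thus False using dis[OF e(2,1), of b2 b1] e(3) b True by simp
    qed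
    from expanding_doubleton[OF p(1) this] show ?thesis using True by (simp add: k_def)
  qed (simp add: k_def expanding_0 p0)
  have exA0: "expanding p A0 (s e1 + k + s e2)" unfolding A0_def
    by (intro expanding_sumset p0 dd expanding_directed ex e)
  have "sparse p N (B - {v}) (E - {e2}) T nd' w'"
    unfolding sparse_def
  proof (intro allI impI)
    fix B' E' assume B': "B' \<subseteq> B - {v}" "B' \<noteq> {}" and E': "E' \<subseteq> E - {e2}" "\<forall>e\<in>E'. \<forall>b. nd' e b \<in> B'"
    have finB: "finite B'" and finE: "finite E'" using fin B' E' by (auto intro: finite_subset)
    show "int N * (int (card E') + 1 - int (card B')) \<le> int (sum w' E' + p * card (B' \<inter> T))"
    proof (cases "e1 \<in> E'")
      case False
      have "\<forall>e\<in>E'. \<forall>b. nd e b \<in> B'" using E'(2) False unfolding nd'_def by (metis fun_upd_other)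
      hence "int N * (int (card E') + 1 - int (card B')) \<le> int (sum w E' + p * card (B' \<inter> T))"
        using B' E' by (intro sparseD[OF sp]) auto
      moreover have "sum w' E' = sum w E'" using False unfolding w'_def by (intro sum.cong) auto
      ultimately show ?thesis by simp
    next
      case True
      have ends: "nd e1 (\<not> b1) \<in> B'" "nd e2 (\<not> b2) \<in> B'"
        using E'(2) True unfolding nd'_def by (metis fun_upd_same)+
      \<comment> \<open>A subnetwork with the composed edge is compared with the old one in which
        \<open>v\<close> and \<open>e2\<close> are restored. One more node and one more edge leave
        the left side of the inequality unchanged, and the weight lost by \<open>v\<close> and
        \<open>e2\<close> is exactly what the composed edge has gained.\<close>
      have "\<forall>e\<in>insert e2 E'. \<forall>b. nd e b \<in> insert v B'"
      proof (intro ballI allI)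
        fix e b assume "e \<in> insert e2 E'"
        then consider "e = e1" | "e = e2" | "e \<in> E'" "e \<noteq> e1" by blast
        thus "nd e b \<in> insert v B'"
        proof cases
          case 1 thus ?thesis using ends b by (cases "b = b1") auto
        next
          case 2 thus ?thesis using ends b by (cases "b = b2") auto
        next
          case 3 thus ?thesis using E'(2) unfolding nd'_def by (metis fun_upd_other insertI2)
        qed
      qed
      hence "int N * (int (card (insert e2 E')) + 1 - int (card (insert v B')))
         \<le> int (sum w (insert e2 E') + p * card (insert v B' \<inter> T))"
        using B' E' vB e by (intro sparseD[OF sp]) auto
      moreover have "card (insert e2 E') = card E' + 1" "card (insert v B') = card B' + 1"
        using B' E' finB finE by (simp_all add: card_insert_if subset_Diff_insert)
      moreover have "card (insert v B' \<inter> T) = card (B' \<inter> T) + k"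
      proof (cases "v \<in> T")
        case True
        hence "insert v B' \<inter> T = insert v (B' \<inter> T)" by auto
        thus ?thesis using True B' finB by (simp add: k_def card_insert_if subset_Diff_insert)
      qed (simp add: k_def)
      moreover have "sum w (insert e2 E') + p * k = sum w' E'"
      proof -
        have "sum w (insert e2 E') = w e2 + (w e1 + sum w (E' - {e1}))"
          using E' finE True by (subst sum.insert) (auto simp: sum.remove)
        moreover have "sum w' E' = w' e1 + sum w' (E' - {e1})" using finE True by (simp add: sum.remove)
        moreover have "sum w' (E' - {e1}) = sum w (E' - {e1})" unfolding w'_def by (intro sum.cong) auto
        ultimately show ?thesis unfolding w'_def by simp
      qed
      moreover have "int N * (int (card E' + 1) + 1 - int (card B' + 1)) = int N * (int (card E') + 1 - int (card B'))"
        by simp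
      moreover have "sum w (insert e2 E') + p * (card (B' \<inter> T) + k) = sum w' E' + p * card (B' \<inter> T)"
        using calculation(5) by (simp add: algebra_simps)
      ultimately show ?thesis by metis
    qed
  qed
  moreover have "\<forall>e\<in>E - {e2}. \<forall>b. nd' e b \<in> B - {v}"
    using nB e other notv unfolding nd'_def by auto
  moreover have "\<forall>e\<in>E - {e2}. expanding p (A' e) (s' e) \<and> w' e \<le> p * s' e"
    using ex ws exA0 ws[OF e(1)] ws[OF e(2)] unfolding A'_def s'_def w'_def
    by (auto simp: distrib_left)
  moreover have "\<forall>e\<in>E - {e2}. \<forall>e'\<in>E - {e2}. \<forall>b b'. e \<noteq> e' \<longrightarrow> nd' e b = nd' e' b' \<longrightarrow> nd' e b \<in> T \<longrightarrow>
       \<not> [off' e b = off' e' b'] (mod int p)"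
  proof (intro ballI allI impI)
    fix e e' b b' assume h: "e \<in> E - {e2}" "e' \<in> E - {e2}" "e \<noteq> e'" "nd' e b = nd' e' b'" "nd' e b \<in> T"
    have rep: "\<exists>f c. f \<in> E \<and> nd f c = nd' g b \<and> off f c = off' g b \<and> (g \<noteq> e1 \<longrightarrow> f = g) \<and> (g = e1 \<longrightarrow> f \<in> {e1, e2})"
      if "g \<in> E - {e2}" for g b
    proof (cases "g = e1")
      case True
      show ?thesis
      proof (cases b)
        case True
        thus ?thesis using e(2) \<open>g = e1\<close> unfolding nd'_def off'_def
          by (intro exI[of _ e2] exI[of _ "\<not> b2"]) simp
      next
        case False
        thus ?thesis using e(1) \<open>g = e1\<close> unfolding nd'_def off'_def
          by (intro exI[of _ e1] exI[of _ "\<not> b1"]) simp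
      qed
    next
      case False
      thus ?thesis using that unfolding nd'_def off'_def by auto
    qed
    obtain f c where f: "f \<in> E" "nd f c = nd' e b" "off f c = off' e b" "e \<noteq> e1 \<longrightarrow> f = e" "e = e1 \<longrightarrow> f \<in> {e1, e2}"
      using rep[OF h(1), of b] by blast
    obtain f' c' where f': "f' \<in> E" "nd f' c' = nd' e' b'" "off f' c' = off' e' b'" "e' \<noteq> e1 \<longrightarrow> f' = e'" "e' = e1 \<longrightarrow> f' \<in> {e1, e2}"
      using rep[OF h(2), of b'] by blast
    have "f \<noteq> f'" using f f' h by auto
    from dis[OF f(1) f'(1) this, of c c'] show "\<not> [off' e b = off' e' b'] (mod int p)"
      using f f' h by simp
  qed
  ultimately have net': "network p N (B - {v}) (E - {e2}) T nd' off' A' s' w'"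
    using fin unfolding network_def by blast
  show thesis
  proof (rule that[OF net'])
    fix x \<epsilon> assume eps: "\<forall>u. \<epsilon> u = (1::int) \<or> \<epsilon> u = -1" and sat: "\<forall>e\<in>E - {e2}. satisfied p nd' off' A' x \<epsilon> e"
    define \<alpha> where "\<alpha> = x (nd e1 (\<not> b1)) + \<epsilon> (nd e1 (\<not> b1)) * off e1 (\<not> b1)"
    define \<beta> where "\<beta> = x (nd e2 (\<not> b2)) + \<epsilon> (nd e2 (\<not> b2)) * off e2 (\<not> b2)"
    have "satisfied p nd' off' A' x \<epsilon> e1" using sat e by blast
    then obtain a where a: "a \<in> A0" "[\<alpha> + a = \<beta>] (mod int p)"
      unfolding satisfied_def \<alpha>_def \<beta>_def nd'_def off'_def A'_def by auto
    obtain a1 a2 \<eta> where a12: "a1 \<in> directed (b1 \<noteq> True) (A e1)" "a2 \<in> directed b2 (A e2)"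
      "\<eta> = 1 \<or> \<eta> = -1" "a = a1 + \<eta> * d + a2"
      using a(1) unfolding A0_def sumset_def by fastforce
    \<comment> \<open>The value of \<open>v\<close> is read off the constraint of \<open>e1\<close>;
      by the choice of \<open>a\<close> the constraint of \<open>e2\<close> then holds too.\<close>
    define z where "z = \<alpha> + a1 - \<eta> * off e1 b1"
    have s1: "satisfied p nd off A (x(v := z)) (\<epsilon>(v := \<eta>)) e1"
    proof (subst satisfied_iff[where b = "\<not> b1"], rule bexI)
      show "a1 \<in> directed (\<not> b1) (A e1)" using a12(1) by simp
      show "[(x(v := z)) (nd e1 (\<not> b1)) + (\<epsilon>(v := \<eta>)) (nd e1 (\<not> b1)) * off e1 (\<not> b1) + a1 =
        (x(v := z)) (nd e1 (\<not> \<not> b1)) + (\<epsilon>(v := \<eta>)) (nd e1 (\<not> \<not> b1)) * off e1 (\<not> \<not> b1)] (mod int p)"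
        using other(1) b(1) by (simp add: z_def \<alpha>_def)
    qed
    have s2: "satisfied p nd off A (x(v := z)) (\<epsilon>(v := \<eta>)) e2"
    proof (subst satisfied_iff[where b = b2], rule bexI)
      show "a2 \<in> directed b2 (A e2)" by (rule a12(2))
      have "z + \<eta> * off e2 b2 + a2 = \<alpha> + a" unfolding z_def a12(4) d_def by (simp add: algebra_simps)
      thus "[(x(v := z)) (nd e2 b2) + (\<epsilon>(v := \<eta>)) (nd e2 b2) * off e2 b2 + a2 =
        (x(v := z)) (nd e2 (\<not> b2)) + (\<epsilon>(v := \<eta>)) (nd e2 (\<not> b2)) * off e2 (\<not> b2)] (mod int p)"
        using other(2) b(2) a(2) by (simp add: \<beta>_def)
    qed
    have "satisfied p nd off A (x(v := z)) (\<epsilon>(v := \<eta>)) e" if "e \<in> E" for e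
    proof -
      consider "e = e1" | "e = e2" | "e \<noteq> e1" "e \<noteq> e2" by blast
      thus ?thesis
      proof cases
        case 3
        hence "satisfied p nd' off' A' x \<epsilon> e" using sat that by blast
        thus ?thesis using 3 notv[OF that 3] unfolding satisfied_def nd'_def off'_def A'_def by simp
      qed (use s1 s2 in auto)
    qed
    thus "\<exists>z \<eta>. (\<eta> = 1 \<or> \<eta> = -1) \<and> (\<forall>e\<in>E. satisfied p nd off A (x(v := z)) (\<epsilon>(v := \<eta>)) e)"
      using a12(3) by blast
  qed
qed

text \<open>Induction on the number of nodes and edges. Edges with \<open>s e \<ge> p - 1\<close>
  are dropped first, so that afterwards every edge has positive deficiency
  \<open>p - 1 - s e\<close>. This is all that is known of the edges at the root in the final
  count.\<close>

theorem network_colorable: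
  fixes B :: "'b set" and E :: "'e set"
  assumes p: "prime p" "p \<ge> 5" and N: "N = 2 * (p - 1) * (p + 2)"
    and "network p N B E T nd off A s w"
    and "r \<in> B" and e0: "\<epsilon>0 = 1 \<or> \<epsilon>0 = (-1 :: int)"
  shows "\<exists>x \<epsilon>. x r = x0 \<and> \<epsilon> r = \<epsilon>0 \<and> (\<forall>v. \<epsilon> v = 1 \<or> \<epsilon> v = -1) \<and> (\<forall>e\<in>E. satisfied p nd off A x \<epsilon> e)"
  using assms(4,5)
proof (induction "card B + card E" arbitrary: B E nd off A s w rule: less_induct)
  case less
  have p0: "p > 0" using p by simp
  note net = less.prems(1)
  have nB: "\<And>e b. e \<in> E \<Longrightarrow> nd e b \<in> B"
    and ex: "\<And>e. e \<in> E \<Longrightarrow> expanding p (A e) (s e)" and ws: "\<And>e. e \<in> E \<Longrightarrow> w e \<le> p * s e"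
    and sp: "sparse p N B E T nd w" and fin: "finite B" "finite E"
    using net unfolding network_def by blast+
  note IH = less.hyps
  show ?case
  proof (cases "\<exists>e\<in>E. s e \<ge> p - 1")
    case True
    then obtain e where e: "e \<in> E" "s e \<ge> p - 1" by blast
    have "network p N B (E - {e}) T nd off A s w"
      by (rule network_delete[OF net]) (use nB in auto)
    moreover have "card (E - {e}) < card E" using e fin by (meson card_Diff1_less)
    ultimately obtain x \<epsilon> where x: "x r = x0" "\<epsilon> r = \<epsilon>0" "\<forall>v. \<epsilon> v = 1 \<or> \<epsilon> v = -1"
      "\<forall>e\<in>E - {e}. satisfied p nd off A x \<epsilon> e"
      using IH[of B "E - {e}"] less.prems(2) by (meson add_strict_left_mono)
    moreover have "satisfied p nd off A x \<epsilon> e" by (rule satisfied_full[where A = A and s = s, OF p0 ex[OF e(1)] e(2)])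
    ultimately show ?thesis by (metis DiffI singletonD)
  next
    case False
    hence small: "\<And>e. e \<in> E \<Longrightarrow> s e \<le> p - 2" by fastforce
    \<comment> \<open>One node with a loop is a subnetwork in which sparsity forces
      \<open>N \<le> w e + p\<close>, but \<open>w e\<close> is at most
      \<open>p * (p - 2)\<close>.\<close>
    have noloop: "nd e b \<noteq> nd e (\<not> b)" if e: "e \<in> E" for e b
    proof
      assume loop: "nd e b = nd e (\<not> b)"
      have "nd e c = nd e b" for c using loop by (cases "c = b") auto
      hence "\<forall>c. nd e c \<in> {nd e b}" by simp
      hence "int N * (int (card {e}) + 1 - int (card {nd e b}))
         \<le> int (sum w {e} + p * card ({nd e b} \<inter> T))"
        using nB e by (intro sparseD[OF sp]) auto
      hence "int N \<le> int (w e + p * card ({nd e b} \<inter> T))"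
        by (simp del: of_nat_mult of_nat_add)
      hence "N \<le> w e + p * card ({nd e b} \<inter> T)" using of_nat_le_iff by blast
      moreover have "p * card ({nd e b} \<inter> T) \<le> p * 1"
        using card_mono[of "{nd e b}" "{nd e b} \<inter> T"] by (intro mult_le_mono) auto
      moreover have "w e \<le> p * (p - 2)" using ws[OF e] mult_le_mono2[OF small[OF e], of p] by linarith
      ultimately have le: "2 * (p - 1) * (p + 2) \<le> p * (p - 2) + p * 1" unfolding N by linarith
      obtain q where "p = q + 5" using p(2) by (metis add.commute le_Suc_ex)
      with le show False by (simp add: algebra_simps)
    qed
    show ?thesis
    proof (cases "\<exists>v\<in>B - {r}. (\<Sum>e\<in>incident nd E v. p - 1 - s e) < p")
      case True
      then obtain v where v: "v \<in> B" "v \<noteq> r" "(\<Sum>e\<in>incident nd E v. p - 1 - s e) < p" by blast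
      define I where "I = incident nd E v"
      have "network p N (B - {v}) (E - I) T nd off A s w"
        using nB by (intro network_delete[OF net]) (auto simp: I_def incident_def)
      moreover have "card (B - {v}) + card (E - I) < card B + card E"
        using v(1) fin by (intro add_less_le_mono card_Diff1_less card_mono) auto
      ultimately obtain x \<epsilon> where x: "x r = x0" "\<epsilon> r = \<epsilon>0" "\<forall>v. \<epsilon> v = 1 \<or> \<epsilon> v = -1"
        "\<forall>e\<in>E - I. satisfied p nd off A x \<epsilon> e"
        using IH[of "B - {v}" "E - I"] less.prems(2) v(2) by blast
      \<comment> \<open>\<open>c e\<close> is the end of \<open>e\<close> opposite to
        \<open>v\<close>.\<close>
      define c where "c e = (SOME b. nd e (\<not> b) = v)" for e
      have c: "nd e (\<not> c e) = v" if eI: "e \<in> I" for e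
      proof -
        obtain b where "nd e b = v" using eI unfolding I_def incident_def by blast
        hence "nd e (\<not> (\<not> b)) = v" by simp
        thus ?thesis unfolding c_def by (rule someI)
      qed
      have IE: "I \<subseteq> E" unfolding I_def incident_def by blast
      have c': "nd e (c e) \<noteq> v" if "e \<in> I" for e
        using noloop[of e "c e"] c[OF that] that IE by auto
      \<comment> \<open>The removed node gets orientation \<open>1\<close> even if it is rigid; its
        offsets then become constants, moved to the other side, and only a residue \<open>z\<close>
        has to be found.\<close>
      have "\<exists>z. \<forall>e\<in>I. \<exists>a\<in>directed (c e) (A e).
          [(x (nd e (c e)) + \<epsilon> (nd e (c e)) * off e (c e) - off e (\<not> c e)) + a = z] (mod int p)"
      proof (rule residue_avoiding[OF p0, where s = s])
        show "finite I" using IE fin finite_subset by blast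
        show "expanding p (directed (c e) (A e)) (s e) \<and> s e \<le> p - 1" if "e \<in> I" for e
          using ex expanding_directed[OF p0] small[of e] that IE by auto
        show "(\<Sum>i\<in>I. p - 1 - s i) < p" using v(3) unfolding I_def .
      qed
      then obtain z where z: "\<And>e. e \<in> I \<Longrightarrow> \<exists>a\<in>directed (c e) (A e).
          [(x (nd e (c e)) + \<epsilon> (nd e (c e)) * off e (c e) - off e (\<not> c e)) + a = z] (mod int p)" by blast
      have "satisfied p nd off A (x(v := z)) (\<epsilon>(v := 1)) e" if e: "e \<in> E" for e
      proof (cases "e \<in> I")
        case True
        obtain a where a: "a \<in> directed (c e) (A e)"
          "[(x (nd e (c e)) + \<epsilon> (nd e (c e)) * off e (c e) - off e (\<not> c e)) + a = z] (mod int p)"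
          using z[OF True] by blast
        have "[(x (nd e (c e)) + \<epsilon> (nd e (c e)) * off e (c e) - off e (\<not> c e)) + a + off e (\<not> c e)
           = z + off e (\<not> c e)] (mod int p)" using a(2) cong_add_rcancel by blast
        hence "[x (nd e (c e)) + \<epsilon> (nd e (c e)) * off e (c e) + a = z + off e (\<not> c e)] (mod int p)"
          by (simp add: algebra_simps)
        thus ?thesis using a(1) c[OF True] c'[OF True]
          by (subst satisfied_iff[where b = "c e"]) auto
      next
        case False
        hence "nd e b \<noteq> v" for b using e unfolding I_def incident_def by blast
        moreover have "satisfied p nd off A x \<epsilon> e" using x(4) e False by blast
        ultimately show ?thesis unfolding satisfied_def by simp
      qed
      thus ?thesis using x(1-3) v(2)
        by (intro exI[of _ "x(v := z)"] exI[of _ "\<epsilon>(v := 1)"]) auto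
    next
      case nosmall: False
      show ?thesis
      proof (cases "\<exists>v\<in>B - {r}. card (incident nd E v) = 2")
        case True
        then obtain v where v: "v \<in> B" "v \<noteq> r" "card (incident nd E v) = 2" by blast
        then obtain e1 e2 where ee: "incident nd E v = {e1, e2}" "e1 \<noteq> e2" by (meson card_2_iff)
        hence eE: "e1 \<in> E" "e2 \<in> E" unfolding incident_def by blast+
        obtain b1 where b1: "nd e1 b1 = v" using ee(1) unfolding incident_def by blast
        obtain b2 where b2: "nd e2 b2 = v" using ee(1) unfolding incident_def by blast
        have oddp: "odd p" using p prime_odd_nat by force
        obtain nd' off' A' s' w' where
          net': "network p N (B - {v}) (E - {e2}) T nd' off' A' s' w'"
          and ext: "\<And>x \<epsilon>. \<forall>u. \<epsilon> u = 1 \<or> \<epsilon> u = -1 \<Longrightarrow> \<forall>e\<in>E - {e2}. satisfied p nd' off' A' x \<epsilon> e \<Longrightarrow>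
            \<exists>z \<eta>. (\<eta> = 1 \<or> \<eta> = -1) \<and> (\<forall>e\<in>E. satisfied p nd off A (x(v := z)) (\<epsilon>(v := \<eta>)) e)"
          using network_suppress[OF net p(1) oddp eE ee(2,1) b1 b2] noloop[of e1 b1] noloop[of e2 b2] eE b1 b2
          by (metis (no_types, lifting))
        have "card (B - {v}) + card (E - {e2}) < card B + card E"
          using v(1) fin by (intro add_less_le_mono card_Diff1_less card_mono) auto
        then obtain x \<epsilon> where x: "x r = x0" "\<epsilon> r = \<epsilon>0" "\<forall>v. \<epsilon> v = 1 \<or> \<epsilon> v = -1"
          "\<forall>e\<in>E - {e2}. satisfied p nd' off' A' x \<epsilon> e"
          using IH[OF _ net'] less.prems(2) v(2) by blast
        obtain z \<eta> where "\<eta> = 1 \<or> \<eta> = -1" "\<forall>e\<in>E. satisfied p nd off A (x(v := z)) (\<epsilon>(v := \<eta>)) e"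
          using ext[OF x(3,4)] by blast
        thus ?thesis using x(1-3) v(2)
          by (intro exI[of _ "x(v := z)"] exI[of _ "\<epsilon>(v := \<eta>)"]) auto
      next
        case no2: False
        \<comment> \<open>Each deficiency is at most \<open>p - 1\<close> and together they reach
          \<open>p\<close>, which excludes degrees 0 and 1. Degree 2 would have been
          suppressed.\<close>
        have deg3: "card (incident nd E v) \<ge> 3" and
             degs: "(\<Sum>e\<in>incident nd E v. p - 1 - s e) \<ge> p" if v: "v \<in> B - {r}" for v
        proof -
          show 1: "(\<Sum>e\<in>incident nd E v. p - 1 - s e) \<ge> p" using nosmall v by force
          have "(\<Sum>e\<in>incident nd E v. p - 1 - s e) \<le> card (incident nd E v) * (p - 1)"
            by (rule order_trans[OF sum_bounded_above[where K = "p - 1"]]) auto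
          hence "p \<le> card (incident nd E v) * (p - 1)" using 1 by linarith
          hence "card (incident nd E v) \<noteq> 0" "card (incident nd E v) \<noteq> 1"
            using p(2) by (intro notI; simp)+
          moreover have "card (incident nd E v) \<noteq> 2" using no2 v by blast
          ultimately show "card (incident nd E v) \<ge> 3" by linarith
        qed
        show ?thesis
        proof (cases "B = {r}")
          case True
          have "E = {}" using noloop nB True by (metis all_not_in_conv singletonD)
          thus ?thesis using e0 by (intro exI[of _ "\<lambda>_. x0"] exI[of _ "\<lambda>_. \<epsilon>0"]) auto
        next
          case False
          define k where "k = card (B - {r})"
          define d where "d = card (incident nd E r)"
          have rB: "r \<in> B" by (rule less.prems(2))
          have "B - {r} \<noteq> {}" using False rB by blast
          hence k1: "k \<ge> 1" using fin(1) unfolding k_def by (simp add: Suc_le_eq card_gt_0_iff)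
          have cB: "card B = k + 1" unfolding k_def using card_Suc_Diff1[OF fin(1) rB] by simp
          have split: "(\<Sum>v\<in>B. g v) = g r + (\<Sum>v\<in>B - {r}. g v)" for g :: "'b \<Rightarrow> nat"
            by (rule sum.remove[OF fin(1) rB])
          have nl: "\<And>e. e \<in> E \<Longrightarrow> nd e False \<noteq> nd e True" using noloop[of _ False] by simp
          have "d + (\<Sum>v\<in>B - {r}. card (incident nd E v)) = 2 * card E"
            using sum_incident[OF fin, where nd = nd, OF nB nl, where g = "\<lambda>_. 1"] split[of "\<lambda>v. card (incident nd E v)"]
            unfolding d_def by simp
          moreover have "(\<Sum>v\<in>B - {r}. card (incident nd E v)) \<ge> k * 3"
            using sum_bounded_below[of "B - {r}" 3 "\<lambda>v. card (incident nd E v)"] deg3 unfolding k_def by simp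
          ultimately have D: "3 * k + d \<le> 2 * card E" by linarith
          have "(\<Sum>e\<in>incident nd E r. p - 1 - s e) + (\<Sum>v\<in>B - {r}. \<Sum>e\<in>incident nd E v. p - 1 - s e)
            = 2 * (\<Sum>e\<in>E. p - 1 - s e)"
            using sum_incident[OF fin, where nd = nd, OF nB nl, where g = "\<lambda>e. p - 1 - s e"]
              split[of "\<lambda>v. \<Sum>e\<in>incident nd E v. p - 1 - s e"] by simp
          moreover have "(\<Sum>v\<in>B - {r}. \<Sum>e\<in>incident nd E v. p - 1 - s e) \<ge> k * p"
            using sum_bounded_below[of "B - {r}" p "\<lambda>v. \<Sum>e\<in>incident nd E v. p - 1 - s e"] degs
            unfolding k_def by simp
          moreover have "(\<Sum>e\<in>incident nd E r. p - 1 - s e) \<ge> d * 1"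
          proof -
            have "1 \<le> p - 1 - s e" if "e \<in> incident nd E r" for e
              using small[of e] that p(2) unfolding incident_def by fastforce
            from sum_bounded_below[of "incident nd E r" 1, OF this] show ?thesis
              unfolding d_def by simp
          qed
          ultimately have "k * p + d \<le> 2 * (\<Sum>e\<in>E. p - 1 - s e)" by linarith
          moreover have "(\<Sum>e\<in>E. p - 1 - s e) + sum s E = card E * (p - 1)"
          proof -
            have "(\<Sum>e\<in>E. p - 1 - s e) + sum s E = (\<Sum>e\<in>E. (p - 1 - s e) + s e)"
              by (simp add: sum.distrib)
            also have "\<dots> = (\<Sum>e\<in>E. p - 1)" using small p(2) by (intro sum.cong) fastforce+
            finally show ?thesis by simp
          qed
          ultimately have S: "k * p + d + 2 * sum s E \<le> 2 * (card E * (p - 1))" by linarith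
          have "int N * (int (card E) + 1 - int (card B)) \<le> int (sum w E + p * card (B \<inter> T))"
            using nB less.prems(2) by (intro sparseD[OF sp]) auto
          moreover have "sum w E \<le> p * sum s E" unfolding sum_distrib_left using ws by (rule sum_mono)
          moreover have "p * card (B \<inter> T) \<le> p * (k + 1)"
            using card_mono[of B "B \<inter> T"] fin cB by (intro mult_le_mono) auto
          moreover have "int (card E) + 1 - int (card B) = int (card E) - int k" using cB by simp
          moreover have "int (sum w E + p * card (B \<inter> T)) \<le> int (p * sum s E + p * (k + 1))"
            using calculation(2,3) by (intro of_nat_mono add_mono)
          ultimately have W: "int N * (int (card E) - int k) \<le> int (p * sum s E + p * (k + 1))"
            by (metis order_trans)
          have intN: "int N = 2 * (int p - 1) * (int p + 2)"
            using p(2) unfolding N by (simp add: of_nat_diff algebra_simps)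
          have "False"
          proof (rule counting_contradiction[of "int p" "int k" "int d" "int (card E)" "int (sum s E)"])
            show "2 * (int p - 1) * (int p + 2) * (int (card E) - int k) \<le> int (p * sum s E + p * (k + 1))"
              using W unfolding intN .
            show "int (p * sum s E + p * (k + 1)) \<le> int p * int (sum s E) + int p * (int k + 1)"
              by (simp add: algebra_simps)
            have "int (k * p + d + 2 * sum s E) \<le> int (2 * (card E * (p - 1)))" using S of_nat_mono by blast
            thus "int p * int k + int d \<le> 2 * int (card E) * (int p - 1) - 2 * int (sum s E)"
              using p(2) by (simp add: of_nat_diff algebra_simps)
          qed (use p(2) k1 D in auto)
          thus ?thesis ..
        qed
      qed
    qed
  qed
qed

section \<open>Cycles and even edge sets\<close>

definition cyc_edge :: "'a list \<Rightarrow> nat \<Rightarrow> 'a set" where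
  "cyc_edge c i = {c ! i, c ! (Suc i mod length c)}"

definition cycle_edges :: "'a list \<Rightarrow> 'a set set" where
  "cycle_edges c = cyc_edge c ` {..<length c}"

definition deg :: "'a set set \<Rightarrow> 'a \<Rightarrow> nat" where
  "deg F v = card {e \<in> F. v \<in> e}"

lemma deg_eq_0: "v \<notin> \<Union>F \<Longrightarrow> deg F v = 0"
  unfolding deg_def by (rule card_eq_0_iff[THEN iffD2]) blast

definition edge_set :: "'a set set \<Rightarrow> bool" where
  "edge_set F \<longleftrightarrow> finite F \<and> (\<forall>e\<in>F. card e = 2)"

definition even_edges :: "'a set set \<Rightarrow> bool" where
  "even_edges F \<longleftrightarrow> edge_set F \<and> (\<forall>v. even (deg F v))"

lemma edge_set_subset: "edge_set F \<Longrightarrow> G \<subseteq> F \<Longrightarrow> edge_set G"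
  unfolding edge_set_def using finite_subset by auto

lemma edge_set_finite_Union: "edge_set F \<Longrightarrow> finite (\<Union>F)"
  unfolding edge_set_def by (metis card.infinite finite_Union zero_neq_numeral)

lemma is_cycle_iff:
  "is_cycle E c \<longleftrightarrow> length c \<ge> 3 \<and> distinct c \<and> cycle_edges c \<subseteq> E"
  unfolding is_cycle_def cycle_edges_def cyc_edge_def by auto

lemma is_cycle_mono: "is_cycle E c \<Longrightarrow> E \<subseteq> F \<Longrightarrow> is_cycle F c"
  unfolding is_cycle_iff by blast

lemma in_cyc_edge_iff:
  assumes c: "distinct c" and ij: "i < length c" "j < length c"
  shows "c ! i \<in> cyc_edge c j \<longleftrightarrow> j = i \<or> Suc j mod length c = i"
proof -
  have "Suc j mod length c < length c" using ij by (intro mod_less_divisor) linarith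
  thus ?thesis using c ij unfolding cyc_edge_def by (auto simp: nth_eq_iff_index_eq)
qed

lemma inj_on_cyc_edge:
  assumes c: "distinct c" "length c \<ge> 3"
  shows "inj_on (cyc_edge c) {..<length c}"
proof (rule inj_onI)
  fix i j assume ij: "i \<in> {..<length c}" "j \<in> {..<length c}" "cyc_edge c i = cyc_edge c j"
  have "c ! i \<in> cyc_edge c j" using ij(3) unfolding cyc_edge_def by auto
  hence 1: "j = i \<or> Suc j mod length c = i" using in_cyc_edge_iff[OF c(1), of i j] ij by simp
  have "c ! j \<in> cyc_edge c i" using ij(3) unfolding cyc_edge_def by auto
  hence 2: "i = j \<or> Suc i mod length c = j" using in_cyc_edge_iff[OF c(1), of j i] ij by simp
  show "i = j"
  proof (rule ccontr)
    assume "i \<noteq> j"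
    hence "Suc j mod length c = i" "Suc i mod length c = j" using 1 2 by auto
    thus False using ij c(2) by (cases "Suc i = length c"; cases "Suc j = length c") auto
  qed
qed

lemma card_cycle_edges:
  assumes "is_cycle E c" shows "card (cycle_edges c) = length c"
  using assms inj_on_cyc_edge[of c] unfolding is_cycle_iff cycle_edges_def by (simp add: card_image)

lemma deg_cyc_edge_image:
  assumes c: "distinct c" "length c \<ge> 3" and S: "S \<subseteq> {..<length c}"
  shows "deg (cyc_edge c ` S) v = card {j \<in> S. v \<in> cyc_edge c j}"
proof -
  have "{e \<in> cyc_edge c ` S. v \<in> e} = cyc_edge c ` {j \<in> S. v \<in> cyc_edge c j}" by auto
  moreover have "inj_on (cyc_edge c) {j \<in> S. v \<in> cyc_edge c j}"
    using inj_on_cyc_edge[OF c] S by (auto intro: inj_on_subset)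
  ultimately show ?thesis unfolding deg_def by (simp add: card_image)
qed

definition cyc_pred :: "'a list \<Rightarrow> nat \<Rightarrow> nat" where
  "cyc_pred c i = (if i = 0 then length c - 1 else i - 1)"

lemma indices_at_vertex:
  assumes c: "distinct c" "length c \<ge> 3" and i: "i < length c" and S: "S \<subseteq> {..<length c}"
  shows "{j \<in> S. c ! i \<in> cyc_edge c j} = S \<inter> {i, cyc_pred c i}"
proof -
  have "Suc j mod length c = i \<longleftrightarrow> j = cyc_pred c i" if "j < length c" for j
    using that i c(2) unfolding cyc_pred_def by (cases "Suc j = length c") auto
  thus ?thesis using in_cyc_edge_iff[OF c(1) i] S by auto
qed

lemma Union_cycle_edges:
  assumes "is_cycle E c" shows "\<Union>(cycle_edges c) = set c"
proof
  have len: "length c \<ge> 3" using assms unfolding is_cycle_iff by auto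
  show "\<Union>(cycle_edges c) \<subseteq> set c"
    using len unfolding cycle_edges_def cyc_edge_def by (auto intro!: nth_mem mod_less_divisor)
  show "set c \<subseteq> \<Union>(cycle_edges c)"
    unfolding cycle_edges_def cyc_edge_def by (auto simp: in_set_conv_nth)
qed

lemma even_edges_cycle:
  assumes c: "is_cycle E c" and E: "edge_set E"
  shows "even_edges (cycle_edges c)"
  unfolding even_edges_def
proof (intro conjI allI)
  have d: "distinct c" "length c \<ge> 3" "cycle_edges c \<subseteq> E" using c unfolding is_cycle_iff by auto
  show "edge_set (cycle_edges c)" using edge_set_subset[OF E d(3)] .
  fix v
  show "even (deg (cycle_edges c) v)"
  proof (cases "v \<in> set c")
    case True
    then obtain i where i: "i < length c" "v = c ! i" by (metis in_set_conv_nth)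
    have "cyc_pred c i < length c" "cyc_pred c i \<noteq> i" using i d(2) unfolding cyc_pred_def by auto
    hence "{..<length c} \<inter> {i, cyc_pred c i} = {i, cyc_pred c i}" using i by auto
    hence "deg (cycle_edges c) v = 2"
      unfolding cycle_edges_def i(2) deg_cyc_edge_image[OF d(1,2) order_refl]
        indices_at_vertex[OF d(1,2) i(1) order_refl]
      using \<open>cyc_pred c i \<noteq> i\<close> by simp
    thus ?thesis by simp
  next
    case False
    hence "deg (cycle_edges c) v = 0" using Union_cycle_edges[OF c] deg_eq_0 by metis
    thus ?thesis by simp
  qed
qed

lemma deg_Un_disjoint:
  assumes "finite A" "finite B" "A \<inter> B = {}"
  shows "deg (A \<union> B) v = deg A v + deg B v"
proof -
  have "{e \<in> A \<union> B. v \<in> e} = {e \<in> A. v \<in> e} \<union> {e \<in> B. v \<in> e}" by auto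
  thus ?thesis unfolding deg_def using assms by (simp add: card_Un_disjoint disjoint_iff)
qed

lemma even_edges_Diff:
  assumes "even_edges F" "even_edges D" "D \<subseteq> F"
  shows "even_edges (F - D)"
  unfolding even_edges_def
proof (intro conjI allI)
  have fin: "finite F" "finite D" using assms unfolding even_edges_def edge_set_def by auto
  show "edge_set (F - D)" using assms(1) edge_set_subset unfolding even_edges_def by blast
  fix v
  have "deg (F - D \<union> D) v = deg (F - D) v + deg D v" using fin by (intro deg_Un_disjoint) auto
  moreover have "F - D \<union> D = F" using assms(3) by auto
  moreover have "even (deg F v)" "even (deg D v)" using assms unfolding even_edges_def by auto
  ultimately show "even (deg (F - D) v)" by simp
qed

lemma even_edges_sym_diff:
  assumes "even_edges A" "even_edges B"
  shows "even_edges ((A - B) \<union> (B - A))"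
  unfolding even_edges_def
proof (intro conjI allI)
  have fin: "finite A" "finite B" using assms unfolding even_edges_def edge_set_def by auto
  show "edge_set ((A - B) \<union> (B - A))" using assms unfolding even_edges_def edge_set_def by auto
  fix v
  have "deg ((A - B) \<union> (A \<inter> B)) v = deg (A - B) v + deg (A \<inter> B) v"
    "deg ((B - A) \<union> (A \<inter> B)) v = deg (B - A) v + deg (A \<inter> B) v"
    "deg ((A - B) \<union> (B - A)) v = deg (A - B) v + deg (B - A) v"
    using fin by (auto intro!: deg_Un_disjoint)
  moreover have "(A - B) \<union> (A \<inter> B) = A" "(B - A) \<union> (A \<inter> B) = B" by auto
  moreover have "even (deg A v)" "even (deg B v)" using assms unfolding even_edges_def by auto
  ultimately show "even (deg ((A - B) \<union> (B - A)) v)" by (metis even_add)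
qed

lemma obtain_edge:
  assumes "card e = 2" "v \<in> e" obtains w where "e = {v, w}" "w \<noteq> v"
  using assms by (metis card_2_iff insertE insert_commute singletonD)

text \<open>An end vertex of a longest path has a second neighbour, which lies on the path.\<close>

lemma exists_cycle:
  assumes F: "edge_set F" "F \<noteq> {}" and deg: "\<And>v. deg F v \<noteq> 1"
  shows "\<exists>c. is_cycle F c"
proof -
  define P where "P ws \<longleftrightarrow> distinct ws \<and> length ws \<ge> 2 \<and> (\<forall>i. Suc i < length ws \<longrightarrow> {ws ! i, ws ! Suc i} \<in> F)" for ws
  have fin: "finite (\<Union>F)" by (rule edge_set_finite_Union[OF F(1)])
  obtain e where e: "e \<in> F" using F(2) by blast
  then obtain u w where uw: "e = {u, w}" "u \<noteq> w" using F(1) unfolding edge_set_def by (meson card_2_iff)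
  have P0: "P [u, w]" using e uw unfolding P_def by auto
  have bound: "\<forall>ws. P ws \<longrightarrow> length ws < Suc (card (\<Union>F))"
  proof (intro allI impI)
    fix ws assume P: "P ws"
    have "set ws \<subseteq> \<Union>F"
    proof
      fix v assume "v \<in> set ws"
      then obtain i where i: "i < length ws" "v = ws ! i" by (metis in_set_conv_nth)
      show "v \<in> \<Union>F"
      proof (cases "Suc i < length ws")
        case True thus ?thesis using P i unfolding P_def by blast
      next
        case False
        hence "i = Suc (i - 1)" "Suc (i - 1) < length ws" using i P unfolding P_def by auto
        hence "{ws ! (i - 1), ws ! i} \<in> F" using P unfolding P_def by metis
        thus ?thesis using i by blast
      qed
    qed
    hence "card (set ws) \<le> card (\<Union>F)" using fin card_mono by blast
    thus "length ws < Suc (card (\<Union>F))" using P unfolding P_def by (simp add: distinct_card)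
  qed
  obtain ws where ws: "P ws" "\<And>ws'. P ws' \<Longrightarrow> length ws' \<le> length ws"
    using ex_has_greatest_nat[of P "[u, w]" length "Suc (card (\<Union>F))", OF P0 bound] by blast
  have ws': "distinct ws" "length ws \<ge> 2" "\<And>i. Suc i < length ws \<Longrightarrow> {ws ! i, ws ! Suc i} \<in> F"
    using ws(1) unfolding P_def by auto
  define v where "v = ws ! 0"
  have e0: "{v, ws ! 1} \<in> F" using ws'(3)[of 0] ws'(2) unfolding v_def by simp
  have "{e \<in> F. v \<in> e} \<noteq> {{v, ws ! 1}}" using deg[of v] unfolding deg_def by (metis is_singletonI is_singleton_altdef)
  then obtain e' where e': "e' \<in> F" "v \<in> e'" "e' \<noteq> {v, ws ! 1}" using e0 by blast
  then obtain x where x: "e' = {v, x}" "x \<noteq> v" using F(1) obtain_edge unfolding edge_set_def by metis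
  have "x \<in> set ws"
  proof (rule ccontr)
    assume no: "x \<notin> set ws"
    have "P (x # ws)" unfolding P_def
    proof (intro conjI allI impI)
      show "distinct (x # ws)" "length (x # ws) \<ge> 2" using no ws' by auto
      fix i assume "Suc i < length (x # ws)"
      thus "{(x # ws) ! i, (x # ws) ! Suc i} \<in> F"
        using ws'(3)[of "i - 1"] e'(1) x(1) unfolding v_def by (cases i) (auto simp: insert_commute)
    qed
    from ws(2)[OF this] show False by simp
  qed
  then obtain j where j: "j < length ws" "x = ws ! j" by (metis in_set_conv_nth)
  have "j \<noteq> 0" "j \<noteq> 1" using j x e' unfolding v_def by auto
  hence j2: "j \<ge> 2" by simp
  define c where "c = take (Suc j) ws"
  have len: "length c = Suc j" using j unfolding c_def by simp
  have nth: "c ! i = ws ! i" if "i \<le> j" for i using that unfolding c_def by simp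
  have "is_cycle F c" unfolding is_cycle_def
  proof (intro conjI allI impI)
    show "3 \<le> length c" "distinct c" using len j2 ws'(1) unfolding c_def by auto
    fix i assume i: "i < length c"
    show "{c ! i, c ! (Suc i mod length c)} \<in> F"
    proof (cases "i = j")
      case True
      thus ?thesis using e'(1) x(1) j(2) nth[of 0] nth[of j] len unfolding v_def by (simp add: insert_commute)
    next
      case False
      thus ?thesis using i len nth[of i] nth[of "Suc i"] ws'(3)[of i] j by simp
    qed
  qed
  thus ?thesis ..
qed

lemma exists_leaf:
  assumes "edge_set F" "F \<noteq> {}" "\<nexists>c. is_cycle F c"
  obtains v e where "e \<in> F" "v \<in> e" "\<And>f. f \<in> F \<Longrightarrow> v \<in> f \<Longrightarrow> f = e"
proof -
  obtain v where "deg F v = 1" using exists_cycle[OF assms(1,2)] assms(3) by blast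
  then obtain e where "{e \<in> F. v \<in> e} = {e}" unfolding deg_def by (metis card_1_singletonE)
  thus thesis using that[of e v] by blast
qed

text \<open>A leaf is deleted together with its edge. \<open>V\<close> may contain isolated
  vertices, because the count of faces keeps the vertex set fixed while edges are removed.\<close>

lemma acyclic_card:
  assumes "edge_set F" "\<nexists>c. is_cycle F c" "\<Union>F \<subseteq> V" "finite V" "V \<noteq> {}"
  shows "card F + 1 \<le> card V"
  using assms
proof (induction "card F" arbitrary: F V)
  case 0
  hence "F = {}" unfolding edge_set_def by auto
  thus ?case using 0 by (simp add: Suc_le_eq card_gt_0_iff)
next
  case (Suc n)
  hence "F \<noteq> {}" by auto
  then obtain v e where ve: "e \<in> F" "v \<in> e" "\<And>f. f \<in> F \<Longrightarrow> v \<in> f \<Longrightarrow> f = e"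
    using exists_leaf Suc.prems by metis
  obtain w where w: "e = {v, w}" "w \<noteq> v" using obtain_edge ve Suc.prems(1) unfolding edge_set_def by metis
  have fin: "finite F" using Suc.prems(1) unfolding edge_set_def by blast
  have n: "n = card (F - {e})" using Suc(2) fin ve(1) by simp
  have "card (F - {e}) + 1 \<le> card (V - {v})"
  proof (rule Suc(1)[OF n])
    show "edge_set (F - {e})" using edge_set_subset Suc.prems(1) by blast
    show "\<nexists>c. is_cycle (F - {e}) c" using Suc.prems(2) is_cycle_mono by blast
    show "\<Union>(F - {e}) \<subseteq> V - {v}" using Suc.prems(3) ve(3) by blast
    show "finite (V - {v})" using Suc.prems(4) by simp
    have "w \<in> V - {v}" using Suc.prems(3) ve(1) w by blast
    thus "V - {v} \<noteq> {}" by blast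
  qed
  moreover have "v \<in> V" using Suc.prems(3) ve by blast
  hence "card (V - {v}) = card V - 1" "card V > 0"
    using Suc.prems(4,5) by (simp_all add: card_gt_0_iff)
  ultimately show ?case using Suc(2) n by linarith
qed

lemma cycle_length_le_card:
  assumes "is_cycle F c" "edge_set F" shows "length c \<le> card F"
  using assms card_cycle_edges[OF assms(1)] card_mono[of F "cycle_edges c"]
  unfolding is_cycle_iff edge_set_def by auto

text \<open>Removing the edges of a cycle keeps all degrees even, so the set decomposes into cycles,
  each with \<open>p\<close> edges.\<close>

lemma even_edges_card_dvd:
  assumes "even_edges F" "\<And>c. is_cycle F c \<Longrightarrow> length c = p"
  shows "p dvd card F"
  using assms
proof (induction "card F" arbitrary: F rule: less_induct)
  case less
  show ?case
  proof (cases "F = {}")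
    case False
    have F: "edge_set F" "finite F" using less.prems unfolding even_edges_def edge_set_def by auto
    have "deg F v \<noteq> 1" for v using less.prems(1) unfolding even_edges_def by (metis odd_one)
    then obtain c where c: "is_cycle F c" using exists_cycle[OF F(1) False] by blast
    have cF: "cycle_edges c \<subseteq> F" using c unfolding is_cycle_iff by blast
    have "card (cycle_edges c) = p" using card_cycle_edges[OF c] less.prems(2)[OF c] by simp
    moreover have "p \<ge> 3" using less.prems(2)[OF c] c unfolding is_cycle_iff by auto
    ultimately have card: "card F = card (F - cycle_edges c) + p" "card (F - cycle_edges c) < card F"
      using card_Diff_subset[OF finite_subset[OF cF F(2)] cF] card_mono[OF F(2) cF] by auto
    have "p dvd card (F - cycle_edges c)"
    proof (rule less.hyps[OF card(2)])
      show "even_edges (F - cycle_edges c)"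
        using even_edges_Diff[OF less.prems(1) even_edges_cycle[OF c F(1)] cF] .
      show "\<And>c'. is_cycle (F - cycle_edges c) c' \<Longrightarrow> length c' = p"
        using less.prems(2) is_cycle_mono by blast
    qed
    thus ?thesis using card(1) by simp
  qed simp
qed

text \<open>Unlike a condition \<open>girth E = enat p\<close>, this passes to all subsets of the
  edges, as the recursion on subgraphs requires.\<close>

definition short_cycles :: "nat \<Rightarrow> nat \<Rightarrow> 'a set set \<Rightarrow> bool" where
  "short_cycles p N E \<longleftrightarrow> edge_set E \<and> (\<forall>c. is_cycle E c \<longrightarrow> length c = p \<or> N \<le> length c)"

lemma short_cycles_subset: "short_cycles p N E \<Longrightarrow> F \<subseteq> E \<Longrightarrow> short_cycles p N F"
  unfolding short_cycles_def using edge_set_subset is_cycle_mono by metis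

text \<open>A cycle within fewer than \<open>2 * p \<le> N\<close> edges has length
  \<open>p\<close>, so the size is a positive multiple of \<open>p\<close> below
  \<open>2 * p\<close>.\<close>

lemma even_card_eq:
  assumes E: "short_cycles p N E" and "2 * p \<le> N" and F: "F \<subseteq> E" "even_edges F" "F \<noteq> {}" "card F < 2 * p"
  shows "card F = p"
proof -
  have "length c = p" if c: "is_cycle F c" for c
    using E is_cycle_mono[OF c F(1)] cycle_length_le_card[OF c] F assms(2)
    unfolding short_cycles_def even_edges_def by fastforce
  hence "p dvd card F" using even_edges_card_dvd[OF F(2)] by blast
  then obtain k where k: "card F = k * p" by (metis dvd_def mult.commute)
  have "card F > 0" using F unfolding even_edges_def edge_set_def by (simp add: card_gt_0_iff)
  hence "k > 0" using k by simp
  moreover have "k < 2" using F(4) unfolding k mult_less_cancel2 by blast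
  ultimately have "k = 1" by simp
  thus ?thesis using k by simp
qed

text \<open>If two different \<open>p\<close>-cycles shared an edge, their symmetric difference
  would be a nonempty even set with \<open>2 * (p - card (A \<inter> B)) < 2 * p\<close> edges. It
  would have exactly \<open>p\<close> edges, but \<open>p\<close> is odd.\<close>

lemma p_cycles_edge_disjoint:
  assumes E: "short_cycles p N E" and N: "2 * p \<le> N" and p: "odd p"
    and c: "is_cycle E c" "length c = p" and d: "is_cycle E d" "length d = p"
    and ne: "cycle_edges c \<noteq> cycle_edges d"
  shows "cycle_edges c \<inter> cycle_edges d = {}"
proof (rule ccontr)
  assume meet: "\<not> ?thesis"
  define A where "A = cycle_edges c"
  define B where "B = cycle_edges d"
  have es: "edge_set E" using E unfolding short_cycles_def by blast
  have ev: "even_edges A" "even_edges B" unfolding A_def B_def using even_edges_cycle c d es by blast+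
  have fin: "finite A" "finite B" using ev unfolding even_edges_def edge_set_def by auto
  have card: "card A = p" "card B = p" unfolding A_def B_def using card_cycle_edges c d by metis+
  have sub: "A \<subseteq> E" "B \<subseteq> E" using c d unfolding A_def B_def is_cycle_iff by auto
  have "card ((A - B) \<union> (B - A)) = card (A - B) + card (B - A)"
    using fin by (intro card_Un_disjoint) auto
  moreover have "card (A - B) = p - card (A \<inter> B)" "card (B - A) = p - card (A \<inter> B)"
    using fin card by (simp_all add: card_Diff_subset_Int Int_commute)
  moreover have "card (A \<inter> B) > 0" using meet fin unfolding A_def B_def by (simp add: card_gt_0_iff)
  moreover have "card ((A - B) \<union> (B - A)) = p"
  proof (rule even_card_eq[OF E N])
    show "even_edges ((A - B) \<union> (B - A))" using even_edges_sym_diff[OF ev] .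
    show "(A - B) \<union> (B - A) \<subseteq> E" using sub by blast
    show "(A - B) \<union> (B - A) \<noteq> {}" using ne unfolding A_def B_def by blast
    have "p > 0" using p by (metis even_zero gr0I)
    thus "card ((A - B) \<union> (B - A)) < 2 * p" using calculation by linarith
  qed
  ultimately have "p = 2 * (p - card (A \<inter> B))" by linarith
  thus False using p by (metis dvd_triv_left)
qed

text \<open>The handshake lemma: the degrees add up to twice the number of edges.\<close>

lemma even_odd_vertices:
  assumes "edge_set F" shows "even (card {v. odd (deg F v)})"
proof -
  have fin: "finite F" "finite (\<Union>F)" using assms edge_set_finite_Union unfolding edge_set_def by auto
  have "(\<Sum>v\<in>\<Union>F. deg F v) = (\<Sum>v\<in>\<Union>F. \<Sum>e\<in>F. if v \<in> e then 1 else 0)"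
    unfolding deg_def using fin(1) by (simp add: sum.If_cases Int_def)
  also have "\<dots> = (\<Sum>e\<in>F. \<Sum>v\<in>\<Union>F. if v \<in> e then 1 else 0)" by (rule sum.swap)
  also have "\<dots> = (\<Sum>e\<in>F. 2)"
  proof (intro sum.cong refl)
    fix e assume "e \<in> F"
    hence "\<Union>F \<inter> e = e" "card e = 2" using assms unfolding edge_set_def by auto
    thus "(\<Sum>v\<in>\<Union>F. if v \<in> e then 1 else 0) = (2::nat)"
      using fin(2) by (simp add: sum.If_cases Collect_mem_eq)
  qed
  finally have "even (\<Sum>v\<in>\<Union>F. deg F v)" by simp
  hence "even (card {v \<in> \<Union>F. odd (deg F v)})" using even_sum_iff[OF fin(2)] by blast
  moreover have "{v \<in> \<Union>F. odd (deg F v)} = {v. odd (deg F v)}"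
  proof -
    have "v \<in> \<Union>F" if "odd (deg F v)" for v
      using deg_eq_0[of v F] that by (cases "v \<in> \<Union>F") (simp_all only: even_zero simp_thms)
    hence "(v \<in> \<Union>F \<and> odd (deg F v)) = odd (deg F v)" for v by metis
    thus ?thesis by (simp only:)
  qed
  ultimately show ?thesis by simp
qed

text \<open>The odd vertices of \<open>A\<close> lie on the cycle \<open>c\<close>. They split \<open>c\<close> into two complementary sets of arcs,
  each of which completes \<open>A\<close> to an even set; the sizes of these two even sets add up to an odd number.\<close>

lemma p_cycle_one_side:
  assumes E: "short_cycles p N E" and N: "2 * p \<le> N" and p: "odd p"
    and c: "is_cycle E c" "length c = p" and d: "is_cycle E d" "length d = p"
    and disj: "cycle_edges c \<inter> cycle_edges d = {}"
    and A: "A \<subseteq> cycle_edges d" "\<And>v. v \<notin> set c \<Longrightarrow> even (deg A v)"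
  shows "A = {} \<or> A = cycle_edges d"
proof (rule ccontr)
  assume no: "\<not> ?thesis"
  have es: "edge_set E" using E unfolding short_cycles_def by blast
  have dc: "distinct c" "length c \<ge> 3" "cycle_edges c \<subseteq> E" "cycle_edges d \<subseteq> E"
    using c d unfolding is_cycle_iff by auto
  have ev: "even_edges (cycle_edges c)" using even_edges_cycle[OF c(1) es] .
  have fin: "finite (cycle_edges c)" "finite (cycle_edges d)" "finite A" "edge_set A"
  proof -
    have fE: "finite E" using es unfolding edge_set_def by blast
    show "finite (cycle_edges c)" "finite (cycle_edges d)"
      using finite_subset[OF dc(3) fE] finite_subset[OF dc(4) fE] .
    thus "finite A" using finite_subset[OF A(1)] by blast
    show "edge_set A" using edge_set_subset[OF es] A(1) dc(4) by (metis order_trans)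
  qed
  define T where "T = {v. odd (deg A v)}"
  have T: "T \<subseteq> set c" "even (card T)" using A(2) even_odd_vertices[OF fin(4)] unfolding T_def by auto
  \<comment> \<open>\<open>f i\<close> counts the odd vertices among
    \<open>c ! 0, ..., c ! i\<close>, and edge \<open>i\<close> of \<open>c\<close> is selected if
    this count is odd. Selection thus switches exactly at the vertices of \<open>T\<close>; at
    \<open>c ! 0\<close> this is consistent because \<open>card T\<close> is even.\<close>
  define f where "f i = card {j. j \<le> i \<and> c ! j \<in> T}" for i
  define S where "S = {i. i < p \<and> odd (f i)}"
  have S: "S \<subseteq> {..<length c}" unfolding S_def using c(2) by auto
  define J where "J = cyc_edge c ` S"
  have Jc: "J \<subseteq> cycle_edges c" using S unfolding J_def cycle_edges_def by auto
  have finJ: "finite J" using Jc fin finite_subset by blast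
  have f_Suc: "f (Suc i) = f i + (if c ! Suc i \<in> T then 1 else 0)" for i
  proof -
    have "{j. j \<le> Suc i \<and> c ! j \<in> T} = {j. j \<le> i \<and> c ! j \<in> T} \<union> (if c ! Suc i \<in> T then {Suc i} else {})"
      by (auto simp: le_Suc_eq)
    moreover have "finite {j. j \<le> i \<and> c ! j \<in> T}" by simp
    ultimately show ?thesis unfolding f_def by (simp add: card_insert_if)
  qed
  have f0: "f 0 = (if c ! 0 \<in> T then 1 else 0)"
  proof -
    have "{j. j \<le> 0 \<and> c ! j \<in> T} = (if c ! 0 \<in> T then {0} else {})" by auto
    thus ?thesis unfolding f_def by simp
  qed
  have f_last: "f (p - 1) = card T"
  proof -
    have "p > 0" using dc(2) c(2) by simp
    have "bij_betw (\<lambda>j. c ! j) {j. j \<le> p - 1 \<and> c ! j \<in> T} T"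
      unfolding bij_betw_def
    proof
      show "inj_on ((!) c) {j. j \<le> p - 1 \<and> c ! j \<in> T}"
      proof (rule inj_onI)
        fix i j assume "i \<in> {j. j \<le> p - 1 \<and> c ! j \<in> T}" "j \<in> {j. j \<le> p - 1 \<and> c ! j \<in> T}" "c ! i = c ! j"
        moreover from this have "i < length c" "j < length c" using c(2) dc(2) by auto
        ultimately show "i = j" using dc(1) nth_eq_iff_index_eq by blast
      qed
      show "(!) c ` {j. j \<le> p - 1 \<and> c ! j \<in> T} = T"
      proof
        show "T \<subseteq> (!) c ` {j. j \<le> p - 1 \<and> c ! j \<in> T}"
        proof
          fix v assume v: "v \<in> T"
          then obtain j where "j < length c" "v = c ! j" using T(1) by (metis in_set_conv_nth subsetD)
          thus "v \<in> (!) c ` {j. j \<le> p - 1 \<and> c ! j \<in> T}" using v c(2) by auto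
        qed
      qed auto
    qed
    thus ?thesis unfolding f_def by (rule bij_betw_same_card)
  qed
  have parJ: "odd (deg J v) \<longleftrightarrow> v \<in> T" for v
  proof (cases "v \<in> set c")
    case True
    then obtain i where i: "i < length c" "v = c ! i" by (metis in_set_conv_nth)
    have ne: "cyc_pred c i \<noteq> i" using i dc(2) unfolding cyc_pred_def by auto
    have lt: "cyc_pred c i < p" "i < p" using i c(2) dc(2) unfolding cyc_pred_def by auto
    have "deg J v = card (S \<inter> {i, cyc_pred c i})"
      unfolding J_def i(2) deg_cyc_edge_image[OF dc(1,2) S] indices_at_vertex[OF dc(1,2) i(1) S] ..
    also have "\<dots> = (if odd (f i) then 1 else 0) + (if odd (f (cyc_pred c i)) then 1 else 0)"
      using ne lt unfolding S_def by (auto simp: Int_insert_right)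
    finally have "odd (deg J v) \<longleftrightarrow> odd (f i + f (cyc_pred c i))" by auto
    also have "\<dots> \<longleftrightarrow> v \<in> T"
    proof (cases i)
      case 0
      thus ?thesis using f0 f_last T(2) i(2) c(2) unfolding cyc_pred_def by simp
    next
      case (Suc k)
      thus ?thesis using f_Suc[of k] i(2) unfolding cyc_pred_def by simp
    qed
    finally show ?thesis .
  next
    case False
    hence "v \<notin> \<Union>J" using Union_cycle_edges[OF c(1)] Jc by blast
    hence "deg J v = 0" by (rule deg_eq_0)
    moreover have "v \<notin> T" using False T(1) by blast
    ultimately show ?thesis by simp
  qed
  have disjAJ: "A \<inter> J = {}" "A \<inter> (cycle_edges c - J) = {}" using A(1) Jc disj by blast+
  have evJ: "even (deg (A \<union> J) v)" for v
  proof -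
    have "deg (A \<union> J) v = deg A v + deg J v" by (rule deg_Un_disjoint[OF fin(3) finJ disjAJ(1)])
    thus ?thesis using parJ[of v] unfolding T_def by simp
  qed
  have evJ': "even (deg (A \<union> (cycle_edges c - J)) v)" for v
  proof -
    have "deg (A \<union> (cycle_edges c - J)) v = deg A v + deg (cycle_edges c - J) v"
      by (rule deg_Un_disjoint[OF fin(3) finite_Diff[OF fin(1)] disjAJ(2)])
    moreover have "deg ((cycle_edges c - J) \<union> J) v = deg (cycle_edges c - J) v + deg J v"
      using fin finJ by (intro deg_Un_disjoint) auto
    moreover have "(cycle_edges c - J) \<union> J = cycle_edges c" using Jc by blast
    moreover have "even (deg (cycle_edges c) v)" using ev unfolding even_edges_def by blast
    ultimately show ?thesis using parJ[of v] unfolding T_def by (metis (mono_tags) even_add mem_Collect_eq)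
  qed
  have cc: "card (cycle_edges c) = p" "card (cycle_edges d) = p" using card_cycle_edges c d by metis+
  have cA: "card A < p" "A \<noteq> {}" using psubset_card_mono[OF fin(2), of A] A(1) no cc by auto
  have cJ: "card J \<le> p" using card_mono[OF fin(1) Jc] cc by simp
  have cJ': "card (cycle_edges c - J) = p - card J" using card_Diff_subset[OF finJ Jc] cc by simp
  have u1: "card (A \<union> J) = card A + card J" using card_Un_disjoint[OF fin(3) finJ disjAJ(1)] .
  have u2: "card (A \<union> (cycle_edges c - J)) = card A + (p - card J)"
    using card_Un_disjoint[OF fin(3) _ disjAJ(2)] fin(1) cJ' by simp
  have sub1: "A \<union> J \<subseteq> E" "A \<union> (cycle_edges c - J) \<subseteq> E" using A(1) Jc dc by blast+
  have "card (A \<union> J) = p"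
  proof (rule even_card_eq[OF E N sub1(1)])
    show "even_edges (A \<union> J)" using evJ edge_set_subset[OF es sub1(1)] unfolding even_edges_def by blast
    show "A \<union> J \<noteq> {}" using cA by blast
    show "card (A \<union> J) < 2 * p" using u1 cA cJ by linarith
  qed
  moreover have "card (A \<union> (cycle_edges c - J)) = p"
  proof (rule even_card_eq[OF E N sub1(2)])
    show "even_edges (A \<union> (cycle_edges c - J))"
      using evJ' edge_set_subset[OF es sub1(2)] unfolding even_edges_def by blast
    show "A \<union> (cycle_edges c - J) \<noteq> {}" using cA by blast
    show "card (A \<union> (cycle_edges c - J)) < 2 * p" using u2 cA cJ by linarith
  qed
  ultimately have "p = 2 * card A" using u1 u2 cJ by linarith
  thus False using p by (metis dvd_triv_left)
qed

section \<open>Arcs and complementary domains in the plane\<close>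

abbreviation open_arc :: "(real \<Rightarrow> complex) \<Rightarrow> complex set" where
  "open_arc \<alpha> \<equiv> path_image \<alpha> - {pathstart \<alpha>, pathfinish \<alpha>}"

text \<open>The times with \<open>r \<le> h\<close> form a compact set. Its minimum is the first
  exit, and the intermediate value theorem rules out \<open>r < h t\<close> there.\<close>

lemma first_exit:
  fixes h :: "real \<Rightarrow> real"
  assumes "continuous_on {a..b} h" "h a < r" "r < h b" "a \<le> b"
  obtains t where "a < t" "t < b" "h t = r" "\<And>s. a \<le> s \<Longrightarrow> s < t \<Longrightarrow> h s < r"
proof -
  define S where "S = {s \<in> {a..b}. r \<le> h s}"
  have "closed S" unfolding S_def
    using continuous_closed_preimage[OF assms(1), of "{r..}"] by (simp add: vimage_def Int_def)
  moreover have "bounded S" unfolding S_def by (rule bounded_subset[of "{a..b}"]) auto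
  moreover have "b \<in> S" using assms unfolding S_def by auto
  ultimately obtain t where t: "t \<in> S" "\<And>s. s \<in> S \<Longrightarrow> t \<le> s"
    using compact_attains_inf[of S] compact_eq_bounded_closed by blast
  have lt: "h s < r" if "a \<le> s" "s < t" for s
    using t(2)[of s] t(1) that unfolding S_def by fastforce
  have "t \<noteq> a" using t(1) assms(2) unfolding S_def by auto
  hence at: "a < t" "t \<le> b" using t(1) unfolding S_def by auto
  have "h t = r"
  proof (rule ccontr)
    assume "h t \<noteq> r"
    hence "r < h t" using t(1) unfolding S_def by auto
    moreover have "continuous_on {a..t} h" using assms(1) at by (auto intro: continuous_on_subset)
    ultimately obtain s where "a \<le> s" "s \<le> t" "h s = r"
      using IVT'[of h a r t] assms(2) at by auto
    thus False using lt[of s] \<open>r < h t\<close> by (cases "s = t") auto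
  qed
  moreover from this have "t \<noteq> b" using assms(3) by auto
  ultimately show thesis using that[of t] at lt by auto
qed

text \<open>The arc crosses a small disc around \<open>x\<close> in a crosscut, which splits the disc into two domains.
  By Janiszewski's theorem the returns of the arc to the disc do not separate two points of the same
  domain that are close to \<open>x\<close>: together with the circle these returns miss a neighbourhood of \<open>x\<close>, and
  they meet the union of circle and crosscut exactly in the circle.\<close>

lemma arc_sides:
  fixes \<alpha> :: "real \<Rightarrow> complex"
  assumes arc: "arc \<alpha>" and K: "compact K"
    and x: "x \<in> open_arc \<alpha>"
    and disj: "open_arc \<alpha> \<inter> K = {}"
  obtains W P Q where "open W" "connected W" "x \<in> W" "W \<inter> K = {}" "W - path_image \<alpha> \<subseteq> P \<union> Q"
    "\<And>y z. y \<in> P \<Longrightarrow> z \<in> P \<Longrightarrow> connected_component (- (K \<union> path_image \<alpha>)) y z"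
    "\<And>y z. y \<in> Q \<Longrightarrow> z \<in> Q \<Longrightarrow> connected_component (- (K \<union> path_image \<alpha>)) y z"
    "W \<inter> path_image \<alpha> \<subseteq> closure P" "W \<inter> path_image \<alpha> \<subseteq> closure Q"
proof -
  have inj: "inj_on \<alpha> {0..1}" and cont: "continuous_on {0..1} \<alpha>"
    using arc unfolding arc_def path_def by auto
  obtain t0 where t0: "t0 \<in> {0..1}" "x = \<alpha> t0" using x unfolding path_image_def by auto
  have t01: "0 < t0" "t0 < 1"
    using x t0 unfolding pathstart_def pathfinish_def by (auto simp: order_less_le)
  have "open (- (K \<union> {\<alpha> 0, \<alpha> 1}))"
    using K by (intro open_Compl closed_Un compact_imp_closed) auto
  moreover have "x \<in> - (K \<union> {\<alpha> 0, \<alpha> 1})"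
    using x disj unfolding pathstart_def pathfinish_def by auto
  ultimately obtain r where r: "r > 0" "cball x r \<subseteq> - (K \<union> {\<alpha> 0, \<alpha> 1})"
    by (meson open_contains_cball)
  have far: "dist x (\<alpha> 0) > r" "dist x (\<alpha> 1) > r" using r(2) by (auto simp: subset_iff not_le)
  define h where "h t = dist x (\<alpha> t)" for t
  have h: "continuous_on {0..1} h" unfolding h_def by (intro continuous_intros cont)
  obtain t2 where t2: "t0 < t2" "t2 < 1" "h t2 = r" "\<And>s. t0 \<le> s \<Longrightarrow> s < t2 \<Longrightarrow> h s < r"
    using first_exit[of t0 1 h r] continuous_on_subset[OF h, of "{t0..1}"] t01 far r t0(2)
    unfolding h_def by (auto simp: dist_commute)
  \<comment> \<open>Time is reversed: the last entrance into the disc before \<open>t0\<close> is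
    the first exit of the reversed arc.\<close>
  have "continuous_on {- t0..0} (\<lambda>s. h (- s))"
    using t01 by (intro continuous_on_compose2[OF h] continuous_intros) auto
  then obtain t1' where t1': "- t0 < t1'" "t1' < 0" "h (- t1') = r" "\<And>s. - t0 \<le> s \<Longrightarrow> s < t1' \<Longrightarrow> h (- s) < r"
    using first_exit[of "- t0" 0 "\<lambda>s. h (- s)" r] t01 far r t0(2) unfolding h_def by auto
  define t1 where "t1 = - t1'"
  have t1: "0 < t1" "t1 < t0" "h t1 = r" "\<And>s. t1 < s \<Longrightarrow> s \<le> t0 \<Longrightarrow> h s < r"
    using t1' t1'(4)[of "- s" for s] unfolding t1_def by auto
  have h_lt: "h s < r" if "t1 < s" "s < t2" for s
    using t1(4)[of s] t2(4)[of s] that by linarith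
  define a where "a = \<alpha> t1"
  define b where "b = \<alpha> t2"
  define c where "c = subpath t1 t2 \<alpha>"
  \<comment> \<open>The parts of the arc before and after the crosscut \<open>c\<close>; they may
    return into the disc.\<close>
  define R where "R = \<alpha> ` ({0..t1} \<union> {t2..1})"
  have c: "arc c" "pathstart c = a" "pathfinish c = b" "path_image c = \<alpha> ` {t1..t2}"
    using t1 t2 t01 arc unfolding c_def a_def b_def
    by (auto intro!: arc_subpath_arc simp: path_image_subpath)
  have ab: "a \<noteq> b" using inj t1 t2 t01 unfolding a_def b_def inj_on_def by force
  have Rc: "R \<inter> path_image c \<subseteq> {a, b}"
  proof
    fix z assume "z \<in> R \<inter> path_image c"
    then obtain s s' where s: "s \<in> {0..t1} \<union> {t2..1}" "z = \<alpha> s" "s' \<in> {t1..t2}" "z = \<alpha> s'"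
      unfolding R_def c(4) by blast
    hence "s \<in> {0..1}" "s' \<in> {0..1}" using t1 t2 t01 by auto
    hence "s = s'" using inj_onD[OF inj, of s s'] s by simp
    hence "s = t1 \<or> s = t2" using s t1 t2 by auto
    thus "z \<in> {a, b}" using s unfolding a_def b_def by auto
  qed
  have imUn: "path_image \<alpha> = R \<union> path_image c"
  proof -
    have split: "{0..1} = {0..t1} \<union> {t2..1} \<union> {t1..t2}" using t1 t2 t01 by auto
    have "path_image \<alpha> = \<alpha> ` ({0..t1} \<union> {t2..1} \<union> {t1..t2})"
      unfolding path_image_def split[symmetric] ..
    thus ?thesis unfolding R_def c(4) image_Un .
  qed
  have xR: "x \<notin> R"
  proof
    assume "x \<in> R"
    then obtain s where s: "s \<in> {0..t1} \<union> {t2..1}" "\<alpha> t0 = \<alpha> s" unfolding R_def t0(2) by blast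
    hence "s \<in> {0..1}" using t1 t2 t01 by auto
    hence "t0 = s" using inj_onD[OF inj s(2)] t0(1) by blast
    thus False using s(1) t1 t2 by auto
  qed
  have csph: "path_image c \<inter> sphere x r = {a, b}"
  proof
    show "path_image c \<inter> sphere x r \<subseteq> {a, b}"
    proof
      fix z assume "z \<in> path_image c \<inter> sphere x r"
      then obtain s where s: "s \<in> {t1..t2}" "z = \<alpha> s" "h s = r" unfolding c(4) h_def by auto
      hence "s = t1 \<or> s = t2" using h_lt[of s] by force
      thus "z \<in> {a, b}" using s unfolding a_def b_def by auto
    qed
    show "{a, b} \<subseteq> path_image c \<inter> sphere x r"
      using t1 t2 unfolding c(4) a_def b_def h_def by auto
  qed
  have ccball: "path_image c \<subseteq> cball x r"
  proof
    fix z assume "z \<in> path_image c"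
    then obtain s where "s \<in> {t1..t2}" "z = \<alpha> s" unfolding c(4) by auto
    moreover have "h s \<le> r" using h_lt[of s] t1(3) t2(3) \<open>s \<in> _\<close>
      by (cases "s = t1"; cases "s = t2") auto
    ultimately show "z \<in> cball x r" unfolding h_def by auto
  qed
  have "simple_path (circlepath x r)" "path_image (circlepath x r) = sphere x r"
    "pathfinish (circlepath x r) = pathstart (circlepath x r)"
    using r by (auto simp: simple_path_circlepath)
  then obtain u d where ud: "arc u" "arc d" "pathstart u = a" "pathfinish u = b"
    "pathstart d = b" "pathfinish d = a" "path_image u \<inter> path_image d = {a, b}"
    "path_image u \<union> path_image d = sphere x r"
    using exists_double_arc[of "circlepath x r" a b] csph ab by (metis IntD2 insertI1 insertI2)
  define d' where "d' = reversepath d"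
  have d': "arc d'" "pathstart d' = a" "pathfinish d' = b" "path_image d' = path_image d"
    using ud unfolding d'_def by (auto simp: arc_reversepath)
  have uc: "path_image u \<inter> path_image c = {a, b}" and dc: "path_image d' \<inter> path_image c = {a, b}"
    using csph ud(7,8) d'(4) by blast+
  have ins: "inside (path_image u \<union> path_image d') = ball x r"
    using inside_frontier_eq_interior[of "cball x r"] ud(8) d'(4) by simp
  have xc: "x \<in> path_image c" unfolding c(4) using t0 t1 t2 by auto
  define I1 where "I1 = inside (path_image u \<union> path_image c)"
  define I2 where "I2 = inside (path_image d' \<union> path_image c)"
  have "path_image c \<inter> inside (path_image u \<union> path_image d') \<noteq> {}"
    using ins xc r by auto
  \<comment> \<open>Crosscut and circle form a theta curve; \<open>I1\<close> and \<open>I2\<close>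
    are the two domains inside it.\<close>
  then have I12: "I1 \<union> I2 \<union> (path_image c - {a, b}) = ball x r"
    using split_inside_simple_closed_curve[of u a b d' c] ud d' c uc dc ab ins
    unfolding I1_def I2_def by (metis arc_imp_simple_path)
  have jordan: "connected (inside (path_image v \<union> path_image c))"
    "path_image c \<subseteq> frontier (inside (path_image v \<union> path_image c))"
    "inside (path_image v \<union> path_image c) \<inter> path_image c = {}"
    if v: "arc v" "pathstart v = a" "pathfinish v = b" "path_image v \<inter> path_image c = {a, b}" for v
  proof -
    have sp: "simple_path (v +++ reversepath c)"
      using v c by (intro simple_path_join_loop) (auto simp: arc_reversepath)
    have im: "path_image (v +++ reversepath c) = path_image v \<union> path_image c"
      using v c by (simp add: path_image_join)
    have "pathfinish (v +++ reversepath c) = pathstart (v +++ reversepath c)"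
      using v c by simp
    from Jordan_inside_outside[OF sp this, unfolded im]
    show "connected (inside (path_image v \<union> path_image c))"
      "path_image c \<subseteq> frontier (inside (path_image v \<union> path_image c))"
      "inside (path_image v \<union> path_image c) \<inter> path_image c = {}"
      by blast+
  qed
  note j1 = jordan[OF ud(1,3,4) uc, folded I1_def] and j2 = jordan[OF d'(1-3) dc, folded I2_def]
  have compR: "compact R" unfolding R_def
    by (rule compact_continuous_image[OF continuous_on_subset[OF cont]]) (use t1 t2 t01 in auto)
  have "open (ball x r - R)" using compR by (intro open_Diff compact_imp_closed) auto
  moreover have "x \<in> ball x r - R" using xR r by auto
  ultimately obtain \<delta> where \<delta>: "\<delta> > 0" "ball x \<delta> \<subseteq> ball x r - R" by (meson open_contains_ball)
  define W where "W = ball x \<delta>"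
  define S where "S = K \<union> R \<union> sphere x r"
  define T where "T = path_image c \<union> sphere x r"
  have "path_image c \<inter> K = {}" using ccball r(2) by blast
  hence ST: "S \<inter> T = sphere x r" unfolding S_def T_def using Rc csph r(2) by blast
  have comS: "compact S" unfolding S_def using K compR by (intro compact_Un) auto
  have cloT: "closed T" unfolding T_def using c(1) by (intro closed_Un) (auto simp: closed_arc_image)
  have WS: "W \<subseteq> - S"
    unfolding W_def S_def using \<delta>(2) r(2) by (auto simp: subset_iff)
  have same: "connected_component (- (K \<union> path_image \<alpha>)) y z"
    if I: "connected I" "I \<subseteq> ball x r" "I \<inter> path_image c = {}" and yz: "y \<in> W \<inter> I" "z \<in> W \<inter> I" for I y z
  proof -
    have "connected_component (- S) y z"
      using WS yz unfolding connected_component_def W_def by (metis IntD1 connected_ball)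
    moreover have "I \<subseteq> - T" using I unfolding T_def by auto
    hence "connected_component (- T) y z"
      using I(1) yz unfolding connected_component_def by (metis IntD2)
    moreover have "connected (S \<inter> T)" unfolding ST by (rule connected_sphere) simp
    ultimately have "connected_component (- (S \<union> T)) y z"
      using Janiszewski[OF comS cloT] by blast
    thus ?thesis by (rule connected_component_of_subset) (auto simp: S_def T_def imUn)
  qed
  have cl: "W \<inter> path_image \<alpha> \<subseteq> closure (W \<inter> I)" if "path_image c \<subseteq> frontier I" for I
  proof -
    have "W \<inter> path_image \<alpha> \<subseteq> W \<inter> closure I"
      using that WS unfolding imUn S_def frontier_def by blast
    also have "\<dots> \<subseteq> closure (W \<inter> I)" unfolding W_def by (intro open_Int_closure_subset) auto
    finally show ?thesis .
  qed
  show thesis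
  proof (rule that[of W "W \<inter> I1" "W \<inter> I2"])
    show "open W" "connected W" "x \<in> W" unfolding W_def using \<delta> by auto
    show "W \<inter> K = {}" using WS unfolding S_def by auto
    have "W \<subseteq> ball x r" unfolding W_def using \<delta> by auto
    thus "W - path_image \<alpha> \<subseteq> W \<inter> I1 \<union> W \<inter> I2" using I12 imUn by blast
    show "connected_component (- (K \<union> path_image \<alpha>)) y z" if "y \<in> W \<inter> I1" "z \<in> W \<inter> I1" for y z
      using same[OF j1(1) _ j1(3) that] I12 by blast
    show "connected_component (- (K \<union> path_image \<alpha>)) y z" if "y \<in> W \<inter> I2" "z \<in> W \<inter> I2" for y z
      using same[OF j2(1) _ j2(3) that] I12 by blast
    show "W \<inter> path_image \<alpha> \<subseteq> closure (W \<inter> I1)" by (rule cl[OF j1(2)])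
    show "W \<inter> path_image \<alpha> \<subseteq> closure (W \<inter> I2)" by (rule cl[OF j2(2)])
  qed
qed

text \<open>A larger connected set would meet the frontier of \<open>f\<close>, which lies in
  \<open>X\<close>. In this way a face of a drawing is recognized as a face of any smaller drawing
  that contains its frontier.\<close>

lemma component_of_frontier_subset:
  assumes "connected f" "f \<noteq> {}" "f \<inter> X = {}" "frontier f \<subseteq> X"
  shows "f \<in> components (- X)"
  unfolding in_components_maximal
proof (intro conjI allI impI)
  fix D assume D: "D \<noteq> {} \<and> f \<subseteq> D \<and> D \<subseteq> - X \<and> connected D"
  show "D = f"
  proof (rule ccontr)
    assume "D \<noteq> f"
    hence "D \<inter> f \<noteq> {}" "D - f \<noteq> {}" using D assms by auto
    hence "D \<inter> frontier f \<noteq> {}" using connected_Int_frontier D by blast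
    thus False using D assms by auto
  qed
qed (use assms in auto)

lemma component_meets_unique:
  assumes "f \<in> components S" "g \<in> components S" "y \<in> f" "z \<in> g" "connected_component S y z"
  shows "f = g"
  using assms by (metis components_iff connected_component_eq mem_Collect_eq)

lemma component_superset:
  assumes "f \<in> components S" "y \<in> f" "\<And>z. z \<in> P \<Longrightarrow> connected_component S y z"
  shows "P \<subseteq> f"
  using assms by (metis components_iff connected_component_eq mem_Collect_eq subsetI)

text \<open>A component with \<open>x\<close> in its closure meets the neighbourhood
  \<open>W\<close>, hence one of the two sides \<open>P\<close> and \<open>Q\<close>, and each side
  meets at most one component.\<close>

lemma components_near_arc_point:
  fixes \<alpha> :: "real \<Rightarrow> complex"
  assumes "arc \<alpha>" "compact K"
    and "x \<in> open_arc \<alpha>"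
    and "open_arc \<alpha> \<inter> K = {}"
  defines "F \<equiv> {f \<in> components (- (K \<union> path_image \<alpha>)). x \<in> closure f}"
  shows "finite F \<and> card F \<le> 2"
proof -
  obtain W P Q where W: "open W" "connected W" "x \<in> W" "W \<inter> K = {}" "W - path_image \<alpha> \<subseteq> P \<union> Q"
    "\<And>y z. y \<in> P \<Longrightarrow> z \<in> P \<Longrightarrow> connected_component (- (K \<union> path_image \<alpha>)) y z"
    "\<And>y z. y \<in> Q \<Longrightarrow> z \<in> Q \<Longrightarrow> connected_component (- (K \<union> path_image \<alpha>)) y z"
    using arc_sides[OF assms(1-4)] by metis
  define FP where "FP = {f \<in> components (- (K \<union> path_image \<alpha>)). f \<inter> P \<noteq> {}}"
  define FQ where "FQ = {f \<in> components (- (K \<union> path_image \<alpha>)). f \<inter> Q \<noteq> {}}"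
  have P1: "f = g" if "f \<in> FP" "g \<in> FP" for f g
    using that W(6) component_meets_unique unfolding FP_def by blast
  have Q1: "f = g" if "f \<in> FQ" "g \<in> FQ" for f g
    using that W(7) component_meets_unique unfolding FQ_def by blast
  have one: "finite A \<and> card A \<le> 1" if "\<And>f g. f \<in> A \<Longrightarrow> g \<in> A \<Longrightarrow> f = g" for A :: "complex set set"
  proof (cases "A = {}")
    case False
    then obtain f where "f \<in> A" by blast
    hence "A = {f}" using that by blast
    thus ?thesis by simp
  qed simp
  have sub: "F \<subseteq> FP \<union> FQ"
  proof
    fix f assume f: "f \<in> F"
    hence "W \<inter> f \<noteq> {}" using W(1,3) unfolding F_def
      by (metis (mono_tags, lifting) IntI empty_iff mem_Collect_eq open_Int_closure_eq_empty)
    moreover have "f \<inter> path_image \<alpha> = {}" using f in_components_subset unfolding F_def by blast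
    ultimately show "f \<in> FP \<union> FQ" using f W(5) unfolding F_def FP_def FQ_def by blast
  qed
  have oneP: "finite FP \<and> card FP \<le> 1" by (rule one) (rule P1)
  have oneQ: "finite FQ \<and> card FQ \<le> 1" by (rule one) (rule Q1)
  have fin: "finite (FP \<union> FQ)" using oneP oneQ by blast
  have "card (FP \<union> FQ) \<le> 2" using card_Un_le[of FP FQ] oneP oneQ by linarith
  thus ?thesis using sub fin by (meson card_mono finite_subset order_trans)
qed

text \<open>The points of the open arc in \<open>closure f\<close> form a relatively closed set. It
  is also relatively open, since near such a point \<open>f\<close> contains a whole side, whose
  closure contains the nearby arc. The open arc is connected.\<close>

lemma arc_in_closure_of_component:
  fixes \<alpha> :: "real \<Rightarrow> complex"
  assumes arc: "arc \<alpha>" and K: "compact K"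
    and x: "x \<in> open_arc \<alpha>"
    and disj: "open_arc \<alpha> \<inter> K = {}"
    and f: "f \<in> components (- (K \<union> path_image \<alpha>))" and xf: "x \<in> closure f"
  shows "open_arc \<alpha> \<subseteq> closure f"
proof -
  define A where "A = open_arc \<alpha>"
  have con: "connected A" unfolding A_def
    by (rule connected_simple_path_endless[OF arc_imp_simple_path[OF arc]])
  have "\<exists>W. open W \<and> y \<in> W \<and> W \<inter> A \<subseteq> closure f" if y: "y \<in> A \<inter> closure f" for y
  proof -
    obtain W P Q where W: "open W" "connected W" "y \<in> W" "W \<inter> K = {}" "W - path_image \<alpha> \<subseteq> P \<union> Q"
      "\<And>y z. y \<in> P \<Longrightarrow> z \<in> P \<Longrightarrow> connected_component (- (K \<union> path_image \<alpha>)) y z"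
      "\<And>y z. y \<in> Q \<Longrightarrow> z \<in> Q \<Longrightarrow> connected_component (- (K \<union> path_image \<alpha>)) y z"
      "W \<inter> path_image \<alpha> \<subseteq> closure P" "W \<inter> path_image \<alpha> \<subseteq> closure Q"
      using arc_sides[OF arc K _ disj, of y] y unfolding A_def by (metis IntD1)
    have "W \<inter> f \<noteq> {}" using W(1,3) y by (metis IntD2 IntI empty_iff open_Int_closure_eq_empty)
    moreover have "f \<inter> path_image \<alpha> = {}" using f in_components_subset by blast
    ultimately obtain q where q: "q \<in> f" "q \<in> P \<or> q \<in> Q" using W(5) by blast
    hence "P \<subseteq> f \<or> Q \<subseteq> f" using component_superset[OF f q(1)] W(6,7) by blast
    hence "W \<inter> path_image \<alpha> \<subseteq> closure f" using W(8,9) closure_mono by blast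
    thus ?thesis using W unfolding A_def by blast
  qed
  then obtain U where U: "\<And>y. y \<in> A \<inter> closure f \<Longrightarrow> open (U y) \<and> y \<in> U y \<and> U y \<inter> A \<subseteq> closure f"
    by metis
  have "A \<inter> closure f = A \<inter> (\<Union>y\<in>A \<inter> closure f. U y)" using U by blast
  hence "openin (top_of_set A) (A \<inter> closure f)"
    using U by (metis openin_open_Int open_UN)
  moreover have "closedin (top_of_set A) (A \<inter> closure f)" by (simp add: closedin_closed_Int)
  ultimately have "A \<inter> closure f = {} \<or> A \<inter> closure f = A"
    using con unfolding connected_clopen by blast
  moreover have "x \<in> A \<inter> closure f" using x xf unfolding A_def by simp
  ultimately show ?thesis unfolding A_def by blast
qed

text \<open>At most two new components have a chosen point \<open>x\<close> of the arc in their
  closure. The closure of any other misses the whole open arc, so that component was one before, and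
  it differs from the old component that contained \<open>x\<close>.\<close>

lemma components_add_arc_le:
  fixes \<alpha> :: "real \<Rightarrow> complex"
  assumes arc: "arc \<alpha>" and K: "compact K" and ends: "{pathstart \<alpha>, pathfinish \<alpha>} \<subseteq> K"
    and disj: "open_arc \<alpha> \<inter> K = {}"
    and fin: "finite (components (- K))"
  shows "finite (components (- (K \<union> path_image \<alpha>))) \<and>
    card (components (- (K \<union> path_image \<alpha>))) \<le> card (components (- K)) + 1"
proof -
  have "open_arc \<alpha> \<noteq> {}"
    using nonempty_simple_path_endless arc arc_imp_simple_path by blast
  then obtain x where x: "x \<in> open_arc \<alpha>" by blast
  define F where "F = {f \<in> components (- (K \<union> path_image \<alpha>)). x \<in> closure f}"
  have F: "finite F" "card F \<le> 2"
    using components_near_arc_point[OF arc K x disj] unfolding F_def by auto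
  define g where "g = connected_component_set (- K) x"
  have xK: "x \<in> - K" using x disj by blast
  have g: "g \<in> components (- K)" "x \<in> g" unfolding g_def using xK by (auto simp: componentsI)
  have "components (- (K \<union> path_image \<alpha>)) \<subseteq> F \<union> (components (- K) - {g})"
  proof
    fix f assume f: "f \<in> components (- (K \<union> path_image \<alpha>))"
    show "f \<in> F \<union> (components (- K) - {g})"
    proof (cases "x \<in> closure f")
      case True thus ?thesis using f unfolding F_def by blast
    next
      case False
      have no: "open_arc \<alpha> \<inter> closure f = {}"
      proof (rule ccontr)
        assume "\<not> ?thesis"
        then obtain y where y: "y \<in> open_arc \<alpha>" "y \<in> closure f" by blast
        from arc_in_closure_of_component[OF arc K y(1) disj f y(2)] x False show False by blast
      qed
      have "closed (K \<union> path_image \<alpha>)" using K arc by (simp add: closed_Un compact_imp_closed closed_arc_image)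
      hence "frontier f \<subseteq> K \<union> path_image \<alpha>" using f frontier_of_components_closed_complement by blast
      moreover have "frontier f \<subseteq> closure f" by (simp add: frontier_def)
      ultimately have fr: "frontier f \<subseteq> K" using no ends by blast
      have f': "connected f" "f \<noteq> {}" "f \<inter> (K \<union> path_image \<alpha>) = {}"
        using f in_components_connected in_components_nonempty in_components_subset by blast+
      hence "f \<in> components (- K)" using component_of_frontier_subset fr by blast
      moreover have "f \<noteq> g" using f' g x by blast
      ultimately show ?thesis by blast
    qed
  qed
  moreover have "finite (F \<union> (components (- K) - {g}))" using F fin by blast
  moreover have "card (F \<union> (components (- K) - {g})) \<le> card (components (- K)) + 1"
  proof -
    have "card (components (- K) - {g}) = card (components (- K)) - 1" using g fin by simp
    moreover have "card (components (- K)) > 0" using g fin by (metis card_gt_0_iff empty_iff)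
    ultimately show ?thesis using card_Un_le[of F "components (- K) - {g}"] F by linarith
  qed
  ultimately show ?thesis by (meson card_mono finite_subset order_trans)
qed

text \<open>Sending each new component to the old one that contains it is surjective but not
  injective: the components next to \<open>x\<close> inside and outside the Jordan curve
  \<open>c\<close> differ, and they merge when the open arc is erased.\<close>

lemma components_add_arc_ge:
  fixes \<alpha> :: "real \<Rightarrow> complex"
  assumes arc: "arc \<alpha>" and K: "compact K"
    and disj: "open_arc \<alpha> \<inter> K = {}"
    and c: "simple_path c" "pathfinish c = pathstart c"
    and sub: "path_image \<alpha> \<subseteq> path_image c" "path_image c \<subseteq> K \<union> path_image \<alpha>"
    and fin: "finite (components (- (K \<union> path_image \<alpha>)))"
  shows "card (components (- K)) + 1 \<le> card (components (- (K \<union> path_image \<alpha>)))"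
proof -
  define X where "X = K \<union> path_image \<alpha>"
  define J where "J = path_image c"
  have "open_arc \<alpha> \<noteq> {}"
    using nonempty_simple_path_endless arc arc_imp_simple_path by blast
  then obtain x where x: "x \<in> open_arc \<alpha>" by blast
  have jo: "open (inside J)" "open (outside J)" "inside J \<inter> outside J = {}" "inside J \<union> outside J = - J"
    "frontier (inside J) = J" "frontier (outside J) = J"
    using Jordan_inside_outside[OF c] unfolding J_def by auto
  define \<pi> where "\<pi> f = connected_component_set (- K) (SOME y. y \<in> f)" for f
  have pi: "\<pi> f = connected_component_set (- K) y" if f: "f \<in> components (- X)" and y: "y \<in> f" for f y
  proof -
    have "(SOME y. y \<in> f) \<in> f" using y by (rule someI)
    moreover have "f \<subseteq> - K" "connected f"
      using f in_components_subset in_components_connected unfolding X_def by blast+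
    ultimately have "connected_component (- K) (SOME y. y \<in> f) y"
      using y unfolding connected_component_def by blast
    thus ?thesis unfolding \<pi>_def by (rule connected_component_eq[symmetric, OF CollectI, simplified])
  qed
  have cc: "connected_component_set (- X) y \<in> components (- X)" "y \<in> connected_component_set (- X) y"
    if "y \<notin> X" for y using that by (auto simp: componentsI)
  have "components (- K) \<subseteq> \<pi> ` components (- X)"
  proof
    fix g assume g: "g \<in> components (- K)"
    have "open g" using g K by (meson compact_imp_closed open_Compl open_components)
    have "g \<noteq> {}" using g in_components_nonempty by blast
    \<comment> \<open>The map reaches \<open>g\<close> only if \<open>g\<close> has a point off the
      arc. It has one, because an open set that meets a Jordan curve also meets its inside.\<close>
    have "\<not> g \<subseteq> path_image \<alpha>"
    proof
      assume "g \<subseteq> path_image \<alpha>"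
      hence gJ: "g \<subseteq> J" using sub unfolding J_def by blast
      hence "g \<inter> closure (inside J) \<noteq> {}" using \<open>g \<noteq> {}\<close> jo(5) unfolding frontier_def by blast
      hence "g \<inter> inside J \<noteq> {}" using \<open>open g\<close> open_Int_closure_eq_empty by blast
      thus False using gJ jo(4) by blast
    qed
    then obtain y where y: "y \<in> g" "y \<notin> path_image \<alpha>" by blast
    have "y \<notin> X" using y g in_components_subset unfolding X_def by blast
    moreover have "connected_component_set (- K) y = g" using g y
      by (metis components_iff connected_component_eq)
    ultimately show "g \<in> \<pi> ` components (- X)" using pi cc by (metis image_eqI)
  qed
  moreover have "\<not> inj_on \<pi> (components (- X))"
  proof -
    have "x \<in> - K" "open (- K)" using x disj K by (auto simp: compact_imp_closed open_Compl)
    then obtain e where e: "e > 0" "ball x e \<subseteq> - K" by (meson open_contains_ball)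
    have xJ: "x \<in> J" using x sub unfolding J_def by blast
    have "x \<in> closure (inside J)" "x \<in> closure (outside J)" using xJ jo unfolding frontier_def by blast+
    hence "ball x e \<inter> inside J \<noteq> {}" "ball x e \<inter> outside J \<noteq> {}"
      using e open_ball by (metis IntI centre_in_ball empty_iff open_Int_closure_eq_empty)+
    then obtain y z where yz: "y \<in> ball x e" "y \<in> inside J" "z \<in> ball x e" "z \<in> outside J" by blast
    have nX: "y \<notin> X" "z \<notin> X"
      using yz e(2) jo(4) sub unfolding X_def J_def by blast+
    define fy where "fy = connected_component_set (- X) y"
    define fz where "fz = connected_component_set (- X) z"
    have f: "fy \<in> components (- X)" "y \<in> fy" "fz \<in> components (- X)" "z \<in> fz"
      using cc nX unfolding fy_def fz_def by auto
    have "fy \<noteq> fz"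
    proof
      assume "fy = fz"
      hence "inside J \<inter> fy \<noteq> {}" "outside J \<inter> fy \<noteq> {}" using f yz by auto
      moreover have "connected fy" using f in_components_connected by blast
      moreover have "fy \<subseteq> - X" using f in_components_subset by blast
      hence "fy \<subseteq> inside J \<union> outside J" using jo(4) sub unfolding X_def J_def by blast
      ultimately show False using jo(1-3) connectedD[of fy "inside J" "outside J"] by blast
    qed
    moreover have "connected_component (- K) y z"
      using e yz unfolding connected_component_def by (metis connected_ball)
    hence "connected_component_set (- K) z = connected_component_set (- K) y"
      by (intro connected_component_eq) simp
    hence "\<pi> fy = \<pi> fz" using pi[OF f(1,2)] pi[OF f(3,4)] by simp
    ultimately show ?thesis using f unfolding inj_on_def by blast
  qed
  hence "card (\<pi> ` components (- X)) < card (components (- X))"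
    using fin card_image_le[of "components (- X)" \<pi>] eq_card_imp_inj_on[of "components (- X)" \<pi>]
    unfolding X_def by linarith
  ultimately show ?thesis
    using fin card_mono[of "\<pi> ` components (- X)" "components (- K)"] unfolding X_def by simp
qed

section \<open>Faces of a plane graph\<close>

context plane_graph
begin

definition edge_image :: "'a set set \<Rightarrow> complex set" where
  "edge_image F = (\<Union>e\<in>F. path_image (\<gamma> e))"

text \<open>All of \<open>V\<close> is included whatever \<open>F\<close> is, so adding an edge adds
  an open arc whose ends are already present.\<close>

definition drawing :: "'a set set \<Rightarrow> complex set" where
  "drawing F = pos ` V \<union> edge_image F"

definition faces :: "'a set set \<Rightarrow> complex set set" where
  "faces F = components (- drawing F)"

text \<open>A marker for the edge: the closure of a face contains all or nothing of an open edge, so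
  one point tests incidence.\<close>

definition mid :: "'a set \<Rightarrow> complex" where
  "mid e = \<gamma> e (1 / 2)"

lemma edge_set_E: "edge_set E"
proof -
  have "E \<subseteq> Pow V" using edge_subset by blast
  hence "finite E" using finite_verts finite_subset finite_Pow_iff by metis
  thus ?thesis unfolding edge_set_def using edge_card by blast
qed

lemma finite_edges: "F \<subseteq> E \<Longrightarrow> finite F"
  using edge_set_E edge_set_subset unfolding edge_set_def by blast

lemma closed_edge: "e \<in> E \<Longrightarrow> compact (path_image (\<gamma> e))"
  using edge_arc by (simp add: compact_arc_image)

lemma compact_edge_image: "F \<subseteq> E \<Longrightarrow> compact (edge_image F)"
  unfolding edge_image_def using finite_edges closed_edge by (intro compact_UN) auto

lemma compact_drawing: "F \<subseteq> E \<Longrightarrow> compact (drawing F)"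
  unfolding drawing_def using compact_edge_image finite_verts by (simp add: compact_Un finite_imp_compact)

lemma drawing_insert: "drawing (insert e F) = drawing F \<union> path_image (\<gamma> e)"
  unfolding drawing_def edge_image_def by auto

lemma interior_disjoint_drawing:
  assumes "e \<in> E" "F \<subseteq> E" "e \<notin> F"
  shows "open_arc (\<gamma> e) \<inter> drawing F = {}"
proof -
  have "(path_image (\<gamma> e) - pos ` e) \<inter> path_image (\<gamma> f) = {}" if "f \<in> F" for f
    using interior_edge[of e f] assms that by blast
  thus ?thesis
    using interior_vertex[OF assms(1)] unfolding edge_ends[OF assms(1)] drawing_def edge_image_def by blast
qed

lemma ends_in_drawing:
  assumes "e \<in> E" shows "{pathstart (\<gamma> e), pathfinish (\<gamma> e)} \<subseteq> drawing F"
  using edge_subset[OF assms] unfolding edge_ends[OF assms] drawing_def by blast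

lemma vertex_on_edge:
  assumes "e \<in> E" "v \<in> V" "pos v \<in> path_image (\<gamma> e)" shows "v \<in> e"
proof -
  have "pos v \<in> pos ` e" using interior_vertex[OF assms(1)] assms by blast
  then obtain u where "u \<in> e" "pos v = pos u" by blast
  thus ?thesis using inj_pos edge_subset[OF assms(1)] assms(2) by (metis inj_onD subsetD)
qed

lemma end_on_edge:
  assumes "e \<in> E" "v \<in> e" shows "pos v \<in> path_image (\<gamma> e)"
proof -
  have "pos v \<in> {pathstart (\<gamma> e), pathfinish (\<gamma> e)}" unfolding edge_ends[OF assms(1)] using assms(2) by blast
  thus ?thesis using pathstart_in_path_image[of "\<gamma> e"] pathfinish_in_path_image[of "\<gamma> e"] by auto
qed

lemma edge_Int_edge:
  assumes "e \<in> E" "f \<in> E" "e \<noteq> f"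
  shows "path_image (\<gamma> e) \<inter> path_image (\<gamma> f) \<subseteq> pos ` (e \<inter> f)"
proof
  fix z assume z: "z \<in> path_image (\<gamma> e) \<inter> path_image (\<gamma> f)"
  have "z \<in> pos ` e" using interior_edge[OF assms] z by blast
  then obtain v where v: "v \<in> e" "z = pos v" by blast
  have "v \<in> f" using vertex_on_edge[OF assms(2)] edge_subset[OF assms(1)] v z by blast
  thus "z \<in> pos ` (e \<inter> f)" using v by blast
qed

lemma mid_interior:
  assumes "e \<in> E"
  shows "mid e \<in> open_arc (\<gamma> e)"
proof -
  have "inj_on (\<gamma> e) {0..1}" using edge_arc[OF assms] unfolding arc_def by blast
  hence "\<gamma> e (1/2) \<noteq> \<gamma> e 0" "\<gamma> e (1/2) \<noteq> \<gamma> e 1"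
    using inj_onD[of "\<gamma> e" "{0..1}" "1/2" 0] inj_onD[of "\<gamma> e" "{0..1}" "1/2" 1] by auto
  thus ?thesis unfolding mid_def pathstart_def pathfinish_def path_image_def by auto
qed

lemma mid_in_drawing_iff:
  assumes "e \<in> E" "F \<subseteq> E" shows "mid e \<in> drawing F \<longleftrightarrow> e \<in> F"
proof
  show "mid e \<in> drawing F \<Longrightarrow> e \<in> F"
    using interior_disjoint_drawing[OF assms] mid_interior[OF assms(1)] by blast
  show "e \<in> F \<Longrightarrow> mid e \<in> drawing F"
    using mid_interior[OF assms(1)] unfolding drawing_def edge_image_def by blast
qed

lemma mid_in_edge_image_iff:
  assumes "e \<in> E" "F \<subseteq> E" shows "mid e \<in> edge_image F \<longleftrightarrow> e \<in> F"
  using mid_in_drawing_iff[OF assms] mid_interior[OF assms(1)] unfolding drawing_def edge_image_def by blast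

section \<open>Cycles as Jordan curves, forests and Euler's inequality\<close>

lemma oriented_arc:
  assumes "{u, w} \<in> E"
  obtains g where "arc g" "pathstart g = pos u" "pathfinish g = pos w" "path_image g = path_image (\<gamma> {u, w})"
proof -
  have "{pathstart (\<gamma> {u, w}), pathfinish (\<gamma> {u, w})} = {pos u, pos w}"
    using edge_ends[OF assms] by simp
  then consider "pathstart (\<gamma> {u, w}) = pos u" "pathfinish (\<gamma> {u, w}) = pos w"
    | "pathstart (\<gamma> {u, w}) = pos w" "pathfinish (\<gamma> {u, w}) = pos u"
    by (auto simp: doubleton_eq_iff)
  thus thesis
  proof cases
    case 1 thus thesis using that[of "\<gamma> {u, w}"] edge_arc[OF assms] by simp
  next
    case 2 thus thesis using that[of "reversepath (\<gamma> {u, w})"] edge_arc[OF assms]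
      by (simp add: arc_reversepath)
  qed
qed

text \<open>Edges are appended one at a time. As \<open>k < length c\<close> leaves out the closing
  edge, each new edge meets the arc built so far only in their common vertex.\<close>

lemma cycle_initial_arc:
  assumes c: "is_cycle E c" and k: "1 \<le> k" "k < length c"
  shows "\<exists>g. arc g \<and> pathstart g = pos (c ! 0) \<and> pathfinish g = pos (c ! k) \<and>
    path_image g = edge_image (cyc_edge c ` {..<k})"
  using k
proof (induction k rule: dec_induct)
  case base
  have "cyc_edge c 0 = {c ! 0, c ! 1}" using base unfolding cyc_edge_def by simp
  moreover have "cyc_edge c 0 \<in> E" using c base unfolding is_cycle_iff cycle_edges_def
    by (meson image_subset_iff lessThan_iff less_trans less_one)
  ultimately show ?case using oriented_arc[of "c ! 0" "c ! 1"] unfolding edge_image_def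
    by (metis (no_types, lifting) SUP_insert UN_empty Un_empty_right image_empty image_insert lessThan_0 lessThan_Suc One_nat_def)
next
  case (step k)
  have dc: "distinct c" "cycle_edges c \<subseteq> E" using c unfolding is_cycle_iff by auto
  obtain g where g: "arc g" "pathstart g = pos (c ! 0)" "pathfinish g = pos (c ! k)"
    "path_image g = edge_image (cyc_edge c ` {..<k})" using step by auto
  have ek: "cyc_edge c k = {c ! k, c ! Suc k}" using step unfolding cyc_edge_def by simp
  have inE: "cyc_edge c i \<in> E" if "i \<le> k" for i
    using dc(2) that step unfolding cycle_edges_def by auto
  obtain g' where g': "arc g'" "pathstart g' = pos (c ! k)" "pathfinish g' = pos (c ! Suc k)"
    "path_image g' = path_image (\<gamma> (cyc_edge c k))"
    using oriented_arc[of "c ! k" "c ! Suc k"] inE[of k] unfolding ek by blast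
  have "path_image g \<inter> path_image g' \<subseteq> {pos (c ! k)}"
  proof
    fix z assume "z \<in> path_image g \<inter> path_image g'"
    then obtain i where i: "i < k" "z \<in> path_image (\<gamma> (cyc_edge c i)) \<inter> path_image (\<gamma> (cyc_edge c k))"
      unfolding g(4) g'(4) edge_image_def by blast
    have "cyc_edge c i = {c ! i, c ! Suc i}" using i step unfolding cyc_edge_def by simp
    hence int: "cyc_edge c i \<inter> cyc_edge c k \<subseteq> {c ! k}"
      using i step dc(1) unfolding ek by (auto simp: nth_eq_iff_index_eq)
    have "c ! Suc k \<notin> cyc_edge c i"
      using \<open>cyc_edge c i = {c ! i, c ! Suc i}\<close> i step dc(1) by (auto simp: nth_eq_iff_index_eq)
    hence ne: "cyc_edge c i \<noteq> cyc_edge c k" unfolding ek by blast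
    show "z \<in> {pos (c ! k)}"
      using edge_Int_edge[OF inE[OF less_imp_le[OF i(1)]] inE[OF order_refl] ne] i(2) int by blast
  qed
  hence "arc (g +++ g')" using g g' by (intro arc_join) auto
  moreover have "path_image (g +++ g') = edge_image (cyc_edge c ` {..<Suc k})"
    using g g' by (simp add: path_image_join edge_image_def lessThan_Suc Un_commute)
  ultimately show ?case using g g' by (intro exI[of _ "g +++ g'"]) simp
qed

lemma cycle_loop:
  assumes c: "is_cycle E c"
  obtains g where "simple_path g" "pathfinish g = pathstart g" "path_image g = edge_image (cycle_edges c)"
proof -
  have dc: "distinct c" "length c \<ge> 3" "cycle_edges c \<subseteq> E" using c unfolding is_cycle_iff by auto
  define n where "n = length c - 1"
  have n: "1 \<le> n" "n < length c" "Suc n = length c" using dc(2) unfolding n_def by auto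
  obtain g where g: "arc g" "pathstart g = pos (c ! 0)" "pathfinish g = pos (c ! n)"
    "path_image g = edge_image (cyc_edge c ` {..<n})" using cycle_initial_arc[OF c n(1,2)] by blast
  have en: "cyc_edge c n = {c ! n, c ! 0}" using n unfolding cyc_edge_def by simp
  have inE: "cyc_edge c i \<in> E" if "i \<le> n" for i
    using dc(3) that n unfolding cycle_edges_def by auto
  obtain g' where g': "arc g'" "pathstart g' = pos (c ! n)" "pathfinish g' = pos (c ! 0)"
    "path_image g' = path_image (\<gamma> (cyc_edge c n))"
    using oriented_arc[of "c ! n" "c ! 0"] inE[of n] unfolding en by blast
  have "path_image g \<inter> path_image g' \<subseteq> {pos (c ! 0), pos (c ! n)}"
  proof
    fix z assume "z \<in> path_image g \<inter> path_image g'"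
    then obtain i where i: "i < n" "z \<in> path_image (\<gamma> (cyc_edge c i)) \<inter> path_image (\<gamma> (cyc_edge c n))"
      unfolding g(4) g'(4) edge_image_def by blast
    have ne: "cyc_edge c i \<noteq> cyc_edge c n"
      using inj_onD[OF inj_on_cyc_edge[OF dc(1,2)], of i n] i(1) n by auto
    show "z \<in> {pos (c ! 0), pos (c ! n)}"
      using edge_Int_edge[OF inE[OF less_imp_le[OF i(1)]] inE[OF order_refl] ne] i(2) unfolding en by blast
  qed
  hence "simple_path (g +++ g')" using g g' by (intro simple_path_join_loop) auto
  moreover have "cycle_edges c = insert (cyc_edge c n) (cyc_edge c ` {..<n})"
    unfolding cycle_edges_def n(3)[symmetric] lessThan_Suc image_insert ..
  hence "path_image (g +++ g') = edge_image (cycle_edges c)"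
    using g g' by (simp add: path_image_join edge_image_def Un_commute)
  moreover have "pathfinish (g +++ g') = pathstart (g +++ g')" using g g' by simp
  ultimately show thesis using that by blast
qed

text \<open>A leaf edge meets the rest of the forest in at most one point, so by Janiszewski's
  theorem adding it does not separate the plane.\<close>

lemma connected_forest_complement:
  assumes "F \<subseteq> E" "\<nexists>c. is_cycle F c"
  shows "connected (- edge_image F)"
  using assms
proof (induction "card F" arbitrary: F)
  case 0
  hence "F = {}" using finite_edges by (metis card_0_eq)
  thus ?case unfolding edge_image_def by (simp add: connected_UNIV)
next
  case (Suc n)
  have es: "edge_set F" using edge_set_subset[OF edge_set_E Suc.prems(1)] .
  have "F \<noteq> {}" using Suc(2) by auto
  then obtain v e where ve: "e \<in> F" "v \<in> e" "\<And>f. f \<in> F \<Longrightarrow> v \<in> f \<Longrightarrow> f = e"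
    using exists_leaf[OF es] Suc.prems(2) by metis
  have eE: "e \<in> E" using ve Suc.prems by blast
  obtain w where w: "e = {v, w}" "w \<noteq> v" using obtain_edge edge_card[OF eE] ve(2) by metis
  have sub: "F - {e} \<subseteq> E" using Suc.prems by blast
  have n: "n = card (F - {e})" using Suc(2) finite_edges[OF Suc.prems(1)] ve(1) by simp
  have con: "connected (- edge_image (F - {e}))"
    using Suc(1)[OF n sub] Suc.prems(2) is_cycle_mono[of "F - {e}" _ F] by blast
  have "path_image (\<gamma> e) \<inter> edge_image (F - {e}) \<subseteq> {pos w}"
  proof
    fix z assume "z \<in> path_image (\<gamma> e) \<inter> edge_image (F - {e})"
    then obtain f where f: "f \<in> F" "f \<noteq> e" "z \<in> path_image (\<gamma> e) \<inter> path_image (\<gamma> f)"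
      unfolding edge_image_def by blast
    have "e \<inter> f \<subseteq> {w}" using ve(3) f w by blast
    moreover have "f \<in> E" using f Suc.prems(1) by blast
    ultimately show "z \<in> {pos w}" using edge_Int_edge[OF eE, of f] f by blast
  qed
  hence "path_image (\<gamma> e) \<inter> edge_image (F - {e}) = {} \<or> path_image (\<gamma> e) \<inter> edge_image (F - {e}) = {pos w}"
    by blast
  hence "connected (path_image (\<gamma> e) \<inter> edge_image (F - {e}))" by (metis connected_empty connected_sing)
  moreover have "connected (- path_image (\<gamma> e))" using connected_arc_complement[OF edge_arc[OF eE]] by simp
  moreover have "closed (edge_image (F - {e}))" using compact_edge_image[OF sub] compact_imp_closed by blast
  ultimately have "connected (- (path_image (\<gamma> e) \<union> edge_image (F - {e})))"
    using Janiszewski_connected[OF closed_edge[OF eE]] con by blast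
  moreover have "path_image (\<gamma> e) \<union> edge_image (F - {e}) = edge_image F"
    using ve(1) unfolding edge_image_def by blast
  ultimately show ?case by simp
qed

text \<open>Besides the edges, only finitely many points are removed, and these cannot disconnect an
  open connected subset of the plane.\<close>

lemma card_faces_forest:
  assumes "F \<subseteq> E" "\<nexists>c. is_cycle F c"
  shows "finite (faces F) \<and> card (faces F) = 1"
proof -
  have "open (- edge_image F)" using compact_edge_image[OF assms(1)] by (simp add: compact_imp_closed open_Compl)
  hence "connected (- edge_image F - pos ` V)"
    using connected_forest_complement[OF assms] finite_verts by (intro connected_open_delete_finite) auto
  moreover have "- edge_image F - pos ` V = - drawing F" unfolding drawing_def by blast
  moreover have "- drawing F \<noteq> {}"
    using compact_drawing[OF assms(1)] compact_imp_bounded not_bounded_UNIV by (metis Compl_empty_eq double_complement)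
  ultimately have "faces F = {- drawing F}" unfolding faces_def by (metis components_eq_sing_iff)
  thus ?thesis by simp
qed

lemma faces_add_edge_le:
  assumes "e \<in> E" "F \<subseteq> E" "e \<notin> F" "finite (faces F)"
  shows "finite (faces (insert e F)) \<and> card (faces (insert e F)) \<le> card (faces F) + 1"
  using components_add_arc_le[OF edge_arc compact_drawing ends_in_drawing interior_disjoint_drawing] assms
  unfolding faces_def drawing_insert by blast

lemma faces_add_edges_le:
  assumes "F \<subseteq> E" "A \<subseteq> E" "A \<inter> F = {}" "finite (faces F)"
  shows "finite (faces (F \<union> A)) \<and> card (faces (F \<union> A)) \<le> card (faces F) + card A"
proof -
  have "finite A" using finite_edges assms(2) .
  thus ?thesis using assms(2,3)
  proof (induction A)
    case empty
    thus ?case using assms(4) by simp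
  next
    case (insert e A)
    hence IH: "finite (faces (F \<union> A))" "card (faces (F \<union> A)) \<le> card (faces F) + card A" by auto
    have "finite (faces (insert e (F \<union> A))) \<and> card (faces (insert e (F \<union> A))) \<le> card (faces (F \<union> A)) + 1"
      using insert assms(1) by (intro faces_add_edge_le IH(1)) auto
    thus ?case using IH(2) insert by simp
  qed
qed

lemma finite_faces:
  assumes "F \<subseteq> E" shows "finite (faces F)"
proof -
  have "finite (faces {})" using card_faces_forest[of "{}"] unfolding is_cycle_def by fastforce
  thus ?thesis using faces_add_edges_le[of "{}" F] assms by simp
qed

text \<open>The drawn cycle is a Jordan curve through the edge, with different faces on its two
  sides.\<close>

lemma faces_add_cycle_edge:
  assumes c: "is_cycle F c" and F: "F \<subseteq> E" and e: "e \<in> cycle_edges c"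
  shows "card (faces (F - {e})) + 1 \<le> card (faces F)"
proof -
  have cF: "cycle_edges c \<subseteq> F" using c unfolding is_cycle_iff by blast
  hence eF: "e \<in> F" "e \<in> E" using e F by auto
  have sub: "F - {e} \<subseteq> E" using F by blast
  obtain g where g: "simple_path g" "pathfinish g = pathstart g" "path_image g = edge_image (cycle_edges c)"
    using cycle_loop[OF is_cycle_mono[OF c F]] by blast
  have ins: "drawing F = drawing (F - {e}) \<union> path_image (\<gamma> e)"
    using drawing_insert[of e "F - {e}"] eF by (simp add: insert_absorb)
  have "path_image (\<gamma> e) \<subseteq> path_image g" using g(3) e unfolding edge_image_def by blast
  moreover have "path_image g \<subseteq> drawing (F - {e}) \<union> path_image (\<gamma> e)"
    unfolding ins[symmetric] g(3) drawing_def edge_image_def using cF by blast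
  moreover have "finite (components (- (drawing (F - {e}) \<union> path_image (\<gamma> e))))"
    using finite_faces[OF F] unfolding faces_def ins .
  ultimately show ?thesis
    using components_add_arc_ge[OF edge_arc[OF eF(2)] compact_drawing[OF sub]
        interior_disjoint_drawing[OF eF(2) sub] g(1,2)]
    unfolding faces_def ins by blast
qed

text \<open>An inequality, since the graph need not be connected; this direction guarantees many
  faces. Edges on cycles are removed until a forest with a single face is left.\<close>

lemma euler:
  assumes "F \<subseteq> E" "V \<noteq> {}"
  shows "card F + 2 \<le> card (faces F) + card V"
  using assms(1)
proof (induction "card F" arbitrary: F rule: less_induct)
  case less
  show ?case
  proof (cases "\<exists>c. is_cycle F c")
    case False
    have "\<Union>F \<subseteq> V" using less.prems edge_subset by blast
    hence "card F + 1 \<le> card V"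
      using acyclic_card[OF edge_set_subset[OF edge_set_E less.prems] False] finite_verts assms(2) by blast
    thus ?thesis using card_faces_forest[OF less.prems False] by simp
  next
    case True
    then obtain c where c: "is_cycle F c" by blast
    hence "c \<noteq> []" "cycle_edges c \<subseteq> F" unfolding is_cycle_iff by auto
    then obtain e where e: "e \<in> cycle_edges c" "e \<in> F" unfolding cycle_edges_def by auto
    have "card F = card (F - {e}) + 1"
      using e finite_edges[OF less.prems] by (metis Suc_eq_plus1 card_Suc_Diff1)
    moreover from this have "card (F - {e}) + 2 \<le> card (faces (F - {e})) + card V"
      using less.hyps[of "F - {e}"] less.prems by auto
    ultimately show ?thesis using faces_add_cycle_edge[OF c less.prems e(1)] by linarith
  qed
qed

section \<open>Edges on the boundary of a face\<close>

definition boundary :: "'a set set \<Rightarrow> complex set \<Rightarrow> 'a set set" where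
  "boundary F f = {e \<in> F. mid e \<in> closure f}"

lemma drawing_remove: "e \<in> F \<Longrightarrow> drawing (F - {e}) \<union> path_image (\<gamma> e) = drawing F"
  using drawing_insert[of e "F - {e}"] by (simp add: insert_absorb)

text \<open>An edge outside the boundary has no interior point in \<open>closure f\<close>, so the
  frontier of \<open>f\<close> is drawn by vertices and boundary edges alone, and \<open>f\<close>
  stays a maximal connected set when the other edges are erased.\<close>

lemma face_of_boundary:
  assumes F: "F \<subseteq> E" and f: "f \<in> faces F"
  shows "f \<in> faces (boundary F f)"
proof -
  have dis: "open_arc (\<gamma> e) \<inter> closure f = {}"
    if e: "e \<in> F" "e \<notin> boundary F f" for e
  proof (rule ccontr)
    assume "\<not> ?thesis"
    then obtain x where x: "x \<in> open_arc (\<gamma> e)" "x \<in> closure f" by blast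
    have eE: "e \<in> E" and sub: "F - {e} \<subseteq> E" using e F by auto
    have f': "f \<in> components (- (drawing (F - {e}) \<union> path_image (\<gamma> e)))"
      using f unfolding faces_def drawing_remove[OF e(1)] .
    have "open_arc (\<gamma> e) \<subseteq> closure f"
      using arc_in_closure_of_component[OF edge_arc[OF eE] compact_drawing[OF sub] x(1)
        interior_disjoint_drawing[OF eE sub] f' x(2)] by blast
    thus False using mid_interior[OF eE] e unfolding boundary_def by blast
  qed
  have f3: "connected f" "f \<noteq> {}" "f \<inter> drawing F = {}"
    using f in_components_connected in_components_nonempty in_components_subset unfolding faces_def by blast+
  have "closed (drawing F)" using compact_drawing[OF F] compact_imp_closed by blast
  hence "frontier f \<subseteq> drawing F" using f frontier_of_components_closed_complement unfolding faces_def by blast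
  have "frontier f \<subseteq> drawing (boundary F f)"
  proof
    fix z assume z: "z \<in> frontier f"
    hence zc: "z \<in> closure f" "z \<in> drawing F" using \<open>frontier f \<subseteq> drawing F\<close> unfolding frontier_def by auto
    show "z \<in> drawing (boundary F f)"
    proof (cases "z \<in> pos ` V")
      case False
      then obtain e where e: "e \<in> F" "z \<in> path_image (\<gamma> e)"
        using zc(2) unfolding drawing_def edge_image_def by blast
      have "z \<notin> {pathstart (\<gamma> e), pathfinish (\<gamma> e)}"
        using False edge_ends[of e] edge_subset[of e] e F by blast
      hence "e \<in> boundary F f" using dis[OF e(1)] e(2) zc(1) by blast
      thus ?thesis using e(2) unfolding drawing_def edge_image_def by blast
    qed (simp add: drawing_def)
  qed
  moreover have "drawing (boundary F f) \<subseteq> drawing F"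
    unfolding drawing_def edge_image_def boundary_def by blast
  ultimately show ?thesis using component_of_frontier_subset[OF f3(1,2)] f3(3) unfolding faces_def by blast
qed

text \<open>Double counting: the midpoint of an edge lies in the closure of at most two
  faces.\<close>

lemma sum_boundary_le:
  assumes F: "F \<subseteq> E"
  shows "(\<Sum>f\<in>faces F. card (boundary F f)) \<le> 2 * card F"
proof -
  have fin: "finite F" "finite (faces F)" using finite_edges finite_faces F by auto
  have "(\<Sum>f\<in>faces F. card (boundary F f)) = (\<Sum>f\<in>faces F. \<Sum>e\<in>F. if mid e \<in> closure f then 1 else 0)"
    unfolding boundary_def using fin(1) by (simp add: sum.If_cases Int_def)
  also have "\<dots> = (\<Sum>e\<in>F. \<Sum>f\<in>faces F. if mid e \<in> closure f then 1 else 0)" by (rule sum.swap)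
  also have "\<dots> = (\<Sum>e\<in>F. card {f \<in> faces F. mid e \<in> closure f})"
    using fin(2) by (simp add: sum.If_cases Int_def)
  also have "\<dots> \<le> (\<Sum>e\<in>F. 2)"
  proof (rule sum_mono)
    fix e assume e: "e \<in> F"
    have eE: "e \<in> E" and sub: "F - {e} \<subseteq> E" using e F by auto
    show "card {f \<in> faces F. mid e \<in> closure f} \<le> 2"
      using components_near_arc_point[OF edge_arc[OF eE] compact_drawing[OF sub] mid_interior[OF eE]
          interior_disjoint_drawing[OF eE sub]]
      unfolding faces_def drawing_remove[OF e] by blast
  qed
  finally show ?thesis by simp
qed

text \<open>The sides of the edges are counted over the faces. A face that is not bounded by one of the \<open>p\<close>-cycles
  has at least \<open>N\<close> edges on its boundary: otherwise its boundary graph has no other faces than itself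
  and the faces inside its \<open>p\<close>-cycles, so it is the whole graph.\<close>

lemma plane_count:
  assumes sc: "short_cycles p N E" and V: "V \<noteq> {}"
    and D: "\<And>D. D \<in> \<D> \<longleftrightarrow> (\<exists>c. is_cycle E c \<and> length c = p \<and> D = cycle_edges c)"
    and disj: "\<And>D D'. D \<in> \<D> \<Longrightarrow> D' \<in> \<D> \<Longrightarrow> D \<noteq> D' \<Longrightarrow> D \<inter> D' = {}"
    and facial: "\<And>D. D \<in> \<D> \<Longrightarrow> \<exists>f\<in>faces E. frontier f = edge_image D"
  shows "int N * (int (card E) + 1 - int (card V) - int (card \<D>)) \<le> 2 * int (card E) - int (p * card \<D>)"
proof -
  have DE: "D \<subseteq> E" "card D = p" "D \<noteq> {}" if DD: "D \<in> \<D>" for D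
  proof -
    obtain c where c: "is_cycle E c" "length c = p" "D = cycle_edges c" using D[of D] DD by blast
    show "D \<subseteq> E" "card D = p" using c card_cycle_edges unfolding is_cycle_iff by auto
    have "length c \<ge> 3" using c(1) unfolding is_cycle_iff by blast
    hence "0 \<in> {..<length c}" by auto
    thus "D \<noteq> {}" using c(3) unfolding cycle_edges_def by blast
  qed
  have finE: "finite E" using finite_edges by blast
  have finD: "finite \<D>" using DE(1) finE by (meson Pow_iff finite_Pow_iff finite_subset subsetI)
  \<comment> \<open>One edge from each \<open>p\<close>-cycle; in a subgraph all of whose cycles
    have length \<open>p\<close>, deleting these edges leaves a forest.\<close>
  obtain h where h: "\<And>D. D \<in> \<D> \<Longrightarrow> h D \<in> D" using DE(3) by (metis ex_in_conv)
  have acyc: "\<nexists>c. is_cycle (H - h ` {D \<in> \<D>. D \<subseteq> H}) c"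
    if H: "H \<subseteq> E" "\<And>c. is_cycle H c \<Longrightarrow> length c = p" for H
  proof
    assume "\<exists>c. is_cycle (H - h ` {D \<in> \<D>. D \<subseteq> H}) c"
    then obtain c where c: "is_cycle (H - h ` {D \<in> \<D>. D \<subseteq> H}) c" by blast
    have cH: "is_cycle H c" using is_cycle_mono[OF c] by blast
    have sub: "cycle_edges c \<subseteq> H - h ` {D \<in> \<D>. D \<subseteq> H}" using c unfolding is_cycle_iff by blast
    have "cycle_edges c \<in> \<D>" using D is_cycle_mono[OF cH H(1)] H(2)[OF cH] by blast
    thus False using h[of "cycle_edges c"] sub by blast
  qed
  have pt: "p * card \<D> \<le> card E"
  proof -
    have "card (\<Union>\<D>) = (\<Sum>D\<in>\<D>. card D)"
    proof (rule card_Union_disjoint)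
      show "pairwise disjnt \<D>" using disj unfolding pairwise_def disjnt_def by blast
      show "finite D" if "D \<in> \<D>" for D using finite_subset[OF DE(1)[OF that] finE] .
    qed
    also have "\<dots> = card \<D> * p" using DE(2) by simp
    finally show ?thesis using card_mono[OF finE, of "\<Union>\<D>"] DE(1) by (simp add: Sup_le_iff mult.commute)
  qed
  show ?thesis
  proof (cases "\<forall>c. is_cycle E c \<longrightarrow> length c = p")
    case True
    \<comment> \<open>The outer face may be short here, so faces are not counted. The forest bound
      makes the left side nonpositive, and the right side is at least \<open>card E\<close> because
      the \<open>p\<close>-cycles are disjoint.\<close>
    have all: "{D \<in> \<D>. D \<subseteq> E} = \<D>" using DE(1) by blast
    have ac: "\<nexists>c. is_cycle (E - h ` \<D>) c" using acyc[of E] True unfolding all by blast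
    have "card (E - h ` \<D>) + 1 \<le> card V"
      using acyclic_card[OF edge_set_subset[OF edge_set_E] ac _ finite_verts V] edge_subset by blast
    moreover have "card E \<le> card (E - h ` \<D>) + card \<D>"
      using card_image_le[OF finD, of h] diff_card_le_card_Diff[of "h ` \<D>" E] finD by (simp add: le_diff_conv)
    ultimately have "int (card E) + 1 - int (card V) - int (card \<D>) \<le> 0" by linarith
    hence "int N * (int (card E) + 1 - int (card V) - int (card \<D>)) \<le> 0"
      by (simp add: mult_nonneg_nonpos)
    moreover have "int (p * card \<D>) \<le> int (card E)" using pt of_nat_mono by blast
    ultimately show ?thesis by linarith
  next
    case False
    then obtain c0 where c0: "is_cycle E c0" "length c0 \<noteq> p" by blast
    obtain \<phi> where phi: "\<And>D. D \<in> \<D> \<Longrightarrow> \<phi> D \<in> faces E" "\<And>D. D \<in> \<D> \<Longrightarrow> frontier (\<phi> D) = edge_image D"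
      using facial by metis
    have inj: "inj_on \<phi> \<D>"
    proof (rule inj_onI)
      fix D D' assume a: "D \<in> \<D>" "D' \<in> \<D>" "\<phi> D = \<phi> D'"
      hence "edge_image D = edge_image D'" using phi(2) by metis
      hence "e \<in> D \<longleftrightarrow> e \<in> D'" if "e \<in> E" for e
        using mid_in_edge_image_iff[OF that] DE(1) a by metis
      thus "D = D'" using DE(1) a by blast
    qed
    have fF: "finite (faces E)" using finite_faces by blast
    have big: "N \<le> card (boundary E f)" if f: "f \<in> faces E" "f \<notin> \<phi> ` \<D>" for f
    proof (rule ccontr)
      assume small: "\<not> N \<le> card (boundary E f)"
      define H where "H = boundary E f"
      have HE: "H \<subseteq> E" unfolding H_def boundary_def by blast
      have es: "edge_set H" using edge_set_subset[OF edge_set_E HE] .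
      have cyc: "length c = p" if c: "is_cycle H c" for c
        using sc is_cycle_mono[OF c HE] cycle_length_le_card[OF c es] small
        unfolding short_cycles_def H_def by fastforce
      define \<D>' where "\<D>' = {D \<in> \<D>. D \<subseteq> H}"
      have finD': "finite \<D>'" "\<D>' \<subseteq> \<D>" using finD unfolding \<D>'_def by auto
      have hH: "h ` \<D>' \<subseteq> H" using h unfolding \<D>'_def by blast
      have "card (faces (H - h ` \<D>')) = 1"
        using card_faces_forest[of "H - h ` \<D>'"] acyc[OF HE cyc] HE unfolding \<D>'_def by blast
      moreover have "card (faces ((H - h ` \<D>') \<union> h ` \<D>')) \<le> card (faces (H - h ` \<D>')) + card (h ` \<D>')"
        using faces_add_edges_le[of "H - h ` \<D>'" "h ` \<D>'"] finite_faces HE hH by blast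
      moreover have "(H - h ` \<D>') \<union> h ` \<D>' = H" using hH by blast
      \<comment> \<open>A forest has one face, and each restored edge adds at most one. This bound
        is met by \<open>f\<close> together with the faces \<open>\<phi> D\<close>, so all faces of
        \<open>H\<close> are faces of \<open>E\<close> and no edge lies outside
        \<open>H\<close>.\<close>
      ultimately have up: "card (faces H) \<le> 1 + card \<D>'" using card_image_le[OF finD'(1), of h] by simp
      have "f \<in> faces H" unfolding H_def using face_of_boundary[OF _ f(1)] by blast
      moreover have "\<phi> D \<in> faces H" if D': "D \<in> \<D>'" for D
      proof -
        have DD: "D \<in> \<D>" "D \<subseteq> H" using D' unfolding \<D>'_def by auto
        have c3: "connected (\<phi> D)" "\<phi> D \<noteq> {}" "\<phi> D \<inter> drawing E = {}"
          using phi(1)[OF DD(1)] in_components_connected in_components_nonempty in_components_subset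
          unfolding faces_def by blast+
        have "drawing H \<subseteq> drawing E" "edge_image D \<subseteq> drawing H"
          using HE DD(2) unfolding drawing_def edge_image_def by blast+
        thus ?thesis using component_of_frontier_subset[OF c3(1,2), of "drawing H"] c3(3) phi(2)[OF DD(1)]
          unfolding faces_def by blast
      qed
      ultimately have sub: "insert f (\<phi> ` \<D>') \<subseteq> faces H" by blast
      have "card (\<phi> ` \<D>') = card \<D>'" using inj finD'(2) by (meson card_image inj_on_subset)
      moreover have "f \<notin> \<phi> ` \<D>'" using f(2) finD'(2) by blast
      ultimately have "card (insert f (\<phi> ` \<D>')) = 1 + card \<D>'" using finD'(1) by simp
      hence eq: "insert f (\<phi> ` \<D>') = faces H"
        using card_seteq[OF finite_faces[OF HE] sub] up by simp
      have "insert f (\<phi> ` \<D>') \<subseteq> faces E" using f(1) phi(1) finD'(2) by blast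
      hence "\<Union>(faces H) \<subseteq> \<Union>(faces E)" unfolding eq by (rule Union_mono)
      hence "drawing E \<subseteq> drawing H" unfolding faces_def Union_components by blast
      hence "E \<subseteq> H" using mid_in_drawing_iff[OF _ HE] mid_in_drawing_iff[OF _ order_refl] by blast
      hence "is_cycle H c0" using is_cycle_mono[OF c0(1)] by blast
      thus False using cyc c0(2) by blast
    qed
    have own: "p \<le> card (boundary E (\<phi> D))" if D': "D \<in> \<D>" for D
    proof -
      have "D \<subseteq> boundary E (\<phi> D)"
      proof
        fix e assume e: "e \<in> D"
        hence "mid e \<in> frontier (\<phi> D)"
          using phi(2)[OF D'] mid_in_edge_image_iff[of e D] DE(1)[OF D'] by blast
        thus "e \<in> boundary E (\<phi> D)" using e DE(1)[OF D'] unfolding boundary_def frontier_def by blast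
      qed
      thus ?thesis using card_mono[of "boundary E (\<phi> D)" D] DE(2)[OF D'] finE
        unfolding boundary_def by simp
    qed
    have sub: "\<phi> ` \<D> \<subseteq> faces E" using phi(1) by blast
    have t: "card (\<phi> ` \<D>) = card \<D>" using inj card_image by blast
    have "(\<Sum>f\<in>faces E. card (boundary E f))
        = (\<Sum>f\<in>faces E - \<phi> ` \<D>. card (boundary E f)) + (\<Sum>f\<in>\<phi> ` \<D>. card (boundary E f))"
      using sum.subset_diff[OF sub fF] .
    moreover have "(\<Sum>f\<in>faces E - \<phi> ` \<D>. card (boundary E f)) \<ge> card (faces E - \<phi> ` \<D>) * N"
      using sum_bounded_below[of "faces E - \<phi> ` \<D>" N "\<lambda>f. card (boundary E f)"] big by simp
    moreover have "(\<Sum>f\<in>\<phi> ` \<D>. card (boundary E f)) \<ge> card (\<phi> ` \<D>) * p"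
      using sum_bounded_below[of "\<phi> ` \<D>" p "\<lambda>f. card (boundary E f)"] own by auto
    ultimately have total: "card (faces E - \<phi> ` \<D>) * N + card \<D> * p \<le> 2 * card E"
      using sum_boundary_le[of E] t by simp
    have "card (faces E) = card (faces E - \<phi> ` \<D>) + card \<D>"
      using card_Diff_subset[OF finite_subset[OF sub fF] sub] card_mono[OF fF sub] t by simp
    \<comment> \<open>Euler's formula gives one more; \<open>+ 1\<close> is the form that also holds
      when every cycle has length \<open>p\<close>.\<close>
    hence "int (card E) + 1 - int (card V) - int (card \<D>) \<le> int (card (faces E - \<phi> ` \<D>))"
      using euler[of E] V by simp
    hence "int N * (int (card E) + 1 - int (card V) - int (card \<D>)) \<le> int N * int (card (faces E - \<phi> ` \<D>))"
      by (intro mult_left_mono) auto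
    also have "\<dots> = int (card (faces E - \<phi> ` \<D>) * N)" by simp
    also have "\<dots> \<le> 2 * int (card E) - int (p * card \<D>)"
      using total by (simp add: mult.commute flip: of_nat_mult of_nat_add)
    finally show ?thesis .
  qed
qed

end

section \<open>Extending colorings\<close>

definition step_coloring :: "nat \<Rightarrow> 'a set set \<Rightarrow> ('a \<Rightarrow> int) \<Rightarrow> bool" where
  "step_coloring p E \<psi> \<longleftrightarrow>
    (\<forall>u v. {u, v} \<in> E \<longrightarrow> [\<psi> u - \<psi> v = 1] (mod int p) \<or> [\<psi> u - \<psi> v = -1] (mod int p))"

lemma step_coloring_subset: "step_coloring p E \<psi> \<Longrightarrow> F \<subseteq> E \<Longrightarrow> step_coloring p F \<psi>"
  unfolding step_coloring_def by blast

lemma cyc_edge_in: "i < length c \<Longrightarrow> cyc_edge c i \<in> cycle_edges c"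
  unfolding cycle_edges_def by blast

text \<open>The steps \<open>\<plusminus>1\<close> along the cycle sum to a multiple of \<open>p\<close>; this sum is odd and at most \<open>p\<close> in absolute
  value, so all steps agree.\<close>

lemma step_coloring_cycle:
  assumes p: "odd p" and c: "is_cycle E c" "length c = p" and col: "step_coloring p (cycle_edges c) \<kappa>"
  obtains \<epsilon> where "\<epsilon> = 1 \<or> \<epsilon> = (-1 :: int)" "\<And>i. i < p \<Longrightarrow> [\<kappa> (c ! i) = \<kappa> (c ! 0) + \<epsilon> * int i] (mod int p)"
proof -
  have p0: "p > 0" using p by (cases p) auto
  define d where "d i = (if [\<kappa> (c ! (Suc i mod p)) - \<kappa> (c ! i) = 1] (mod int p) then 1 else -1 :: int)" for i
  have d1: "d i = 1 \<or> d i = -1" for i unfolding d_def by auto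
  have step: "[\<kappa> (c ! (Suc i mod p)) = \<kappa> (c ! i) + d i] (mod int p)" if i: "i < p" for i
  proof -
    have "{c ! (Suc i mod p), c ! i} \<in> cycle_edges c"
      using cyc_edge_in[of i c] i c(2) unfolding cyc_edge_def by (simp add: insert_commute)
    hence "[\<kappa> (c ! (Suc i mod p)) - \<kappa> (c ! i) = d i] (mod int p)"
      using col unfolding step_coloring_def d_def by auto
    from cong_add[OF this cong_refl[of "\<kappa> (c ! i)"]] show ?thesis by (simp add: add.commute)
  qed
  have walk: "[\<kappa> (c ! (i mod p)) = \<kappa> (c ! 0) + (\<Sum>j<i. d j)] (mod int p)" if "i \<le> p" for i
    using that
  proof (induction i)
    case (Suc i)
    hence "[\<kappa> (c ! i) = \<kappa> (c ! 0) + (\<Sum>j<i. d j)] (mod int p)" by simp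
    from cong_trans[OF step[of i] cong_add[OF this cong_refl[of "d i"]]] Suc(2)
    show ?case by (simp add: algebra_simps)
  qed simp
  define S where "S = (\<Sum>j<p. d j)"
  have "[\<kappa> (c ! 0) = \<kappa> (c ! 0) + S] (mod int p)" using walk[of p] unfolding S_def by simp
  hence "int p dvd S" by (simp add: cong_iff_dvd_diff)
  then obtain k where k: "S = int p * k" by (rule dvdE)
  have bd: "d i \<le> 1" "-1 \<le> d i" for i using d1[of i] by auto
  have up: "S \<le> int p" using sum_bounded_above[of "{..<p}" d 1] bd(1) unfolding S_def by simp
  have lo: "- int p \<le> S" using sum_bounded_below[of "{..<p}" "-1" d] bd(2) unfolding S_def by simp
  have "odd S"
  proof -
    have "odd (d j)" for j using d1[of j] by auto
    hence "{j \<in> {..<p}. odd (d j)} = {..<p}" by auto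
    thus ?thesis unfolding S_def using p by (simp add: even_sum_iff)
  qed
  have "k \<le> 1" using up k p0 by (metis mult_le_cancel_left_pos mult.right_neutral of_nat_0_less_iff)
  moreover have "-1 \<le> k" using lo k p0
    by (metis mult_le_cancel_left_pos mult_minus_right mult.right_neutral of_nat_0_less_iff)
  moreover have "k \<noteq> 0" using \<open>odd S\<close> k by auto
  ultimately have k1: "k = 1 \<or> k = -1" by linarith
  have all: "d j = k" if j: "j < p" for j
  proof (rule ccontr)
    assume ne: "d j \<noteq> k"
    \<comment> \<open>Since \<open>S = p * k\<close> and \<open>k\<close> is a sign, this sum of
      nonnegative terms is \<open>p - p * k^2 = 0\<close>, so every term vanishes.\<close>
    have "(\<Sum>j<p. 1 - k * d j) = int p - k * S" unfolding S_def by (simp add: sum_subtractf sum_distrib_left)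
    also have "\<dots> = 0" using k1 k by auto
    finally have "(\<Sum>j<p. 1 - k * d j) = 0" .
    moreover have "0 \<le> 1 - k * d i" for i using d1[of i] k1 by auto
    ultimately have "1 - k * d j = 0" using j sum_nonneg_eq_0_iff[of "{..<p}" "\<lambda>j. 1 - k * d j"] by simp
    thus False using ne d1[of j] k1 by auto
  qed
  show thesis
  proof (rule that[OF k1])
    fix i assume i: "i < p"
    have "(\<Sum>j<i. d j) = k * int i" using all i by simp
    thus "[\<kappa> (c ! i) = \<kappa> (c ! 0) + k * int i] (mod int p)" using walk[of i] i by simp
  qed
qed

lemma step_coloring_of_ray:
  assumes c: "is_cycle E c" "length c = p" and \<epsilon>: "\<epsilon> = 1 \<or> \<epsilon> = (-1 :: int)"
    and ray: "\<And>i. i < p \<Longrightarrow> [x + \<epsilon> * int i = \<psi> (c ! i)] (mod int p)"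
  shows "step_coloring p (cycle_edges c) \<psi>"
  unfolding step_coloring_def
proof (intro allI impI)
  fix u v assume uv: "{u, v} \<in> cycle_edges c"
  then obtain i where i: "i < p" "{u, v} = {c ! i, c ! (Suc i mod p)}"
    using c(2) unfolding cycle_edges_def cyc_edge_def by auto
  have lt: "Suc i mod p < p" using i by (intro mod_less_divisor) simp
  \<comment> \<open>On the closing edge, from index \<open>p - 1\<close> to \<open>0\<close>, the
    change \<open>- \<epsilon> * (p - 1)\<close> is congruent to \<open>\<epsilon>\<close>.\<close>
  have "[\<epsilon> * int (Suc i mod p) - \<epsilon> * int i = \<epsilon>] (mod int p)"
  proof (cases "Suc i = p")
    case True
    hence pi: "int p = int i + 1" by simp
    have "\<epsilon> * int (Suc i mod p) - \<epsilon> * int i - \<epsilon> = int p * - \<epsilon>"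
      using True unfolding pi by (simp add: algebra_simps)
    thus ?thesis unfolding cong_iff_dvd_diff by simp
  next
    case False
    thus ?thesis using i by (simp add: algebra_simps)
  qed
  moreover have "[\<psi> (c ! (Suc i mod p)) - \<psi> (c ! i) = x + \<epsilon> * int (Suc i mod p) - (x + \<epsilon> * int i)] (mod int p)"
    using ray[OF i(1)] ray[OF lt] by (intro cong_diff) (auto intro: cong_sym)
  ultimately have 1: "[\<psi> (c ! (Suc i mod p)) - \<psi> (c ! i) = \<epsilon>] (mod int p)"
    by (simp add: cong_def)
  hence 2: "[\<psi> (c ! i) - \<psi> (c ! (Suc i mod p)) = - \<epsilon>] (mod int p)"
    using cong_minus_minus_iff[of "\<psi> (c ! (Suc i mod p)) - \<psi> (c ! i)" \<epsilon>] by simp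
  show "[\<psi> u - \<psi> v = 1] (mod int p) \<or> [\<psi> u - \<psi> v = -1] (mod int p)"
    using 1 2 \<epsilon> i(2) by (auto simp: doubleton_eq_iff)
qed

text \<open>The first form keeps the vertex set and serves the induction. The second drops isolated
  vertices, which could otherwise lie on the empty side of a nonseparating cycle.\<close>

lemma plane_graph_subset:
  assumes "plane_graph V E pos \<gamma>" "F \<subseteq> E"
  shows "plane_graph V F pos \<gamma>" and "plane_graph (\<Union>F) F pos \<gamma>"
proof -
  interpret plane_graph V E pos \<gamma> by fact
  have UV: "\<Union>F \<subseteq> V" using edge_subset assms(2) by blast
  show "plane_graph V F pos \<gamma>"
  proof unfold_locales
    show "finite V" "inj_on pos V" using finite_verts inj_pos .
    fix e assume e: "e \<in> F"
    hence eE: "e \<in> E" using assms(2) by blast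
    show "e \<subseteq> V" "card e = 2" "arc (\<gamma> e)" "{pathstart (\<gamma> e), pathfinish (\<gamma> e)} = pos ` e"
      "(path_image (\<gamma> e) - pos ` e) \<inter> pos ` V = {}"
      using edge_subset edge_card edge_arc edge_ends interior_vertex eE by auto
    fix f assume "f \<in> F" "e \<noteq> f"
    thus "(path_image (\<gamma> e) - pos ` e) \<inter> path_image (\<gamma> f) = {}"
      using interior_edge[OF eE] assms(2) by blast
  qed
  show "plane_graph (\<Union>F) F pos \<gamma>"
  proof unfold_locales
    show "finite (\<Union>F)" using finite_subset[OF UV finite_verts] .
    show "inj_on pos (\<Union>F)" using inj_on_subset[OF inj_pos UV] .
    fix e assume e: "e \<in> F"
    hence eE: "e \<in> E" using assms(2) by blast
    show "e \<subseteq> \<Union>F" using e by blast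
    show "card e = 2" "arc (\<gamma> e)" "{pathstart (\<gamma> e), pathfinish (\<gamma> e)} = pos ` e"
      using edge_card[OF eE] edge_arc[OF eE] edge_ends[OF eE] .
    show "(path_image (\<gamma> e) - pos ` e) \<inter> pos ` \<Union>F = {}"
      using interior_vertex[OF eE] UV by blast
    fix f assume "f \<in> F" "e \<noteq> f"
    thus "(path_image (\<gamma> e) - pos ` e) \<inter> path_image (\<gamma> f) = {}"
      using interior_edge[OF eE] assms(2) by blast
  qed
qed

section \<open>The two sides of a cycle\<close>

context plane_graph
begin

text \<open>Only edges count, so an isolated vertex may lie on the empty side. The property is
  inherited by subgraphs that contain the cycle.\<close>

definition nonseparating :: "'a list \<Rightarrow> bool" where
  "nonseparating c \<longleftrightarrow> inside (edge_image (cycle_edges c)) \<inter> edge_image E = {} \<or>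
     outside (edge_image (cycle_edges c)) \<inter> edge_image E = {}"

text \<open>The empty side of the Jordan curve is connected and has the curve as frontier;
  \<open>V = \<Union>E\<close> ensures that no isolated vertex lies in it.\<close>

lemma face_of_nonseparating:
  assumes c: "is_cycle E c" "nonseparating c" and V: "V = \<Union>E"
  shows "\<exists>f\<in>faces E. frontier f = edge_image (cycle_edges c)"
proof -
  define J where "J = edge_image (cycle_edges c)"
  obtain g where g: "simple_path g" "pathfinish g = pathstart g" "path_image g = J"
    using cycle_loop[OF c(1)] unfolding J_def by blast
  obtain R where R: "R = inside J \<or> R = outside J" "R \<inter> edge_image E = {}"
    using c(2) unfolding nonseparating_def J_def by blast
  have jr: "R \<noteq> {}" "connected R" "frontier R = J"
    using Jordan_inside_outside[OF g(1,2)] R(1) unfolding g(3) by auto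
  have "pos ` V \<subseteq> edge_image E" using end_on_edge unfolding V edge_image_def by blast
  hence dr: "drawing E = edge_image E" unfolding drawing_def by blast
  have "J \<subseteq> edge_image E" using c(1) unfolding J_def edge_image_def is_cycle_iff by blast
  hence "R \<in> faces E" unfolding faces_def dr
    using component_of_frontier_subset[OF jr(2,1) R(2)] jr(3) by blast
  thus ?thesis using jr(3) unfolding J_def by blast
qed

lemma edge_in_closure_interior:
  assumes "e \<in> E" shows "path_image (\<gamma> e) \<subseteq> closure (path_image (\<gamma> e) - pos ` e)"
proof -
  have eq: "path_image (\<gamma> e) - pos ` e = \<gamma> e ` {0<..<1}"
    using simple_path_endless[OF arc_imp_simple_path[OF edge_arc[OF assms]]]
    unfolding edge_ends[OF assms] .
  have "continuous_on (closure {0<..<1::real}) (\<gamma> e)"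
    using edge_arc[OF assms] unfolding arc_def path_def by simp
  hence "\<gamma> e ` closure {0<..<1::real} \<subseteq> closure (\<gamma> e ` {0<..<1})"
    by (rule image_closure_subset) (auto intro: closure_subset[THEN subsetD])
  thus ?thesis unfolding eq by (simp add: path_image_def)
qed

lemma edge_one_side:
  assumes "e \<in> E" "open R" "open R'" "R \<inter> R' = {}" and J: "R \<union> R' = - edge_image D" and D: "D \<subseteq> E" "e \<notin> D"
  shows "path_image (\<gamma> e) - pos ` e \<subseteq> R \<or> path_image (\<gamma> e) - pos ` e \<subseteq> R'"
proof -
  have "connected (path_image (\<gamma> e) - pos ` e)"
    using connected_simple_path_endless[OF arc_imp_simple_path[OF edge_arc[OF assms(1)]]]
    unfolding edge_ends[OF assms(1)] .
  moreover have "(path_image (\<gamma> e) - pos ` e) \<inter> edge_image D = {}"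
    using interior_disjoint_drawing[OF assms(1) D] unfolding edge_ends[OF assms(1)] drawing_def by blast
  hence "path_image (\<gamma> e) - pos ` e \<subseteq> R \<union> R'" unfolding J by blast
  ultimately show ?thesis using connectedD[of "path_image (\<gamma> e) - pos ` e" R R'] assms(2-4) by blast
qed

text \<open>This concerns the end points of the edge: they are limits of its interior, and an open
  set disjoint from the interior misses its closure.\<close>

lemma edge_misses_other_side:
  assumes "e \<in> E" "open R'" "R \<inter> R' = {}" "path_image (\<gamma> e) - pos ` e \<subseteq> R"
  shows "path_image (\<gamma> e) \<inter> R' = {}"
proof -
  have "R' \<inter> (path_image (\<gamma> e) - pos ` e) = {}" using assms(3,4) by blast
  hence "R' \<inter> closure (path_image (\<gamma> e) - pos ` e) = {}" using open_Int_closure_eq_empty[OF assms(2)] by blast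
  thus ?thesis using edge_in_closure_interior[OF assms(1)] by blast
qed

end

text \<open>On an edge of \<open>E2\<close> the glued coloring is congruent to
  \<open>\<psi>2\<close>: it takes values of \<open>\<psi>1\<close> there only at vertices of
  \<open>S\<close>, where the two colorings agree modulo \<open>p\<close>.\<close>

lemma step_coloring_glue:
  assumes col: "step_coloring p E1 \<psi>1" "step_coloring p E2 \<psi>2"
    and U: "\<And>e v. e \<in> E1 \<Longrightarrow> v \<in> e \<Longrightarrow> v \<notin> U" "\<And>e v. e \<in> E2 \<Longrightarrow> v \<in> e \<Longrightarrow> v \<notin> U \<Longrightarrow> v \<in> S"
    and eq: "\<And>v. v \<in> S \<Longrightarrow> [\<psi>2 v = \<psi>1 v] (mod int p)"
  shows "step_coloring p (E1 \<union> E2) (\<lambda>v. if v \<in> U then \<psi>2 v else \<psi>1 v)"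
  unfolding step_coloring_def
proof (intro allI impI)
  fix u v assume uv: "{u, v} \<in> E1 \<union> E2"
  define \<psi> where "\<psi> = (\<lambda>v. if v \<in> U then \<psi>2 v else \<psi>1 v)"
  show "[(if u \<in> U then \<psi>2 u else \<psi>1 u) - (if v \<in> U then \<psi>2 v else \<psi>1 v) = 1] (mod int p) \<or>
        [(if u \<in> U then \<psi>2 u else \<psi>1 u) - (if v \<in> U then \<psi>2 v else \<psi>1 v) = -1] (mod int p)"
  proof (cases "{u, v} \<in> E1")
    case True
    thus ?thesis using U(1)[OF True] col(1) unfolding step_coloring_def by auto
  next
    case False
    hence E2: "{u, v} \<in> E2" using uv by blast
    have "[\<psi> w = \<psi>2 w] (mod int p)" if "w \<in> {u, v}" for w
      using U(2)[OF E2 that] eq[of w] unfolding \<psi>_def by (auto intro: cong_sym)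
    hence "[\<psi> u - \<psi> v = \<psi>2 u - \<psi>2 v] (mod int p)" by (intro cong_diff) auto
    moreover have "[\<psi>2 u - \<psi>2 v = 1] (mod int p) \<or> [\<psi>2 u - \<psi>2 v = -1] (mod int p)"
      using col(2) E2 unfolding step_coloring_def by blast
    ultimately show ?thesis unfolding \<psi>_def by (metis cong_trans)
  qed
qed

lemma double_le_bound: "2 \<le> p \<Longrightarrow> 2 * p \<le> 2 * (p - 1) * (p + 2)" for p :: nat
  using mult_le_mono[of 1 "p - 1" p "p + 2"] by simp

text \<open>The network of a plane graph: its nodes are the vertices and the \<open>p\<close>-cycles, its edges are the
  edges of the graph outside all \<open>p\<close>-cycles and a spoke from each \<open>p\<close>-cycle to each of its vertices. A
  rigid node \<open>D\<close> with state \<open>(x, \<epsilon>)\<close> stands for the coloring \<open>i \<mapsto> x + \<epsilon> i\<close> of the cycle \<open>D\<close>.\<close>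

lemma nonseparating_extension:
  fixes V :: "'a set"
  assumes p: "prime p" "p \<ge> 5" and N: "N = 2 * (p - 1) * (p + 2)"
    and pg: "plane_graph V E pos \<gamma>" and sc: "short_cycles p N E"
    and ns: "\<And>c. is_cycle E c \<Longrightarrow> length c = p \<Longrightarrow> plane_graph.nonseparating E \<gamma> c"
    and C: "is_cycle E C" "length C = p" and col: "step_coloring p (cycle_edges C) \<kappa>"
  shows "\<exists>\<psi>. step_coloring p E \<psi> \<and> (\<forall>v\<in>set C. [\<psi> v = \<kappa> v] (mod int p))"
proof -
  interpret plane_graph V E pos \<gamma> by fact
  have p0: "p > 0" and oddp: "odd p" using p prime_odd_nat by force+
  have N2: "2 * p \<le> N" using double_le_bound p(2) unfolding N by simp
  define \<D> where "\<D> = {cycle_edges c | c. is_cycle E c \<and> length c = p}"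
  \<comment> \<open>A fixed vertex list for each \<open>p\<close>-cycle; offsets and orientations
    refer to its starting vertex and direction.\<close>
  define R where "R D = (SOME c. is_cycle E c \<and> length c = p \<and> cycle_edges c = D)" for D
  have R: "is_cycle E (R D)" "length (R D) = p" "cycle_edges (R D) = D" if "D \<in> \<D>" for D
  proof -
    have "\<exists>c. is_cycle E c \<and> length c = p \<and> cycle_edges c = D" using that unfolding \<D>_def by blast
    from someI_ex[OF this] show "is_cycle E (R D)" "length (R D) = p" "cycle_edges (R D) = D"
      unfolding R_def by blast+
  qed
  have DE: "D \<subseteq> E" "card D = p" if "D \<in> \<D>" for D
    using R[OF that] card_cycle_edges[OF R(1)[OF that]] unfolding is_cycle_iff by auto
  have disj: "D \<inter> D' = {}" if "D \<in> \<D>" "D' \<in> \<D>" "D \<noteq> D'" for D D'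
    using p_cycles_edge_disjoint[OF sc N2 oddp, of "R D" "R D'"] R that by simp
  have finE: "finite E" using finite_edges by blast
  have "\<D> \<subseteq> Pow E" using DE(1) by blast
  hence finD: "finite \<D>" using finE finite_subset by blast
  define O' where "O' = E - \<Union>\<D>"
  have "\<exists>u w. e = {u, w}" if "e \<in> E" for e using edge_card[OF that] by (meson card_2_iff)
  then obtain f g where fg: "\<And>e. e \<in> E \<Longrightarrow> e = {f e, g e}" by metis
  define nd :: "'a set + 'a set set \<times> nat \<Rightarrow> bool \<Rightarrow> 'a + 'a set set" where
    "nd = case_sum (\<lambda>e b. Inl (if b then g e else f e)) (\<lambda>(D, i) b. if b then Inl (R D ! i) else Inr D)"
  define off :: "'a set + 'a set set \<times> nat \<Rightarrow> bool \<Rightarrow> int" where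
    "off = case_sum (\<lambda>_ _. 0) (\<lambda>(D, i) b. if b then 0 else int i)"
  \<comment> \<open>A graph edge permits the steps \<open>1\<close> and \<open>- 1\<close>. A spoke
    identifies the color of its vertex with the value at offset \<open>i\<close> on the cycle, so it
    permits only \<open>0\<close> and has expansion and weight \<open>0\<close>.\<close>
  define A :: "'a set + 'a set set \<times> nat \<Rightarrow> int set" where "A = case_sum (\<lambda>_. {1, - 1}) (\<lambda>_. {0})"
  define s :: "'a set + 'a set set \<times> nat \<Rightarrow> nat" where "s = case_sum (\<lambda>_. 1) (\<lambda>_. 0)"
  define w :: "'a set + 'a set set \<times> nat \<Rightarrow> nat" where "w = case_sum (\<lambda>_. 2) (\<lambda>_. 0)"
  define T :: "('a + 'a set set) set" where "T = range Inr"
  define B where "B = Inl ` V \<union> (Inr ` \<D> :: ('a + 'a set set) set)"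
  define L where "L = Inl ` O' \<union> (Inr ` (\<D> \<times> {..<p}) :: ('a set + 'a set set \<times> nat) set)"
  have RV: "R D ! i \<in> \<Union>D" if "D \<in> \<D>" "i < p" for D i
    using Union_cycle_edges[OF R(1)[OF that(1)]] R(2,3)[OF that(1)] that(2) nth_mem by metis
  have UEV: "\<Union>E \<subseteq> V" using edge_subset by blast
  have sparse: "sparse p N B L T nd w"
    unfolding sparse_def
  proof (intro allI impI)
    fix B' L' assume B': "B' \<subseteq> B" "B' \<noteq> {}" and L': "L' \<subseteq> L" and ends: "\<forall>e\<in>L'. \<forall>b. nd e b \<in> B'"
    define BV where "BV = {v. Inl v \<in> B'}"
    define BD where "BD = {D. Inr D \<in> B'}"
    define LO where "LO = {e. Inl e \<in> L'}"
    define LS where "LS = {q. Inr q \<in> L'}"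
    have subs: "BV \<subseteq> V" "BD \<subseteq> \<D>" "LO \<subseteq> O'" "LS \<subseteq> \<D> \<times> {..<p}"
      using B' L' unfolding B_def L_def BV_def BD_def LO_def LS_def by auto
    have fins: "finite BV" "finite BD" "finite LO" "finite LS"
      using finite_subset[OF subs(1) finite_verts] finite_subset[OF subs(2) finD]
        finite_subset[OF subs(3)] finite_subset[OF subs(4)] finE finD unfolding O'_def by auto
    have "B' = Inl ` BV \<union> Inr ` BD" unfolding BV_def BD_def by (auto simp: image_iff) (metis sum.exhaust)
    hence cB: "card B' = card BV + card BD"
      using card_Plus[OF fins(1,2)] unfolding Plus_def by simp
    have L'eq: "L' = Inl ` LO \<union> Inr ` LS" unfolding LO_def LS_def
      by (auto simp: image_iff) (metis old.prod.exhaust sum.exhaust)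
    hence cL: "card L' = card LO + card LS"
      using card_Plus[OF fins(3,4)] unfolding Plus_def by simp
    have wL: "sum w L' = 2 * card LO"
      unfolding L'eq using fins
      by (subst sum.union_disjoint) (auto simp: sum.reindex w_def)
    have "B' \<inter> T = Inr ` BD" unfolding BD_def T_def by auto
    hence cT: "card (B' \<inter> T) = card BD" by (simp add: card_image)
    have BVends: "f e \<in> BV" "g e \<in> BV" if "e \<in> LO" for e
      using ends[rule_format, of "Inl e" False] ends[rule_format, of "Inl e" True] that
      unfolding LO_def BV_def nd_def by auto
    have spoke: "D \<in> BD" "R D ! i \<in> BV" if "(D, i) \<in> LS" for D i
      using ends[rule_format, of "Inr (D, i)" False] ends[rule_format, of "Inr (D, i)" True] that
      unfolding LS_def BV_def BD_def nd_def by auto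
    \<comment> \<open>The plane graph behind the subnetwork: a \<open>p\<close>-cycle whose node is
      present is taken whole, even where its spokes are missing.\<close>
    define G where "G = LO \<union> \<Union>BD"
    have GE: "G \<subseteq> E" using subs(2,3) DE(1) unfolding G_def O'_def by blast
    have "card (\<Union>BD) = card BD * p"
    proof -
      have "card (\<Union>BD) = (\<Sum>D\<in>BD. card D)"
      proof (rule card_Union_disjoint)
        show "pairwise disjnt BD" using disj subs(2) unfolding pairwise_def disjnt_def by blast
        show "finite D" if "D \<in> BD" for D using finite_subset[OF DE(1) finE] that subs(2) by blast
      qed
      also have "\<dots> = (\<Sum>D\<in>BD. p)" using DE(2) subs(2) by (intro sum.cong) auto
      finally show ?thesis by simp
    qed
    moreover have "LO \<inter> \<Union>BD = {}" using subs(2,3) unfolding O'_def by blast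
    ultimately have cG: "card G = card LO + card BD * p"
      unfolding G_def using fins finite_subset[OF GE finE] by (subst card_Un_disjoint) (auto simp: G_def)
    show "int N * (int (card L') + 1 - int (card B')) \<le> int (sum w L' + p * card (B' \<inter> T))"
    proof (cases "G = {}")
      case True
      have "LS = {}"
      proof (rule ccontr)
        assume "LS \<noteq> {}"
        then obtain D i where "(D, i) \<in> LS" by auto
        hence "D \<in> BD" using spoke by blast
        hence "card D = p" "D = {}" using True DE(2) subs(2) unfolding G_def by blast+
        thus False using p0 by simp
      qed
      moreover have "LO = {}" using True unfolding G_def by blast
      ultimately have "card L' = 0" unfolding cL by simp
      moreover have "finite B'" using finite_subset[OF B'(1)] finite_verts finD unfolding B_def by blast
      hence "card B' \<ge> 1" using B'(2) by (simp add: Suc_le_eq card_gt_0_iff)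
      ultimately have "int N * (int (card L') + 1 - int (card B')) \<le> 0"
        by (intro mult_nonneg_nonpos) auto
      thus ?thesis by linarith
    next
      case False
      interpret G: plane_graph "\<Union>G" G pos \<gamma> using plane_graph_subset(2)[OF pg GE] .
      \<comment> \<open>A \<open>p\<close>-cycle of \<open>G\<close> has no edge in
        \<open>LO\<close>, so it shares an edge with a member of \<open>BD\<close>, and by
        edge-disjointness it is that member.\<close>
      have cyc: "D \<in> BD \<longleftrightarrow> (\<exists>c. is_cycle G c \<and> length c = p \<and> D = cycle_edges c)" for D
      proof
        assume D: "D \<in> BD"
        hence DD: "D \<in> \<D>" "D \<subseteq> G" using subs(2) unfolding G_def by blast+
        have "is_cycle G (R D)" using R[OF DD(1)] DD(2) unfolding is_cycle_iff by blast
        thus "\<exists>c. is_cycle G c \<and> length c = p \<and> D = cycle_edges c" using R(2,3)[OF DD(1)] by metis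
      next
        assume "\<exists>c. is_cycle G c \<and> length c = p \<and> D = cycle_edges c"
        then obtain c where c: "is_cycle G c" "length c = p" "D = cycle_edges c" by blast
        have DD: "D \<in> \<D>" using is_cycle_mono[OF c(1) GE] c(2,3) unfolding \<D>_def by blast
        have DG: "D \<subseteq> G" using c(1,3) unfolding is_cycle_iff by blast
        have "D \<noteq> {}" using DE(2)[OF DD] p0 by auto
        then obtain e where e: "e \<in> D" by blast
        hence "e \<notin> O'" using DD unfolding O'_def by blast
        hence "e \<in> \<Union>BD" using e DG subs(3) unfolding G_def by blast
        then obtain D' where D': "D' \<in> BD" "e \<in> D'" by blast
        have "D' = D" using disj[of D' D] D' e DD subs(2) by blast
        thus "D \<in> BD" using D' by simp
      qed
      have "int N * (int (card G) + 1 - int (card (\<Union>G)) - int (card BD)) \<le> 2 * int (card G) - int (p * card BD)"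
      proof (rule G.plane_count[OF short_cycles_subset[OF sc GE] _ cyc])
        obtain e where "e \<in> G" using False by blast
        hence "e \<noteq> {}" using G.edge_card by fastforce
        thus "\<Union>G \<noteq> {}" using \<open>e \<in> G\<close> by blast
        show "D \<inter> D' = {}" if "D \<in> BD" "D' \<in> BD" "D \<noteq> D'" for D D'
          using disj that subs(2) by blast
        fix D assume D: "D \<in> BD"
        then obtain c where c: "is_cycle G c" "length c = p" "D = cycle_edges c" using cyc by blast
        have "nonseparating c" using ns[OF is_cycle_mono[OF c(1) GE] c(2)] .
        moreover have "edge_image G \<subseteq> edge_image E" using GE unfolding edge_image_def by blast
        ultimately have "G.nonseparating c" unfolding nonseparating_def G.nonseparating_def by blast
        from G.face_of_nonseparating[OF c(1) this refl]
        show "\<exists>f\<in>G.faces G. frontier f = edge_image D" unfolding c(3) .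
      qed
      moreover have "2 * int (card G) - int (p * card BD) = int (sum w L' + p * card (B' \<inter> T))"
        unfolding wL cT cG by (simp add: algebra_simps)
      \<comment> \<open>A vertex of \<open>G\<close> absent from the subnetwork lies on a cycle in
        \<open>BD\<close> whose spoke to it is missing. Hence replacing nodes and spokes by whole
        cycles does not decrease the left side of the sparsity inequality.\<close>
      moreover have "card LS + card (\<Union>G) \<le> card BV + p * card BD"
      proof -
        have "\<Union>G - BV \<subseteq> (\<lambda>(D, i). R D ! i) ` (BD \<times> {..<p} - LS)"
        proof
          fix v assume v: "v \<in> \<Union>G - BV"
          then obtain e where e: "e \<in> G" "v \<in> e" by blast
          have "e \<notin> LO"
          proof
            assume eLO: "e \<in> LO"
            hence "e \<in> E" using subs(3) unfolding O'_def by blast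
            hence "v = f e \<or> v = g e" using fg[of e] e(2) by blast
            thus False using BVends[OF eLO] v by auto
          qed
          then obtain D where D: "D \<in> BD" "e \<in> D" using e(1) unfolding G_def by blast
          have DD: "D \<in> \<D>" using D subs(2) by blast
          have "v \<in> set (R D)" using Union_cycle_edges[OF R(1)[OF DD]] R(3)[OF DD] D(2) e(2) by blast
          then obtain i where i: "i < p" "v = R D ! i" using R(2)[OF DD] by (metis in_set_conv_nth)
          have "(D, i) \<notin> LS" using spoke(2) i v by blast
          thus "v \<in> (\<lambda>(D, i). R D ! i) ` (BD \<times> {..<p} - LS)" using D i by force
        qed
        hence "card (\<Union>G - BV) \<le> card (BD \<times> {..<p} - LS)"
          using fins(2) by (meson surj_card_le finite_Diff finite_SigmaI finite_lessThan)
        moreover have "LS \<subseteq> BD \<times> {..<p}" using spoke(1) subs(4) by auto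
        hence "card (BD \<times> {..<p} - LS) = card BD * p - card LS" "card LS \<le> card BD * p"
          using fins card_mono[of "BD \<times> {..<p}" LS] by (simp_all add: card_Diff_subset card_cartesian_product)
        moreover have "card (\<Union>G) \<le> card BV + card (\<Union>G - BV)"
          using card_Un_le[of BV "\<Union>G - BV"] card_mono[of "BV \<union> (\<Union>G - BV)" "\<Union>G"] fins(1) G.finite_verts
          by (metis Un_Diff_cancel Un_upper2 finite_UnI order_trans)
        ultimately show ?thesis by (simp add: mult.commute)
      qed
      hence "int (card LS) + int (card (\<Union>G)) \<le> int (card BV) + int (card BD * p)"
        by (metis mult.commute of_nat_add of_nat_mono)
      hence "int (card L') + 1 - int (card B') \<le> int (card G) + 1 - int (card (\<Union>G)) - int (card BD)"
        unfolding cL cB cG of_nat_add by linarith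
      hence "int N * (int (card L') + 1 - int (card B'))
         \<le> int N * (int (card G) + 1 - int (card (\<Union>G)) - int (card BD))"
        by (intro mult_left_mono) auto
      ultimately show ?thesis by linarith
    qed
  qed
  have net: "network p N B L T nd off A s w"
    unfolding network_def
  proof (intro conjI sparse)
    show "finite B" "finite L" using finite_verts finD finE unfolding B_def L_def O'_def by auto
    show "\<forall>e\<in>L. \<forall>b. nd e b \<in> B"
    proof (intro ballI allI)
      fix e b assume "e \<in> L"
      then consider e' where "e = Inl e'" "e' \<in> E" | D i where "e = Inr (D, i)" "D \<in> \<D>" "i < p"
        unfolding L_def O'_def by auto
      thus "nd e b \<in> B"
      proof cases
        case 1
        have "f e' \<in> V" "g e' \<in> V" using fg[OF 1(2)] edge_subset[OF 1(2)] by blast+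
        thus ?thesis using 1 unfolding nd_def B_def by simp
      next
        case 2
        have "R D ! i \<in> V" using RV[OF 2(2,3)] DE(1)[OF 2(2)] UEV by blast
        thus ?thesis using 2 unfolding nd_def B_def by simp
      qed
    qed
    have "\<not> [1 = - 1] (mod int p)"
    proof
      assume "[1 = - 1] (mod int p)"
      hence "int p dvd 2" by (simp add: cong_iff_dvd_diff)
      from zdvd_imp_le[OF this] show False using p(2) by simp
    qed
    from expanding_doubleton[OF p(1) this]
    show "\<forall>e\<in>L. expanding p (A e) (s e) \<and> w e \<le> p * s e"
      using p(2) expanding_0[OF p0, of "{0}"] unfolding A_def s_def w_def by (auto split: sum.split)
    show "\<forall>e\<in>L. \<forall>e'\<in>L. \<forall>b b'. e \<noteq> e' \<longrightarrow> nd e b = nd e' b' \<longrightarrow> nd e b \<in> T \<longrightarrow>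
       \<not> [off e b = off e' b'] (mod int p)"
    proof (intro ballI allI impI)
      fix e e' b b' assume h: "e \<in> L" "e' \<in> L" "e \<noteq> e'" "nd e b = nd e' b'" "nd e b \<in> T"
      have shape: "\<exists>D i. x = Inr (D, i) \<and> i < p \<and> \<not> c \<and> nd x c = Inr D" if "x \<in> L" "nd x c \<in> T" for x c
        using that unfolding L_def nd_def T_def by (cases c) auto
      obtain D i where Di: "e = Inr (D, i)" "i < p" "\<not> b" "nd e b = Inr D" using shape[OF h(1,5)] by blast
      obtain D' i' where Di': "e' = Inr (D', i')" "i' < p" "\<not> b'" "nd e' b' = Inr D'"
        using shape[OF h(2), of b'] h(4,5) by auto
      have "i \<noteq> i'" using Di Di' h by auto
      thus "\<not> [off e b = off e' b'] (mod int p)" using Di Di' unfolding off_def by (simp add: cong_def)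
    qed
  qed
  define DC where "DC = cycle_edges C"
  have DC: "DC \<in> \<D>" using C unfolding \<D>_def DC_def by blast
  have col': "step_coloring p (cycle_edges (R DC)) \<kappa>" using col R(3)[OF DC] unfolding DC_def by simp
  \<comment> \<open>The root state is read along the list \<open>R DC\<close>, which may start
    elsewhere or run in the opposite direction to \<open>C\<close>.\<close>
  obtain \<epsilon>0 where e0: "\<epsilon>0 = 1 \<or> \<epsilon>0 = (-1 :: int)"
    and ray0: "\<And>i. i < p \<Longrightarrow> [\<kappa> (R DC ! i) = \<kappa> (R DC ! 0) + \<epsilon>0 * int i] (mod int p)"
    using step_coloring_cycle[OF oddp R(1,2)[OF DC] col'] by blast
  have rB: "Inr DC \<in> B" using DC unfolding B_def by blast
  obtain x \<epsilon> where x: "x (Inr DC) = \<kappa> (R DC ! 0)" "\<epsilon> (Inr DC) = \<epsilon>0" "\<forall>v. \<epsilon> v = 1 \<or> \<epsilon> v = -1"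
    "\<forall>e\<in>L. satisfied p nd off A x \<epsilon> e"
    using network_colorable[OF p N net rB e0, of "\<kappa> (R DC ! 0)"] by blast
  define \<psi> where "\<psi> v = x (Inl v)" for v
  have ray: "[x (Inr D) + \<epsilon> (Inr D) * int i = \<psi> (R D ! i)] (mod int p)" if "D \<in> \<D>" "i < p" for D i
  proof -
    have "satisfied p nd off A x \<epsilon> (Inr (D, i))" using x(4) that unfolding L_def by blast
    thus ?thesis unfolding satisfied_def nd_def off_def A_def \<psi>_def by simp
  qed
  have stepE: "step_coloring p E \<psi>"
    unfolding step_coloring_def
  proof (intro allI impI)
    fix u v assume uv: "{u, v} \<in> E"
    show "[\<psi> u - \<psi> v = 1] (mod int p) \<or> [\<psi> u - \<psi> v = -1] (mod int p)"
    proof (cases "{u, v} \<in> \<Union>\<D>")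
      case True
      then obtain D where D: "D \<in> \<D>" "{u, v} \<in> D" by blast
      have "step_coloring p (cycle_edges (R D)) \<psi>"
        using step_coloring_of_ray[OF R(1,2)[OF D(1)] x(3)[rule_format, of "Inr D"]] ray[OF D(1)] by blast
      thus ?thesis using D R(3)[OF D(1)] unfolding step_coloring_def by simp
    next
      case False
      define e where "e = {u, v}"
      have "Inl e \<in> L" using uv False unfolding L_def O'_def e_def by blast
      hence "satisfied p nd off A x \<epsilon> (Inl e)" using x(4) by blast
      then obtain a where a: "a \<in> {1, - 1}" "[\<psi> (f e) + a = \<psi> (g e)] (mod int p)"
        unfolding satisfied_def nd_def off_def A_def \<psi>_def
        by (simp only: sum.case if_True if_False mult_zero_right add_0_right) blast
      have "[\<psi> (f e) + a - \<psi> (f e) = \<psi> (g e) - \<psi> (f e)] (mod int p)" using a(2) by (intro cong_diff) auto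
      hence 1: "[\<psi> (g e) - \<psi> (f e) = a] (mod int p)" by (simp add: cong_sym_eq)
      hence 2: "[\<psi> (f e) - \<psi> (g e) = - a] (mod int p)"
        using cong_minus_minus_iff[of "\<psi> (g e) - \<psi> (f e)" a] by simp
      have "{u, v} = {f e, g e}" using fg[of e] uv unfolding e_def by blast
      thus ?thesis using 1 2 a(1) by (auto simp: doubleton_eq_iff)
    qed
  qed
  have "[\<psi> v = \<kappa> v] (mod int p)" if v: "v \<in> set C" for v
  proof -
    have "set (R DC) = set C"
      using Union_cycle_edges[OF R(1)[OF DC]] Union_cycle_edges[OF C(1)] R(3)[OF DC] unfolding DC_def by simp
    hence "v \<in> set (R DC)" using v by simp
    then obtain i where i: "i < p" "R DC ! i = v" unfolding in_set_conv_nth R(2)[OF DC] by blast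
    show ?thesis
      using cong_trans[OF cong_sym[OF ray[OF DC i(1)]] cong_sym[OF ray0[OF i(1), folded x(1,2)]]]
      unfolding i(2) x(1,2) .
  qed
  thus ?thesis using stepE by blast
qed

section \<open>Splitting along a separating cycle\<close>

context plane_graph
begin

text \<open>Each part consists of \<open>c\<close> and the edges on one side of it, and it is proper
  because the other side contains an edge. \<open>U\<close> collects the vertices strictly on the
  side away from \<open>C\<close>, which is colored second.\<close>

lemma separating_split:
  assumes sc: "short_cycles p N E" and N: "2 * p \<le> N" and p: "odd p"
    and c: "is_cycle E c" "length c = p" "\<not> nonseparating c" and C: "is_cycle E C" "length C = p"
  obtains E1 E2 U where "E = E1 \<union> E2" "E1 \<subset> E" "E2 \<subset> E" "cycle_edges c \<subseteq> E1" "cycle_edges c \<subseteq> E2"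
    "cycle_edges C \<subseteq> E1" "\<And>e v. e \<in> E1 \<Longrightarrow> v \<in> e \<Longrightarrow> v \<notin> U"
    "\<And>e v. e \<in> E2 \<Longrightarrow> v \<in> e \<Longrightarrow> v \<notin> U \<Longrightarrow> v \<in> set c"
proof -
  note split = that
  define D where "D = cycle_edges c"
  define J where "J = edge_image D"
  define side where "side R = {e \<in> E - D. path_image (\<gamma> e) - pos ` e \<subseteq> R}" for R
  obtain g where g: "simple_path g" "pathfinish g = pathstart g" "path_image g = J"
    using cycle_loop[OF c(1)] unfolding J_def D_def by blast
  have DE: "D \<subseteq> E" using c(1) unfolding D_def is_cycle_iff by blast
  have Dset: "\<Union>D = set c" unfolding D_def by (rule Union_cycle_edges[OF c(1)])
  have jo: "open (inside J)" "open (outside J)" "inside J \<inter> outside J = {}" "inside J \<union> outside J = - J"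
    using Jordan_inside_outside[OF g(1,2)] unfolding g(3) by auto
  have ne: "inside J \<inter> edge_image E \<noteq> {}" "outside J \<inter> edge_image E \<noteq> {}"
    using c(3) unfolding nonseparating_def J_def D_def by auto
  have on_J: "v \<in> set c" if v: "v \<in> V" "pos v \<in> J" for v
  proof -
    obtain e where e: "e \<in> D" "pos v \<in> path_image (\<gamma> e)" using v(2) unfolding J_def edge_image_def by blast
    hence "v \<in> e" using vertex_on_edge[of e v] DE v(1) by blast
    thus ?thesis using e(1) Dset by blast
  qed
  have misses: "path_image (\<gamma> e) \<inter> R' = {}" if "e \<in> side R" "open R'" "R \<inter> R' = {}" for e R R'
    using edge_misses_other_side[of e R' R] that unfolding side_def by blast
  \<comment> \<open>\<open>R'\<close> is the side on which the edges of \<open>C\<close> outside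
    \<open>c\<close> lie, and \<open>R\<close> is the side colored second; for \<open>c = C\<close>
    the choice is arbitrary.\<close>
  have core: thesis
    if R: "open R" "open R'" "R \<inter> R' = {}" "R \<union> R' = - J" "R \<inter> edge_image E \<noteq> {}" "R' \<inter> edge_image E \<noteq> {}"
      and CR: "cycle_edges C \<subseteq> D \<union> side R'" for R R'
  proof -
    have RR: "R' \<inter> R = {}" using R(3) by blast
    have all: "e \<in> D \<or> e \<in> side R \<or> e \<in> side R'" if e: "e \<in> E" for e
      using edge_one_side[OF e R(1-3) R(4)[unfolded J_def] DE] e unfolding side_def by blast
    have proper: "\<exists>e\<in>E. e \<notin> D \<union> side S'"
      if S: "open S" "S' \<inter> S = {}" "S \<inter> J = {}" "S \<inter> edge_image E \<noteq> {}" for S S'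
    proof -
      obtain e where e: "e \<in> E" "path_image (\<gamma> e) \<inter> S \<noteq> {}" using S(4) unfolding edge_image_def by blast
      have "e \<notin> D" using e(2) S(3) unfolding J_def edge_image_def by blast
      moreover have "e \<notin> side S'" using misses[OF _ S(1,2)] e(2) by blast
      ultimately show ?thesis using e(1) by blast
    qed
    define U where "U = {v \<in> V. pos v \<in> R}"
    show thesis
    proof (rule split[of "D \<union> side R'" "D \<union> side R" U])
      have sub: "D \<union> side R' \<subseteq> E" "D \<union> side R \<subseteq> E" using DE unfolding side_def by blast+
      show "E = D \<union> side R' \<union> (D \<union> side R)" using all sub by blast
      have RJ: "R \<inter> J = {}" "R' \<inter> J = {}" using R(4) by blast+
      show "D \<union> side R' \<subset> E" using proper[OF R(1) RR RJ(1) R(5)] sub by blast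
      show "D \<union> side R \<subset> E" using proper[OF R(2,3) RJ(2) R(6)] sub by blast
      show "cycle_edges c \<subseteq> D \<union> side R'" "cycle_edges c \<subseteq> D \<union> side R" unfolding D_def by auto
      show "cycle_edges C \<subseteq> D \<union> side R'" by (rule CR)
      show "v \<notin> U" if e: "e \<in> D \<union> side R'" "v \<in> e" for e v
      proof
        assume "v \<in> U"
        hence vR: "pos v \<in> R" unfolding U_def by blast
        have on: "pos v \<in> path_image (\<gamma> e)" using end_on_edge[of e v] e sub by blast
        show False
        proof (cases "e \<in> D")
          case True
          thus False using on vR RJ(1) unfolding J_def edge_image_def by blast
        next
          case False
          hence "path_image (\<gamma> e) \<inter> R = {}" using misses[OF _ R(1) RR] e(1) by blast
          thus False using on vR by blast
        qed
      qed
      show "v \<in> set c" if e: "e \<in> D \<union> side R" "v \<in> e" "v \<notin> U" for e v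
      proof (cases "e \<in> D")
        case True thus ?thesis using e(2) Dset by blast
      next
        case False
        have eE: "e \<in> E" using e(1) sub by blast
        have vV: "v \<in> V" using edge_subset[OF eE] e(2) by blast
        have "path_image (\<gamma> e) \<inter> R' = {}" using misses[OF _ R(2,3)] e(1) False by blast
        hence "pos v \<notin> R'" using end_on_edge[OF eE e(2)] by blast
        moreover have "pos v \<notin> R" using e(3) vV unfolding U_def by blast
        ultimately have "pos v \<in> J" using R(4) by blast
        thus ?thesis by (rule on_J[OF vV])
      qed
    qed
  qed
  have jo4: "inside J \<union> outside J = - edge_image D" using jo(4) unfolding J_def .
  have io: "outside J \<inter> inside J = {}" "outside J \<union> inside J = - J" using jo by blast+
  show thesis
  proof (cases "cycle_edges c = cycle_edges C")
    case True
    thus thesis using core[OF jo ne] unfolding D_def by blast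
  next
    case False
    have disj: "cycle_edges c \<inter> cycle_edges C = {}"
      using p_cycles_edge_disjoint[OF sc N p c(1,2) C False] .
    have CE: "cycle_edges C \<subseteq> E" using C(1) unfolding is_cycle_iff by blast
    have sides: "e \<in> side (inside J) \<or> e \<in> side (outside J)" if e: "e \<in> cycle_edges C" for e
    proof -
      have "e \<in> E" "e \<notin> D" using e CE disj unfolding D_def by blast+
      thus ?thesis using edge_one_side[OF _ jo(1-3) jo4 DE] unfolding side_def by blast
    qed
    \<comment> \<open>The edges of \<open>C\<close> inside \<open>c\<close>. A vertex off
      \<open>c\<close> lies strictly on one side together with all its edges of \<open>C\<close>, so
      \<open>A\<close> has even degree there and \<open>C\<close> cannot have edges on both
      sides.\<close>
    define A where "A = cycle_edges C \<inter> side (inside J)"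
    have "A = {} \<or> A = cycle_edges C"
    proof (rule p_cycle_one_side[OF sc N p c(1,2) C disj])
      show "A \<subseteq> cycle_edges C" unfolding A_def by blast
      fix v assume v: "v \<notin> set c"
      have notO: "pos v \<notin> outside J" if "e \<in> side (inside J)" "v \<in> e" for e
        using misses[OF that(1) jo(2,3)] end_on_edge[of e v] that unfolding side_def by blast
      have notI: "pos v \<notin> inside J" if "e \<in> side (outside J)" "v \<in> e" for e
        using misses[OF that(1) jo(1) io(1)] end_on_edge[of e v] that unfolding side_def by blast
      have evC: "even (deg (cycle_edges C) v)"
        using even_edges_cycle[OF C(1) edge_set_E] unfolding even_edges_def by blast
      show "even (deg A v)"
      proof (cases "pos v \<in> inside J")
        case True
        have "{e \<in> A. v \<in> e} = {e \<in> cycle_edges C. v \<in> e}"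
          using sides notI True unfolding A_def by blast
        thus ?thesis using evC unfolding deg_def by simp
      next
        case False
        have "v \<notin> \<Union>A"
        proof
          assume "v \<in> \<Union>A"
          then obtain e where e: "e \<in> cycle_edges C" "e \<in> side (inside J)" "v \<in> e" unfolding A_def by blast
          hence "v \<in> V" using CE edge_subset[of e] by blast
          hence "pos v \<in> outside J" using v on_J[of v] False jo(4) by blast
          thus False using notO e by blast
        qed
        thus ?thesis by (simp add: deg_eq_0)
      qed
    qed
    thus thesis
    proof
      assume "A = {}"
      hence "cycle_edges C \<subseteq> D \<union> side (outside J)" using sides unfolding A_def by blast
      thus thesis by (rule core[OF jo ne])
    next
      assume "A = cycle_edges C"
      hence "cycle_edges C \<subseteq> D \<union> side (inside J)" unfolding A_def by blast
      thus thesis by (rule core[OF jo(2,1) io ne(2,1)])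
    qed
  qed
qed

end

text \<open>\<open>C\<close> and \<open>\<kappa>\<close> vary in the induction: the second part is
  colored with \<open>c\<close> as the precolored cycle, its colors taken from the first
  part.\<close>

theorem plane_extension:
  fixes V :: "'a set"
  assumes p: "prime p" "p \<ge> 5" and N: "N = 2 * (p - 1) * (p + 2)"
    and "plane_graph V E pos \<gamma>" "short_cycles p N E"
    and "is_cycle E C" "length C = p" "step_coloring p (cycle_edges C) \<kappa>"
  shows "\<exists>\<psi>. step_coloring p E \<psi> \<and> (\<forall>v\<in>set C. [\<psi> v = \<kappa> v] (mod int p))"
  using assms(4-)
proof (induction "card E" arbitrary: E C \<kappa> rule: less_induct)
  case less
  note pg = less.prems(1) and sc = less.prems(2) and C = less.prems(3,4) and col = less.prems(5)
  interpret plane_graph V E pos \<gamma> by fact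
  have oddp: "odd p" using p prime_odd_nat by force
  have N2: "2 * p \<le> N" using double_le_bound p(2) unfolding N by simp
  have finE: "finite E" using finite_edges by blast
  show ?case
  proof (cases "\<forall>c. is_cycle E c \<longrightarrow> length c = p \<longrightarrow> nonseparating c")
    case True
    thus ?thesis using nonseparating_extension[OF p N pg sc _ C col] by blast
  next
    case False
    then obtain c where c: "is_cycle E c" "length c = p" "\<not> nonseparating c" by blast
    obtain E1 E2 U where E12: "E = E1 \<union> E2" "E1 \<subset> E" "E2 \<subset> E" "cycle_edges c \<subseteq> E1" "cycle_edges c \<subseteq> E2"
      "cycle_edges C \<subseteq> E1" and U: "\<And>e v. e \<in> E1 \<Longrightarrow> v \<in> e \<Longrightarrow> v \<notin> U"
      "\<And>e v. e \<in> E2 \<Longrightarrow> v \<in> e \<Longrightarrow> v \<notin> U \<Longrightarrow> v \<in> set c"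
      by (rule separating_split[OF sc N2 oddp c C]) (rule that)
    have sub: "E1 \<subseteq> E" "E2 \<subseteq> E" using E12 by auto
    have "is_cycle E1 C" using C(1) E12(6) unfolding is_cycle_iff by blast
    then obtain \<psi>1 where psi1: "step_coloring p E1 \<psi>1" "\<forall>v\<in>set C. [\<psi>1 v = \<kappa> v] (mod int p)"
      using less.hyps[OF psubset_card_mono[OF finE E12(2)] plane_graph_subset(1)[OF pg sub(1)]
        short_cycles_subset[OF sc sub(1)] _ C(2) col] by blast
    have "is_cycle E2 c" using c(1) E12(5) unfolding is_cycle_iff by blast
    then obtain \<psi>2 where psi2: "step_coloring p E2 \<psi>2" "\<forall>v\<in>set c. [\<psi>2 v = \<psi>1 v] (mod int p)"
      using less.hyps[OF psubset_card_mono[OF finE E12(3)] plane_graph_subset(1)[OF pg sub(2)]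
        short_cycles_subset[OF sc sub(2)] _ c(2) step_coloring_subset[OF psi1(1) E12(4)]] by blast
    have "step_coloring p (E1 \<union> E2) (\<lambda>v. if v \<in> U then \<psi>2 v else \<psi>1 v)"
      by (rule step_coloring_glue[OF psi1(1) psi2(1) U]) (use psi2(2) in blast)+
    moreover have "v \<notin> U" if "v \<in> set C" for v
      using that Union_cycle_edges[OF C(1)] E12(6) U(1) by blast
    ultimately show ?thesis using psi1(2) E12(1)
      by (intro exI[of _ "\<lambda>v. if v \<in> U then \<psi>2 v else \<psi>1 v"]) auto
  qed
qed

section \<open>Passing between \<open>C_p\<close>-colorings and step colorings\<close>

text \<open>Doubling turns the differences \<open>\<plusminus>(p \<plusminus> 1)/2\<close> of a \<open>C\<^sub>p\<close>-coloring into \<open>\<plusminus>1\<close> modulo \<open>p\<close>; multiplication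
  by \<open>(p + 1)/2\<close> is the inverse.\<close>

lemma step_coloring_double:
  assumes p: "odd p" and col: "Cp_coloring p V E \<omega>" and F: "F \<subseteq> E"
  shows "step_coloring p F (\<lambda>v. 2 * int (\<omega> v))"
  unfolding step_coloring_def
proof (intro allI impI)
  fix u v assume "{u, v} \<in> F"
  hence "(real p - 1) / 2 \<le> \<bar>real (\<omega> u) - real (\<omega> v)\<bar>" "\<bar>real (\<omega> u) - real (\<omega> v)\<bar> \<le> (real p + 1) / 2"
    using col F unfolding Cp_coloring_def by blast+
  hence "real_of_int (int p - 1) \<le> real_of_int (2 * \<bar>int (\<omega> u) - int (\<omega> v)\<bar>)"
    "real_of_int (2 * \<bar>int (\<omega> u) - int (\<omega> v)\<bar>) \<le> real_of_int (int p + 1)"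
    by simp_all
  hence b: "int p - 1 \<le> 2 * \<bar>int (\<omega> u) - int (\<omega> v)\<bar>" "2 * \<bar>int (\<omega> u) - int (\<omega> v)\<bar> \<le> int p + 1"
    by (simp_all only: of_int_le_iff)
  define d where "d = 2 * int (\<omega> u) - 2 * int (\<omega> v)"
  have "\<bar>d\<bar> = 2 * \<bar>int (\<omega> u) - int (\<omega> v)\<bar>" unfolding d_def by (auto simp: abs_if)
  hence "\<bar>d\<bar> = int p - 1 \<or> \<bar>d\<bar> = int p \<or> \<bar>d\<bar> = int p + 1" using b by linarith
  \<comment> \<open>A difference of doubled colors is even, while \<open>p\<close> is odd.\<close>
  moreover have "\<bar>d\<bar> \<noteq> int p"
  proof
    assume "\<bar>d\<bar> = int p"
    moreover have "even \<bar>d\<bar>" unfolding d_def by simp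
    ultimately show False using p by simp
  qed
  ultimately consider "d = int p - 1" | "d = - int p + 1" | "d = int p + 1" | "d = - int p - 1" by linarith
  hence "[d = 1] (mod int p) \<or> [d = -1] (mod int p)"
    by cases (auto simp: cong_iff_dvd_diff)
  thus "[2 * int (\<omega> u) - 2 * int (\<omega> v) = 1] (mod int p) \<or> [2 * int (\<omega> u) - 2 * int (\<omega> v) = -1] (mod int p)"
    unfolding d_def .
qed

lemma Cp_coloring_of_step_coloring:
  assumes p: "p = 2 * q + 1" "q > 0" and col: "step_coloring p E \<psi>"
    and \<phi>: "\<And>v. \<phi> v = nat ((\<psi> v * (int q + 1)) mod int p)"
  shows "Cp_coloring p V E \<phi>"
  unfolding Cp_coloring_def
proof (intro conjI allI impI)
  have p0: "int p > 0" using p by simp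
  have val: "int (\<phi> v) = (\<psi> v * (int q + 1)) mod int p" for v unfolding \<phi> using p0 by simp
  have lt: "int (\<phi> v) < int p" for v unfolding val using p0 by simp
  show "\<phi> ` V \<subseteq> {0..p - 1}"
  proof
    fix n assume "n \<in> \<phi> ` V"
    then obtain v where "n = \<phi> v" by blast
    thus "n \<in> {0..p - 1}" using lt[of v] by simp
  qed
  fix u v assume "{u, v} \<in> E"
  hence "[\<psi> u - \<psi> v = 1] (mod int p) \<or> [\<psi> u - \<psi> v = -1] (mod int p)"
    using col unfolding step_coloring_def by blast
  then obtain e where e: "e = 1 \<or> e = (-1 :: int)" "[\<psi> u - \<psi> v = e] (mod int p)" by blast
  have "[int (\<phi> u) - int (\<phi> v) = \<psi> u * (int q + 1) - \<psi> v * (int q + 1)] (mod int p)"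
    unfolding val by (intro cong_diff) (simp_all add: cong_def)
  moreover have "\<psi> u * (int q + 1) - \<psi> v * (int q + 1) = (\<psi> u - \<psi> v) * (int q + 1)"
    by (simp add: algebra_simps)
  moreover have "[(\<psi> u - \<psi> v) * (int q + 1) = e * (int q + 1)] (mod int p)"
    using e(2) by (rule cong_scalar_right)
  ultimately have "[int (\<phi> u) - int (\<phi> v) = e * (int q + 1)] (mod int p)" by (metis cong_trans)
  then obtain k where k: "int (\<phi> u) - int (\<phi> v) - e * (int q + 1) = int p * k"
    unfolding cong_iff_dvd_diff by (rule dvdE)
  define d where "d = int (\<phi> u) - int (\<phi> v)"
  have d: "\<bar>d\<bar> < int p" using lt[of u] lt[of v] unfolding d_def by linarith
  have dk: "d = e * (int q + 1) + int p * k" using k unfolding d_def by simp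
  \<comment> \<open>From \<open>\<bar>d\<bar> < p\<close> only \<open>k = -1, 0, 1\<close> remain,
    and then \<open>\<bar>d\<bar>\<close> is \<open>q\<close> or \<open>q + 1\<close>, that is
    \<open>(p - 1) / 2\<close> or \<open>(p + 1) / 2\<close>.\<close>
  have "k < 2"
  proof (rule ccontr)
    assume "\<not> k < 2"
    hence "int p * 2 \<le> int p * k" using p0 by (intro mult_left_mono) auto
    thus False using d dk e(1) p by auto
  qed
  moreover have "k > -2"
  proof (rule ccontr)
    assume "\<not> k > -2"
    hence "int p * k \<le> int p * (-2)" using p0 by (intro mult_left_mono) auto
    thus False using d dk e(1) p by auto
  qed
  ultimately have "k = -1 \<or> k = 0 \<or> k = 1" by linarith
  hence "\<bar>d\<bar> = int q \<or> \<bar>d\<bar> = int q + 1" using d dk e(1) p by auto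
  moreover have "\<bar>real (\<phi> u) - real (\<phi> v)\<bar> = real_of_int \<bar>d\<bar>" unfolding d_def by simp
  ultimately have "\<bar>real (\<phi> u) - real (\<phi> v)\<bar> = real q \<or> \<bar>real (\<phi> u) - real (\<phi> v)\<bar> = real q + 1"
    by auto
  thus "(real p - 1) / 2 \<le> \<bar>real (\<phi> u) - real (\<phi> v)\<bar>" "\<bar>real (\<phi> u) - real (\<phi> v)\<bar> \<le> (real p + 1) / 2"
    unfolding p(1) by auto
qed

theorem theorem3p4:
  fixes p :: nat and V :: "'a set" and E :: "'a set set"
    and pos :: "'a \<Rightarrow> complex" and \<gamma> :: "'a set \<Rightarrow> real \<Rightarrow> complex"
    and C :: "'a list" and \<omega> :: "'a \<Rightarrow> nat"
  assumes "prime p" and "p \<ge> 5"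
    and "plane_graph V E pos \<gamma>"
    and "girth E = enat p"
    and "\<And>l c. p + 1 \<le> l \<Longrightarrow> l \<le> 2 * (p - 1) * (p + 2) - 1 \<Longrightarrow> \<not> (is_cycle E c \<and> length c = l)"
    and "is_cycle E C" and "length C = p"
    and "Cp_coloring p (set C) (induced_edges E (set C)) \<omega>"
  shows "\<exists>\<phi>. Cp_coloring p V E \<phi> \<and> (\<forall>v\<in>set C. \<phi> v = \<omega> v)"
proof -
  interpret plane_graph V E pos \<gamma> by fact
  have oddp: "odd p" using assms(1,2) prime_odd_nat by force
  then obtain q where q: "p = 2 * q + 1" by (rule oddE)
  have q0: "q > 0" using q assms(2) by simp
  have sc: "short_cycles p (2 * (p - 1) * (p + 2)) E"
    unfolding short_cycles_def
  proof (intro conjI edge_set_E allI impI)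
    fix c assume c: "is_cycle E c"
    have "girth E \<le> enat (length c)" unfolding girth_def by (rule INF_lower) (use c in simp)
    hence "p \<le> length c" using assms(4) by simp
    thus "length c = p \<or> 2 * (p - 1) * (p + 2) \<le> length c" using assms(5)[of "length c" c] c by fastforce
  qed
  have "cycle_edges C \<subseteq> induced_edges E (set C)"
    using assms(6) Union_cycle_edges[OF assms(6)] unfolding induced_edges_def is_cycle_iff by blast
  hence "step_coloring p (cycle_edges C) (\<lambda>v. 2 * int (\<omega> v))"
    by (rule step_coloring_double[OF oddp assms(8)])
  then obtain \<psi> where psi: "step_coloring p E \<psi>" "\<And>v. v \<in> set C \<Longrightarrow> [\<psi> v = 2 * int (\<omega> v)] (mod int p)"
    using plane_extension[OF assms(1,2) refl assms(3) sc assms(6,7)] by blast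
  define \<phi> where "\<phi> v = nat ((\<psi> v * (int q + 1)) mod int p)" for v
  have "Cp_coloring p V E \<phi>" by (rule Cp_coloring_of_step_coloring[OF q q0 psi(1) \<phi>_def])
  moreover have "\<phi> v = \<omega> v" if v: "v \<in> set C" for v
  proof -
    have "[\<psi> v * (int q + 1) = 2 * int (\<omega> v) * (int q + 1)] (mod int p)"
      using psi(2)[OF v] by (rule cong_scalar_right)
    \<comment> \<open>\<open>2 * (q + 1) = p + 1\<close>, so \<open>q + 1\<close> inverts the
      doubling modulo \<open>p\<close>.\<close>
    also have "2 * int (\<omega> v) * (int q + 1) = int (\<omega> v) + int p * int (\<omega> v)"
      unfolding q by (simp add: algebra_simps)
    finally have "(\<psi> v * (int q + 1)) mod int p = int (\<omega> v) mod int p" by (simp add: cong_def)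
    moreover have "\<omega> v < p"
      using assms(2,8) v unfolding Cp_coloring_def by fastforce
    ultimately show ?thesis unfolding \<phi>_def by simp
  qed
  ultimately show ?thesis by blast
qed

end
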